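(* Let $G$ and $G'$ be connected (undirected) graphs. The assignments $\mathfrak N\colon(\varphi_0,\varphi_1)\mapsto(\varphi_0,\hat\varphi)$ and $\mathfrak O\colon(\varphi_0,\hat\varphi)\mapsto(\varphi_0,\varphi_1)$ (defined in the context) are inverse bijections between new graph maps from $G$ to $G'$ and graphical maps from $G$ to $G'$. Moreover, these assignments identify the category of connected graphs and new graph maps with the graphical category $\mathbf U$.
   Context: **Graphs.** A graph $G$ consists of finite sets $A_G$ (arcs) and $V_G$ (vertices), a fixpoint-free involution $a\mapsto a^\dagger$ on $A_G$, a subset $D_G\subseteq A_G$, and a function $t\colon D_G\to V_G$. For $v\in V_G$, $\mathrm{nb}(v)=t^{-1}(v)$; the boundary is $\partial(G)=A_G\setminus D_G$. A graph is connected if it is non-empty and is not a disjoint union of two non-empty graphs. The edge $\updownarrow$ is the graph with two arcs interchanged by $\dagger$ and $D=V=\varnothing$. An étale map $f\colon H\to G$ consists of functions on $A$, $D$, $V$ compatible with the involutions, the inclusions and $t$, restricting to a bijection $\mathrm{nb}(v)\to\mathrm{nb}(f(v))$ for each $v\in V_H$. An embedding is an étale map between connected graphs that is injective on vertices. $\mathrm{Emb}(G)$ is the set of classes $[f]$ of embeddings with codomain $G$, where $f\sim h$ iff $f=hz$ for an isomorphism $z$; it is ordered by $[h]\le[k]$ iff $h=kj$ for some embedding $j$. A class $[f\colon H\to G]$ is an edge if $H\cong\updownarrow$. For $v\in V_G$, $\iota_v\colon\star_v\to G$ is the embedding whose domain has vertex set $\{v\}$, $D_{\star_v}=\mathrm{nb}(v)$,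 arc set $\mathrm{nb}(v)\amalg\{b_d:d\in\mathrm{nb}(v)\}$ with $d^\dagger=b_d$, and $\iota_v(d)=d$, $\iota_v(b_d)=d^\dagger$; $v\mapsto[\iota_v]$ is an inclusion $V_G\hookrightarrow\mathrm{Emb}(G)$. $\mathbb NS$ is the free commutative monoid on $S$, and subsets of a finite set $S$ are identified with repetition-free elements of $\mathbb NS$. For $f\colon H\to G$ put $\varsigma[f]=f(V_H)\subseteq V_G$ and $\partial([f])=f(\partial(H))\subseteq A_G$. **Graphical maps and $\mathbf U$.** A graphical map $\varphi\colon G\to G'$ is a pair of an involutive function $\varphi_0\colon A_G\to A_{G'}$ and a function $\varphi_1\colon V_G\to\mathrm{Emb}(G')$ such that: (a) $\sum_{v\in V_G}\varsigma(\varphi_1(v))\le\sum_{w\in V_{G'}}w$ in $\mathbb NV_{G'}$ (i.e. the sets $\varsigma(\varphi_1(v))$ are pairwise disjoint); (b) for each $v$, $a\mapsto\varphi_0(a^\dagger)$ gives a bijection $\mathrm{nb}(v)\to\partial(\varphi_1(v))$; (c) if $\partial(G)=\varnothing$, there is $v$ with $\varphi_1(v)$ not an edge. $\mathbf U$ is the category of connected graphs and graphical maps; the composite of $\varphi\colon G\to G'$ and $\psi\colon G'\to G''$ has $(\psi\varphi)_0=\psi_0\varphi_0$, and $(\psi\varphi)_1(v)$ is the unique class in $\mathrm{Emb}(G'')$ with boundary $\psi_0(\partial(\varphi_1(v)))$ and vertex set $\coprod_{w\in\varsigma(\varphi_1(v))}\varsigma(\psi_1(w))$. An embedding $f\colon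 H\to G$ is regarded as the graphical map given by $f$ on arcs and $v\mapsto[\iota_{f(v)}]$; these are the inert maps. A graphical map is active if $\varphi_0$ restricts to a bijection $\partial(G)\to\partial(G')$. It is known that (active, inert) is an orthogonal factorization system on $\mathbf U$. **New graph maps.** An embedding $\ell\colon L\to G$ is a union of embeddings $h\colon H\to G$ and $k\colon K\to G$ if $[h],[k]\le[\ell]$ and $\ell(V_L)=h(V_H)\cup k(V_K)$; $h,k$ are vertex disjoint if $h(V_H)\cap k(V_K)=\varnothing$. A new graph map $G\to G'$ is a pair $(\varphi_0,\hat\varphi)$, $\varphi_0\colon A_G\to A_{G'}$ involutive, $\hat\varphi\colon\mathrm{Emb}(G)\to\mathrm{Emb}(G')$ a function, such that: (i) $\hat\varphi$ sends edges to edges; (ii) if $[\ell]$ is a union of $[h]$ and $[k]$, then $\hat\varphi[\ell]$ is a union of $\hat\varphi[h]$ and $\hat\varphi[k]$; (iii) $\hat\varphi$ takes vertex disjoint pairs to vertex disjoint pairs; (iv) $\partial(\hat\varphi[h])=(\mathbb N\varphi_0)(\partial[h])$ for all $[h]$. Composition is composition of the two constituent functions. **$\mathfrak O$ and $\mathfrak N$.** For a new graph map, $\mathfrak O(\varphi_0,\hat\varphi)=(\varphi_0,\varphi_1)$ with $\varphi_1(v)=\hat\varphi[\iota_v]$. For a graphical map $\varphi$, $\mathfrak N(\varphi_0,\varphi_1)=(\varphi_0,\hat\varphi)$, where for an embedding $f$ into $G$ one sets $\hat\varphi[f]=[g]$, with $\varphi\circ f=g\circ\alpha$, $\alpha$ active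 and $g$ an embedding, the active–inert factorization in $\mathbf U$. *)

theory Defs
  imports "HOL-Library.FuncSet" "HOL-Library.Multiset" "HOL-Library.Infinite_Typeclass"
begin

text \<open>
  Functions defined on a set are represented by extensional functions
  (\<open>\<rightarrow>\<^sub>E\<close>, \<open>restrict\<close>, \<open>compose\<close>), so that equality in HOL is equality of
  functions on that set.

  Arcs are elements of a type \<open>'a\<close> and vertices elements of a type \<open>'v\<close>; both types serve as
  universes. When \<open>'a\<close> is infinite, every finite graph whose vertices are drawn from \<open>'v\<close> is
  isomorphic to one with arcs in \<open>'a\<close>, and since embeddings are injective on vertices, the domain
  of any embedding into such a graph occurs up to isomorphism as well.
\<close>

section \<open>Graphs and etale maps\<close>

text \<open>\<open>attached G\<close> is the subset $D_G$ of the arcs and \<open>tgt G\<close> is the map $t$.\<close>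

record ('a, 'v) graph =
  arcs :: "'a set"
  verts :: "'v set"
  dagger :: "'a \<Rightarrow> 'a"
  attached :: "'a set"
  tgt :: "'a \<Rightarrow> 'v"

definition is_graph :: "('a, 'v) graph \<Rightarrow> bool" where
  "is_graph G \<longleftrightarrow>
     finite (arcs G) \<and> finite (verts G) \<and>
     dagger G \<in> arcs G \<rightarrow>\<^sub>E arcs G \<and>
     (\<forall>a\<in>arcs G. dagger G (dagger G a) = a \<and> dagger G a \<noteq> a) \<and>
     attached G \<subseteq> arcs G \<and>
     tgt G \<in> attached G \<rightarrow>\<^sub>E verts G"

definition nb :: "('a, 'v) graph \<Rightarrow> 'v \<Rightarrow> 'a set" where
  "nb G v = {d \<in> attached G. tgt G d = v}"

definition bdry :: "('a, 'v) graph \<Rightarrow> 'a set" where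
  "bdry G = arcs G - attached G"

definition nonempty_graph :: "('a, 'v) graph \<Rightarrow> bool" where
  "nonempty_graph G \<longleftrightarrow> arcs G \<noteq> {} \<or> verts G \<noteq> {}"

definition is_disjoint_union ::
  "('a, 'v) graph \<Rightarrow> ('a, 'v) graph \<Rightarrow> ('a, 'v) graph \<Rightarrow> bool" where
  "is_disjoint_union G H K \<longleftrightarrow>
     arcs G = arcs H \<union> arcs K \<and> arcs H \<inter> arcs K = {} \<and>
     verts G = verts H \<union> verts K \<and> verts H \<inter> verts K = {} \<and>
     attached G = attached H \<union> attached K \<and>
     (\<forall>a\<in>arcs H. dagger G a = dagger H a) \<and> (\<forall>a\<in>arcs K. dagger G a = dagger K a) \<and>
     (\<forall>d\<in>attached H. tgt G d = tgt H d) \<and> (\<forall>d\<in>attached K. tgt G d = tgt K d)"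

definition connected_graph :: "('a, 'v) graph \<Rightarrow> bool" where
  "connected_graph G \<longleftrightarrow>
     is_graph G \<and> nonempty_graph G \<and>
     \<not> (\<exists>H K. is_graph H \<and> is_graph K \<and> nonempty_graph H \<and> nonempty_graph K \<and>
              is_disjoint_union G H K)"

definition edge_graph :: "'a \<Rightarrow> 'a \<Rightarrow> ('a, 'v) graph" where
  "edge_graph a b =
     \<lparr>arcs = {a, b}, verts = {}, dagger = (\<lambda>x\<in>{a, b}. if x = a then b else a),
      attached = {}, tgt = (\<lambda>d\<in>{}. undefined)\<rparr>"

text \<open>The component of an etale map on $D$ is the restriction of the component on arcs.\<close>

record ('a, 'v) graph_fun =
  on_arcs :: "'a \<Rightarrow> 'a"
  on_verts :: "'v \<Rightarrow> 'v"

definition etale :: "('a, 'v) graph \<Rightarrow> ('a, 'v) graph \<Rightarrow> ('a, 'v) graph_fun \<Rightarrow> bool" where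
  "etale H G f \<longleftrightarrow>
     is_graph H \<and> is_graph G \<and>
     on_arcs f \<in> arcs H \<rightarrow>\<^sub>E arcs G \<and>
     on_verts f \<in> verts H \<rightarrow>\<^sub>E verts G \<and>
     (\<forall>a\<in>arcs H. on_arcs f (dagger H a) = dagger G (on_arcs f a)) \<and>
     on_arcs f ` attached H \<subseteq> attached G \<and>
     (\<forall>d\<in>attached H. on_verts f (tgt H d) = tgt G (on_arcs f d)) \<and>
     (\<forall>v\<in>verts H. bij_betw (on_arcs f) (nb H v) (nb G (on_verts f v)))"

definition id_fun :: "('a, 'v) graph \<Rightarrow> ('a, 'v) graph_fun" where
  "id_fun G = \<lparr>on_arcs = (\<lambda>a\<in>arcs G. a), on_verts = (\<lambda>v\<in>verts G. v)\<rparr>"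

text \<open>\<open>comp_fun H g f\<close> is $g \circ f$ for $f$ with domain $H$.\<close>

definition comp_fun ::
  "('a, 'v) graph \<Rightarrow> ('a, 'v) graph_fun \<Rightarrow> ('a, 'v) graph_fun \<Rightarrow> ('a, 'v) graph_fun" where
  "comp_fun H g f =
     \<lparr>on_arcs = compose (arcs H) (on_arcs g) (on_arcs f),
      on_verts = compose (verts H) (on_verts g) (on_verts f)\<rparr>"

definition graph_iso :: "('a, 'v) graph \<Rightarrow> ('a, 'v) graph \<Rightarrow> ('a, 'v) graph_fun \<Rightarrow> bool" where
  "graph_iso H K z \<longleftrightarrow>
     etale H K z \<and> (\<exists>y. etale K H y \<and> comp_fun H y z = id_fun H \<and> comp_fun K z y = id_fun K)"

definition embedding :: "('a, 'v) graph \<Rightarrow> ('a, 'v) graph \<Rightarrow> ('a, 'v) graph_fun \<Rightarrow> bool" where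
  "embedding H G f \<longleftrightarrow>
     connected_graph H \<and> connected_graph G \<and> etale H G f \<and> inj_on (on_verts f) (verts H)"

section \<open>Classes of embeddings\<close>

type_synonym ('a, 'v) emb = "(('a, 'v) graph \<times> ('a, 'v) graph_fun) set"

text \<open>\<open>emb_class G H f\<close> is the class $[f]$ of the embedding $f\colon H \to G$.\<close>

definition emb_class ::
  "('a, 'v) graph \<Rightarrow> ('a, 'v) graph \<Rightarrow> ('a, 'v) graph_fun \<Rightarrow> ('a, 'v) emb" where
  "emb_class G H f =
     {(K, h). embedding K G h \<and> (\<exists>z. graph_iso H K z \<and> f = comp_fun H h z)}"

definition Emb :: "('a, 'v) graph \<Rightarrow> ('a, 'v) emb set" where
  "Emb G = {emb_class G H f | H f. embedding H G f}"

definition emb_le :: "('a, 'v) emb \<Rightarrow> ('a, 'v) emb \<Rightarrow> bool" where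
  "emb_le c d \<longleftrightarrow>
     (\<exists>H h K k j. (H, h) \<in> c \<and> (K, k) \<in> d \<and> embedding H K j \<and> h = comp_fun H k j)"

definition is_edge :: "('a, 'v) emb \<Rightarrow> bool" where
  "is_edge c \<longleftrightarrow> (\<exists>H f a b z. (H, f) \<in> c \<and> a \<noteq> b \<and> graph_iso H (edge_graph a b) z)"

text \<open>All representatives of a class have the same image on vertices and on the boundary, so the
  unions below are over a constant family.\<close>

definition emb_verts :: "('a, 'v) emb \<Rightarrow> 'v set" where
  "emb_verts c = (\<Union>(H, f)\<in>c. on_verts f ` verts H)"

definition emb_bdry :: "('a, 'v) emb \<Rightarrow> 'a set" where
  "emb_bdry c = (\<Union>(H, f)\<in>c. on_arcs f ` bdry H)"

text \<open>The arc $b_d$ of the star at $v$ is \<open>star_new G v d\<close>; the choice of these new arcs does not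
  affect the class of the embedding of the star. They exist when the type of arcs is infinite.\<close>

definition star_new :: "('a, 'v) graph \<Rightarrow> 'v \<Rightarrow> 'a \<Rightarrow> 'a" where
  "star_new G v = (SOME b. inj_on b (nb G v) \<and> b ` nb G v \<inter> nb G v = {})"

definition star :: "('a, 'v) graph \<Rightarrow> 'v \<Rightarrow> ('a, 'v) graph" where
  "star G v =
     (let b = star_new G v; N = nb G v in
      \<lparr>arcs = N \<union> b ` N, verts = {v},
       dagger = (\<lambda>a\<in>N \<union> b ` N. if a \<in> N then b a else inv_into N b a),
       attached = N, tgt = (\<lambda>d\<in>N. v)\<rparr>)"

definition star_incl :: "('a, 'v) graph \<Rightarrow> 'v \<Rightarrow> ('a, 'v) graph_fun" where
  "star_incl G v =
     (let b = star_new G v; N = nb G v in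
      \<lparr>on_arcs = (\<lambda>a\<in>N \<union> b ` N. if a \<in> N then a else dagger G (inv_into N b a)),
       on_verts = (\<lambda>w\<in>{v}. w)\<rparr>)"

definition star_class :: "('a, 'v) graph \<Rightarrow> 'v \<Rightarrow> ('a, 'v) emb" where
  "star_class G v = emb_class G (star G v) (star_incl G v)"

section \<open>Graphical maps\<close>

definition involutive_fun :: "('a, 'v) graph \<Rightarrow> ('a, 'v) graph \<Rightarrow> ('a \<Rightarrow> 'a) \<Rightarrow> bool" where
  "involutive_fun G G' \<phi>0 \<longleftrightarrow>
     \<phi>0 \<in> arcs G \<rightarrow>\<^sub>E arcs G' \<and> (\<forall>a\<in>arcs G. \<phi>0 (dagger G a) = dagger G' (\<phi>0 a))"

type_synonym ('a, 'v) gmap = "('a \<Rightarrow> 'a) \<times> ('v \<Rightarrow> ('a, 'v) emb)"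

text \<open>The free commutative monoid on a set is represented by multisets.\<close>

definition graphical_maps :: "('a, 'v) graph \<Rightarrow> ('a, 'v) graph \<Rightarrow> ('a, 'v) gmap set" where
  "graphical_maps G G' =
     {(\<phi>0, \<phi>1).
        involutive_fun G G' \<phi>0 \<and>
        \<phi>1 \<in> verts G \<rightarrow>\<^sub>E Emb G' \<and>
        (\<Sum>v\<in>verts G. mset_set (emb_verts (\<phi>1 v))) \<subseteq># mset_set (verts G') \<and>
        (\<forall>v\<in>verts G. bij_betw (\<lambda>a. \<phi>0 (dagger G a)) (nb G v) (emb_bdry (\<phi>1 v))) \<and>
        (bdry G = {} \<longrightarrow> (\<exists>v\<in>verts G. \<not> is_edge (\<phi>1 v)))}"

text \<open>\<open>gmap_comp G G'' \<psi> \<phi>\<close> is $\psi\varphi$ for $\varphi$ with domain $G$ and $\psi$ with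
  codomain $G''$.\<close>

definition gmap_comp ::
  "('a, 'v) graph \<Rightarrow> ('a, 'v) graph \<Rightarrow> ('a, 'v) gmap \<Rightarrow> ('a, 'v) gmap \<Rightarrow> ('a, 'v) gmap" where
  "gmap_comp G G'' \<psi> \<phi> =
     (compose (arcs G) (fst \<psi>) (fst \<phi>),
      \<lambda>v\<in>verts G. THE c. c \<in> Emb G'' \<and>
        emb_bdry c = fst \<psi> ` emb_bdry (snd \<phi> v) \<and>
        emb_verts c = (\<Union>w\<in>emb_verts (snd \<phi> v). emb_verts (snd \<psi> w)))"

text \<open>\<open>gmap_of_emb H G f\<close> is the inert graphical map given by the embedding $f\colon H \to G$.\<close>

definition gmap_of_emb ::
  "('a, 'v) graph \<Rightarrow> ('a, 'v) graph \<Rightarrow> ('a, 'v) graph_fun \<Rightarrow> ('a, 'v) gmap" where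
  "gmap_of_emb H G f = (on_arcs f, \<lambda>v\<in>verts H. star_class G (on_verts f v))"

definition active_maps :: "('a, 'v) graph \<Rightarrow> ('a, 'v) graph \<Rightarrow> ('a, 'v) gmap set" where
  "active_maps G G' = {\<phi> \<in> graphical_maps G G'. bij_betw (fst \<phi>) (bdry G) (bdry G')}"

section \<open>New graph maps\<close>

definition is_union :: "('a, 'v) emb \<Rightarrow> ('a, 'v) emb \<Rightarrow> ('a, 'v) emb \<Rightarrow> bool" where
  "is_union l h k \<longleftrightarrow> emb_le h l \<and> emb_le k l \<and> emb_verts l = emb_verts h \<union> emb_verts k"

definition vertex_disjoint :: "('a, 'v) emb \<Rightarrow> ('a, 'v) emb \<Rightarrow> bool" where
  "vertex_disjoint h k \<longleftrightarrow> emb_verts h \<inter> emb_verts k = {}"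

type_synonym ('a, 'v) nmap = "('a \<Rightarrow> 'a) \<times> (('a, 'v) emb \<Rightarrow> ('a, 'v) emb)"

definition new_graph_maps :: "('a, 'v) graph \<Rightarrow> ('a, 'v) graph \<Rightarrow> ('a, 'v) nmap set" where
  "new_graph_maps G G' =
     {(\<phi>0, \<phi>h).
        involutive_fun G G' \<phi>0 \<and>
        \<phi>h \<in> Emb G \<rightarrow>\<^sub>E Emb G' \<and>
        (\<forall>c\<in>Emb G. is_edge c \<longrightarrow> is_edge (\<phi>h c)) \<and>
        (\<forall>l\<in>Emb G. \<forall>h\<in>Emb G. \<forall>k\<in>Emb G. is_union l h k \<longrightarrow> is_union (\<phi>h l) (\<phi>h h) (\<phi>h k)) \<and>
        (\<forall>h\<in>Emb G. \<forall>k\<in>Emb G. vertex_disjoint h k \<longrightarrow> vertex_disjoint (\<phi>h h) (\<phi>h k)) \<and>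
        (\<forall>h\<in>Emb G. mset_set (emb_bdry (\<phi>h h)) = image_mset \<phi>0 (mset_set (emb_bdry h)))}"

definition nmap_comp ::
  "('a, 'v) graph \<Rightarrow> ('a, 'v) nmap \<Rightarrow> ('a, 'v) nmap \<Rightarrow> ('a, 'v) nmap" where
  "nmap_comp G \<psi> \<phi> = (compose (arcs G) (fst \<psi>) (fst \<phi>), compose (Emb G) (snd \<psi>) (snd \<phi>))"

section \<open>The two assignments\<close>

definition frakO :: "('a, 'v) graph \<Rightarrow> ('a, 'v) graph \<Rightarrow> ('a, 'v) nmap \<Rightarrow> ('a, 'v) gmap" where
  "frakO G G' \<phi> = (fst \<phi>, \<lambda>v\<in>verts G. snd \<phi> (star_class G v))"

text \<open>The class of the inert part of a factorization is unique because (active, inert) is an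
  orthogonal factorization system.\<close>

definition frakN :: "('a, 'v) graph \<Rightarrow> ('a, 'v) graph \<Rightarrow> ('a, 'v) gmap \<Rightarrow> ('a, 'v) nmap" where
  "frakN G G' \<phi> =
     (fst \<phi>,
      \<lambda>c\<in>Emb G. THE d. \<exists>H f K g \<alpha>.
        (H, f) \<in> c \<and> embedding K G' g \<and> d = emb_class G' K g \<and> \<alpha> \<in> active_maps H K \<and>
        gmap_comp H G' \<phi> (gmap_of_emb H G f) = gmap_comp H G' (gmap_of_emb K G' g) \<alpha>)"

section \<open>Categories\<close>

text \<open>Morphism sets are indexed by domain and codomain and need not be disjoint; composition
  takes the three objects and the morphisms in the order \<open>\<psi>\<close>, \<open>\<phi>\<close> of $\psi\varphi$.\<close>

record ('o, 'm) category =
  Obj :: "'o set"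
  Hom :: "'o \<Rightarrow> 'o \<Rightarrow> 'm set"
  Ident :: "'o \<Rightarrow> 'm"
  Comp :: "'o \<Rightarrow> 'o \<Rightarrow> 'o \<Rightarrow> 'm \<Rightarrow> 'm \<Rightarrow> 'm"

definition is_category :: "('o, 'm) category \<Rightarrow> bool" where
  "is_category C \<longleftrightarrow>
     (\<forall>x\<in>Obj C. Ident C x \<in> Hom C x x) \<and>
     (\<forall>x\<in>Obj C. \<forall>y\<in>Obj C. \<forall>z\<in>Obj C. \<forall>f\<in>Hom C x y. \<forall>g\<in>Hom C y z.
        Comp C x y z g f \<in> Hom C x z) \<and>
     (\<forall>x\<in>Obj C. \<forall>y\<in>Obj C. \<forall>f\<in>Hom C x y.
        Comp C x x y f (Ident C x) = f \<and> Comp C x y y (Ident C y) f = f) \<and>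
     (\<forall>w\<in>Obj C. \<forall>x\<in>Obj C. \<forall>y\<in>Obj C. \<forall>z\<in>Obj C.
        \<forall>f\<in>Hom C w x. \<forall>g\<in>Hom C x y. \<forall>h\<in>Hom C y z.
          Comp C w x z (Comp C x y z h g) f = Comp C w y z h (Comp C w x y g f))"

definition is_functor ::
  "('o, 'm) category \<Rightarrow> ('p, 'n) category \<Rightarrow> ('o \<Rightarrow> 'p) \<Rightarrow> ('o \<Rightarrow> 'o \<Rightarrow> 'm \<Rightarrow> 'n) \<Rightarrow> bool" where
  "is_functor C D F0 F1 \<longleftrightarrow>
     is_category C \<and> is_category D \<and>
     (\<forall>x\<in>Obj C. F0 x \<in> Obj D) \<and>
     (\<forall>x\<in>Obj C. \<forall>y\<in>Obj C. \<forall>f\<in>Hom C x y. F1 x y f \<in> Hom D (F0 x) (F0 y)) \<and>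
     (\<forall>x\<in>Obj C. F1 x x (Ident C x) = Ident D (F0 x)) \<and>
     (\<forall>x\<in>Obj C. \<forall>y\<in>Obj C. \<forall>z\<in>Obj C. \<forall>f\<in>Hom C x y. \<forall>g\<in>Hom C y z.
        F1 x z (Comp C x y z g f) = Comp D (F0 x) (F0 y) (F0 z) (F1 y z g) (F1 x y f))"

definition cat_U :: "(('a, 'v) graph, ('a, 'v) gmap) category" where
  "cat_U =
     \<lparr>Obj = {G. connected_graph G}, Hom = graphical_maps,
      Ident = (\<lambda>G. gmap_of_emb G G (id_fun G)),
      Comp = (\<lambda>G G' G''. gmap_comp G G'')\<rparr>"

definition cat_New :: "(('a, 'v) graph, ('a, 'v) nmap) category" where
  "cat_New =
     \<lparr>Obj = {G. connected_graph G}, Hom = new_graph_maps,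
      Ident = (\<lambda>G. (\<lambda>a\<in>arcs G. a, \<lambda>c\<in>Emb G. c)),
      Comp = (\<lambda>G G' G''. nmap_comp G)\<rparr>"

end

(* An embedding into G is determined, up to isomorphism, by its vertex set S and the image B of its
   boundary, and the pairs (S, B) that occur ("admissible" pairs) are the connected subgraphs of G
   (vertices S, some of the edges between them) together with the edges of G. Every admissible pair
   with S nonempty arises from a star by attaching stars and closing up pairs of opposite boundary
   arcs. Following this process in the codomain, a graphical map carries (S, B) to the admissible
   pair consisting of the union of the vertex sets of phi1(v), v in S, and phi0(B); the only
   obstruction, a cycle all of whose vertices go to edges, is ruled out by condition (c).
   The same induction yields the active map of the factorization, so this pair is the class that N
   assigns to (S, B). Since both axioms (ii) and (iv) pin down a new graph map by its values on
   stars in the same way, the two constructions are mutually inverse, and composition agrees. *)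

theory Submission
  imports Defs
begin

section \<open>Connected graphs\<close>

text \<open>The vertex set alone does not determine a subgraph: an edge joining two vertices of
  \<open>S\<close> may be cut, and then both of its arcs belong to \<open>B\<close>, and the
  embedding takes one attached arc and one boundary arc to each of them. Embeddings are therefore
  injective on attached arcs and on boundary arcs separately, but not on all arcs. This shapes the
  proof: the pair \<open>(S, B)\<close> is needed to name a class, and the active part of a
  factorization requires a choice between two preimages that has to be carried through the
  induction. The other obstacle is that the composite in U and the value of N are definite
  descriptions. They become usable only once the image of an admissible pair is known to be
  admissible, so this comes before any statement about categories. The delicate vertices are those
  sent to edges: gluing an edge to a subgraph changes nothing, while closing up an edge would give a
  circle without vertices, which is not a graph.\<close>

definition darts :: "('a, 'v) graph \<Rightarrow> 'v set \<Rightarrow> 'a set" where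
  "darts G S = {d \<in> attached G. tgt G d \<in> S}"

lemma darts_empty [simp]: "darts G {} = {}"
  by (simp add: darts_def)

lemma darts_Un: "darts G (S \<union> T) = darts G S \<union> darts G T"
  by (auto simp: darts_def)

lemma darts_singleton: "darts G {v} = nb G v"
  by (simp add: darts_def nb_def)

lemma darts_mono: "S \<subseteq> T \<Longrightarrow> darts G S \<subseteq> darts G T"
  by (auto simp: darts_def)

lemma darts_disjoint: "S \<inter> T = {} \<Longrightarrow> darts G S \<inter> darts G T = {}"
  by (auto simp: darts_def)

lemma graph_finite: "is_graph G \<Longrightarrow> finite (arcs G)" "is_graph G \<Longrightarrow> finite (verts G)"
  by (auto simp: is_graph_def)

lemma attached_arcs: "is_graph G \<Longrightarrow> d \<in> attached G \<Longrightarrow> d \<in> arcs G"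
  by (auto simp: is_graph_def)

lemma tgt_verts: "is_graph G \<Longrightarrow> d \<in> attached G \<Longrightarrow> tgt G d \<in> verts G"
  unfolding is_graph_def by auto

lemma dagger_arcs: "is_graph G \<Longrightarrow> a \<in> arcs G \<Longrightarrow> dagger G a \<in> arcs G"
  unfolding is_graph_def by auto

lemma dagger_dagger: "is_graph G \<Longrightarrow> a \<in> arcs G \<Longrightarrow> dagger G (dagger G a) = a"
  unfolding is_graph_def by auto

lemma dagger_neq: "is_graph G \<Longrightarrow> a \<in> arcs G \<Longrightarrow> dagger G a \<noteq> a"
  unfolding is_graph_def by auto

declare dagger_arcs [simp] dagger_dagger [simp] dagger_neq [simp]

lemma darts_arcs: "is_graph G \<Longrightarrow> d \<in> darts G S \<Longrightarrow> d \<in> arcs G"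
  by (auto simp: darts_def attached_arcs)

lemma nb_arcs: "is_graph G \<Longrightarrow> d \<in> nb G v \<Longrightarrow> d \<in> arcs G"
  by (auto simp: nb_def attached_arcs)

lemma darts_verts: "is_graph G \<Longrightarrow> darts G (verts G) = attached G"
  by (auto simp: darts_def tgt_verts)

lemma bdry_arcs: "d \<in> bdry G \<Longrightarrow> d \<in> arcs G"
  by (auto simp: bdry_def)

lemma connected_is_graph [simp]: "connected_graph G \<Longrightarrow> is_graph G"
  by (simp add: connected_graph_def)

text \<open>A proper pair of this kind and its complement would be two nonempty subgraphs with
  disjoint union \<open>G\<close>: the involution also preserves the complement of \<open>X\<close>,
  and an attached arc lies in \<open>X\<close> exactly when its target lies in \<open>W\<close>.
  Connectedness thus becomes a closure principle inside \<open>G\<close>.\<close>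

lemma connected_no_split:
  assumes con: "connected_graph G" and W: "W \<subseteq> verts G" and X: "X \<subseteq> arcs G"
    and dag: "\<forall>a\<in>X. dagger G a \<in> X"
    and att: "X \<inter> attached G = darts G W" and ne: "W \<noteq> {} \<or> X \<noteq> {}"
  shows "W = verts G \<and> X = arcs G"
proof (rule ccontr)
  assume contra: "\<not> ?thesis"
  define part where "part W X = \<lparr>arcs = X, verts = W, dagger = restrict (dagger G) X,
    attached = X \<inter> attached G, tgt = restrict (tgt G) (X \<inter> attached G)\<rparr>" for W X
  have G: "is_graph G" using con by simp
  have part: "is_graph (part W X)"
    if "W \<subseteq> verts G" "X \<subseteq> arcs G" "\<forall>a\<in>X. dagger G a \<in> X" "X \<inter> attached G = darts G W"
    for W X
    using that G unfolding is_graph_def part_def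
    apply (simp add: darts_def subset_iff del: dagger_arcs dagger_dagger dagger_neq)
    apply (intro conjI)
    apply (meson finite_subset subsetI)
    apply (meson finite_subset subsetI)
    by blast+
  have dag': "dagger G a \<in> arcs G - X" if "a \<in> arcs G - X" for a
    using that dag G by (metis DiffD1 DiffD2 DiffI dagger_arcs dagger_dagger)
  have "d \<in> X \<longleftrightarrow> tgt G d \<in> W" if "d \<in> attached G" for d
    using att that unfolding darts_def by blast
  then have att': "(arcs G - X) \<inter> attached G = darts G (verts G - W)"
    using G unfolding darts_def by (auto simp: tgt_verts attached_arcs)
  have "is_graph (part W X)" "is_graph (part (verts G - W) (arcs G - X))"
    using part[OF W X dag att] part[OF _ _ _ att'] dag' by auto
  moreover have "is_disjoint_union G (part W X) (part (verts G - W) (arcs G - X))"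
    unfolding is_disjoint_union_def part_def using W X G
    by (auto simp: attached_arcs)
  moreover have "nonempty_graph (part W X)" "nonempty_graph (part (verts G - W) (arcs G - X))"
    using ne contra W X by (auto simp: nonempty_graph_def part_def)
  ultimately show False using con unfolding connected_graph_def by blast
qed

text \<open>Without vertices no arc is attached, so the orbit of one arc under \<open>dagger\<close>
  is closed in the sense of \<open>connected_no_split\<close> and exhausts the graph.\<close>

lemma connected_no_verts:
  assumes "connected_graph G" "verts G = {}"
  obtains a where "a \<in> arcs G" "arcs G = {a, dagger G a}" "attached G = {}" "bdry G = {a, dagger G a}"
proof -
  have G: "is_graph G" using assms by simp
  have att: "attached G = {}" using tgt_verts[OF G] assms(2) by auto
  have "nonempty_graph G" using assms(1) unfolding connected_graph_def by blast
  then obtain a where a: "a \<in> arcs G" using assms(2) by (auto simp: nonempty_graph_def)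
  have "{a, dagger G a} \<subseteq> arcs G" "\<forall>b\<in>{a, dagger G a}. dagger G b \<in> {a, dagger G a}"
    "{a, dagger G a} \<inter> attached G = darts G {}" using a G att by auto
  then have "arcs G = {a, dagger G a}"
    using connected_no_split[OF assms(1), of "{}" "{a, dagger G a}"] by blast
  then show thesis using that[of a] a att by (auto simp: bdry_def)
qed

lemma connected_arc_attached:
  assumes "connected_graph G" "verts G \<noteq> {}" "a \<in> arcs G"
  shows "a \<in> attached G \<or> dagger G a \<in> attached G"
proof (rule ccontr)
  assume "\<not> ?thesis"
  then have "{a, dagger G a} \<subseteq> arcs G" "\<forall>b\<in>{a, dagger G a}. dagger G b \<in> {a, dagger G a}"
    "{a, dagger G a} \<inter> attached G = darts G {}" using assms by auto
  then show False
    using connected_no_split[OF assms(1), of "{}" "{a, dagger G a}"] assms(2) by blast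
qed

text \<open>Otherwise the darts at \<open>T\<close> and their opposites would form a closed part
  with vertex set \<open>T\<close>. In this form connectedness becomes the last clause of
  \<open>admissible\<close>.\<close>

lemma connected_cross:
  assumes "connected_graph G" "T \<subset> verts G" "T \<noteq> {}"
  obtains (cross) x where "x \<in> darts G T" "dagger G x \<in> darts G (verts G - T)"
proof (rule ccontr)
  assume "\<not> thesis"
  then have no: "dagger G x \<notin> darts G (verts G - T)" if "x \<in> darts G T" for x
    using that cross by blast
  have G: "is_graph G" using assms by simp
  let ?X = "darts G T \<union> dagger G ` darts G T"
  have "?X \<inter> attached G = darts G T"
    using no G by (auto simp: darts_def tgt_verts)
  moreover have "?X \<subseteq> arcs G" using G by (auto simp: darts_arcs)
  moreover have "dagger G a \<in> ?X" if "a \<in> ?X" for a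
    using that G by (auto simp: darts_arcs)
  ultimately show False using connected_no_split[OF assms(1), of T ?X] assms by auto
qed

section \<open>Embeddings and their images\<close>

text \<open>A connected subgraph with vertex set \<open>S \<noteq> {}\<close> and internal arcs \<open>I\<close> is encoded by
  \<open>S\<close> and \<open>B = {d\<^sup>\<dagger> | d \<in> darts G S - I}\<close>; edges are encoded by \<open>S = {}\<close>.\<close>

definition admissible :: "('a, 'v) graph \<Rightarrow> 'v set \<Rightarrow> 'a set \<Rightarrow> bool" where
  "admissible G S B \<longleftrightarrow> S \<subseteq> verts G \<and>
     (if S = {} then \<exists>a\<in>arcs G. B = {a, dagger G a}
      else B \<subseteq> arcs G \<and> (\<forall>b\<in>B. dagger G b \<in> darts G S) \<and>
        (\<forall>x\<in>darts G S. dagger G x \<notin> darts G S \<longrightarrow> dagger G x \<in> B) \<and>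
        (\<forall>x\<in>darts G S. x \<in> B \<longrightarrow> dagger G x \<in> B) \<and>
        (\<forall>T. T \<noteq> {} \<longrightarrow> T \<subset> S \<longrightarrow>
           (\<exists>x\<in>darts G T. dagger G x \<in> darts G (S - T) \<and> dagger G x \<notin> B)))"

text \<open>The order on pairs that corresponds to \<open>emb_le\<close>, see
  \<open>emb_le_iff\<close>. An edge only has to occur in the larger subgraph; a subgraph with
  vertices must be cut wherever the larger one is cut, so that its internal edges remain
  internal.\<close>

definition sub_le :: "('a, 'v) graph \<Rightarrow> 'v set \<Rightarrow> 'a set \<Rightarrow> 'v set \<Rightarrow> 'a set \<Rightarrow> bool" where
  "sub_le G S B S' B' \<longleftrightarrow> S \<subseteq> S' \<and>
     (if S = {} then B \<subseteq> darts G S' \<union> B'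
      else \<forall>x\<in>darts G S. dagger G x \<in> B' \<longrightarrow> dagger G x \<in> B)"

section \<open>Etale maps and embeddings: elementary properties and composition\<close>

lemma etale_graphs: "etale H G f \<Longrightarrow> is_graph H" "etale H G f \<Longrightarrow> is_graph G"
  by (auto simp: etale_def)

lemma etale_arcs: "etale H G f \<Longrightarrow> a \<in> arcs H \<Longrightarrow> on_arcs f a \<in> arcs G"
  by (auto simp: etale_def)

lemma etale_verts: "etale H G f \<Longrightarrow> v \<in> verts H \<Longrightarrow> on_verts f v \<in> verts G"
  by (auto simp: etale_def)

lemma etale_dagger:
  "etale H G f \<Longrightarrow> a \<in> arcs H \<Longrightarrow> on_arcs f (dagger H a) = dagger G (on_arcs f a)"
  by (auto simp: etale_def)

lemma etale_attached: "etale H G f \<Longrightarrow> d \<in> attached H \<Longrightarrow> on_arcs f d \<in> attached G"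
  by (auto simp: etale_def)

lemma etale_tgt: "etale H G f \<Longrightarrow> d \<in> attached H \<Longrightarrow> tgt G (on_arcs f d) = on_verts f (tgt H d)"
  by (auto simp: etale_def)

lemma etale_nb:
  "etale H G f \<Longrightarrow> v \<in> verts H \<Longrightarrow> bij_betw (on_arcs f) (nb H v) (nb G (on_verts f v))"
  by (auto simp: etale_def)

lemma graph_fun_eqI:
  fixes f g :: "('a, 'v) graph_fun"
  assumes "on_arcs f \<in> extensional A" "on_arcs g \<in> extensional A"
    "on_verts f \<in> extensional V" "on_verts g \<in> extensional V"
    "\<And>a. a \<in> A \<Longrightarrow> on_arcs f a = on_arcs g a" "\<And>v. v \<in> V \<Longrightarrow> on_verts f v = on_verts g v"
  shows "f = g"
proof -
  have "on_arcs f = on_arcs g" "on_verts f = on_verts g"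
    using assms by (auto intro: extensionalityI)
  then show ?thesis by simp
qed

lemma etale_extensional:
  "etale H G f \<Longrightarrow> on_arcs f \<in> extensional (arcs H)"
  "etale H G f \<Longrightarrow> on_verts f \<in> extensional (verts H)"
  by (auto simp: etale_def PiE_def)

lemma etale_id: "is_graph G \<Longrightarrow> etale G G (id_fun G)"
  unfolding etale_def id_fun_def
  by (auto simp: attached_arcs tgt_verts nb_def intro!: bij_betw_imageI inj_onI)

lemma etale_comp:
  assumes "etale H K f" "etale K G g"
  shows "etale H G (comp_fun H g f)"
proof -
  have "bij_betw (compose (arcs H) (on_arcs g) (on_arcs f)) (nb H v)
      (nb G (compose (verts H) (on_verts g) (on_verts f) v))" if v: "v \<in> verts H" for v
  proof -
    have "bij_betw (on_arcs g \<circ> on_arcs f) (nb H v) (nb G (on_verts g (on_verts f v)))"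
      by (rule bij_betw_trans[OF etale_nb[OF assms(1) v] etale_nb[OF assms(2)]])
        (use etale_verts[OF assms(1) v] in auto)
    moreover have "bij_betw (compose (arcs H) (on_arcs g) (on_arcs f)) (nb H v) N \<longleftrightarrow>
        bij_betw (on_arcs g \<circ> on_arcs f) (nb H v) N" for N
      by (rule bij_betw_cong) (use etale_graphs[OF assms(1)] in \<open>simp add: compose_eq nb_arcs\<close>)
    ultimately show ?thesis using v by (simp add: compose_eq)
  qed
  moreover have "compose (arcs H) (on_arcs g) (on_arcs f) \<in> arcs H \<rightarrow>\<^sub>E arcs G"
    "compose (verts H) (on_verts g) (on_verts f) \<in> verts H \<rightarrow>\<^sub>E verts G"
    using assms by (simp_all add: compose_def etale_arcs etale_verts)
  moreover note etale_graphs[OF assms(1)] etale_graphs[OF assms(2)]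
  ultimately show ?thesis unfolding etale_def comp_fun_def
    using etale_dagger[OF assms(1)] etale_dagger[OF assms(2)] etale_arcs[OF assms(1)]
      etale_attached[OF assms(1)] etale_attached[OF assms(2)]
      etale_tgt[OF assms(1)] etale_tgt[OF assms(2)]
    by (simp add: compose_eq attached_arcs tgt_verts image_subset_iff)
qed

lemma comp_fun_apply [simp]:
  "a \<in> arcs H \<Longrightarrow> on_arcs (comp_fun H g f) a = on_arcs g (on_arcs f a)"
  "v \<in> verts H \<Longrightarrow> on_verts (comp_fun H g f) v = on_verts g (on_verts f v)"
  by (auto simp: comp_fun_def compose_def)

lemma comp_fun_extensional [simp]:
  "on_arcs (comp_fun H g f) \<in> extensional (arcs H)"
  "on_verts (comp_fun H g f) \<in> extensional (verts H)"
  by (simp_all add: comp_fun_def compose_def)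

lemma id_fun_apply [simp]:
  "a \<in> arcs H \<Longrightarrow> on_arcs (id_fun H) a = a"
  "v \<in> verts H \<Longrightarrow> on_verts (id_fun H) v = v"
  by (auto simp: id_fun_def)

lemma embedding_etale: "embedding H G f \<Longrightarrow> etale H G f"
  by (simp add: embedding_def)

lemma embedding_connected:
  "embedding H G f \<Longrightarrow> connected_graph H" "embedding H G f \<Longrightarrow> connected_graph G"
  by (auto simp: embedding_def)

lemma embedding_graphs [simp]:
  "embedding H G f \<Longrightarrow> is_graph H" "embedding H G f \<Longrightarrow> is_graph G"
  by (auto simp: embedding_def)

lemma embedding_id: "connected_graph G \<Longrightarrow> embedding G G (id_fun G)"
  by (auto simp: embedding_def etale_id inj_on_def)

lemma embedding_comp:
  assumes "embedding H K f" "embedding K G g"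
  shows "embedding H G (comp_fun H g f)"
  using assms etale_comp[of H K f G g] etale_verts[of H K f]
  by (auto simp: embedding_def inj_on_def)

text \<open>Darts at different vertices keep different targets, and at one vertex the map is a
  bijection of neighbourhoods. On all of \<open>arcs H\<close> injectivity may fail, because a
  boundary arc and an attached arc can have the same image.\<close>

lemma embedding_inj_attached:
  assumes "embedding H G f" shows "inj_on (on_arcs f) (attached H)"
proof (rule inj_onI)
  fix d e assume de: "d \<in> attached H" "e \<in> attached H" "on_arcs f d = on_arcs f e"
  have et: "etale H G f" and H: "is_graph H" using assms by (auto simp: embedding_def)
  have "tgt H d = tgt H e"
    using assms de etale_tgt[OF et] tgt_verts[OF H] unfolding embedding_def inj_on_def by metis
  then show "d = e" using etale_nb[OF et, of "tgt H d"] de tgt_verts[OF H]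
    by (auto simp: bij_betw_def nb_def inj_on_def)
qed

lemma embedding_image_attached:
  assumes "embedding H G f"
  shows "on_arcs f ` attached H = darts G (on_verts f ` verts H)"
proof -
  have et: "etale H G f" and H: "is_graph H" using assms by (auto simp: embedding_def)
  have "x \<in> on_arcs f ` attached H" if "x \<in> darts G (on_verts f ` verts H)" for x
  proof -
    obtain v where v: "v \<in> verts H" "x \<in> nb G (on_verts f v)"
      using \<open>x \<in> _\<close> by (auto simp: darts_def nb_def)
    then show ?thesis using etale_nb[OF et v(1)] by (auto simp: bij_betw_def nb_def)
  qed
  then show ?thesis
    using etale_attached[OF et] etale_tgt[OF et] tgt_verts[OF H] by (auto simp: darts_def)
qed

text \<open>When \<open>H\<close> has vertices, the opposite of a boundary arc is attached, which
  reduces the claim to \<open>embedding_inj_attached\<close>. The two arcs of an edge are kept apart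
  because \<open>dagger G\<close> has no fixed points.\<close>

lemma embedding_inj_bdry:
  assumes "embedding H G f" shows "inj_on (on_arcs f) (bdry H)"
proof (rule inj_onI)
  fix a b assume ab: "a \<in> bdry H" "b \<in> bdry H" "on_arcs f a = on_arcs f b"
  have et: "etale H G f" and H: "is_graph H" and G: "is_graph G" and con: "connected_graph H"
    using assms by (auto simp: embedding_def)
  have arcs: "a \<in> arcs H" "b \<in> arcs H" using ab by (auto simp: bdry_def)
  show "a = b"
  proof (cases "verts H = {}")
    case True
    then obtain c where "c \<in> arcs H" "arcs H = {c, dagger H c}"
      using connected_no_verts[OF con] by metis
    then have "a = b \<or> b = dagger H a" using arcs H by auto
    then show ?thesis
      using ab arcs H G et by (metis dagger_neq etale_arcs etale_dagger)
  next
    case False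
    then have "dagger H a \<in> attached H" "dagger H b \<in> attached H"
      using connected_arc_attached[OF con] arcs ab by (auto simp: bdry_def)
    moreover have "on_arcs f (dagger H a) = on_arcs f (dagger H b)"
      using ab arcs et by (simp add: etale_dagger)
    ultimately have "dagger H a = dagger H b"
      using embedding_inj_attached[OF assms] by (auto dest: inj_onD)
    then show ?thesis using arcs H by (metis dagger_dagger)
  qed
qed

text \<open>Whether the edge at \<open>d\<close> is cut can thus be read off from the image. The
  criterion goes through the opposite of an attached arc because an arc in the image of the boundary
  may have an attached preimage as well; a boundary arc over \<open>dagger G (on_arcs f d)\<close>
  has an attached opposite over \<open>on_arcs f d\<close>, and this opposite must be
  \<open>d\<close>.\<close>

lemma embedding_bdry_dagger:
  assumes "embedding H G f" "verts H \<noteq> {}" "d \<in> attached H"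
  shows "dagger H d \<in> bdry H \<longleftrightarrow> dagger G (on_arcs f d) \<in> on_arcs f ` bdry H"
proof
  have et: "etale H G f" and H: "is_graph H" and con: "connected_graph H"
    and G: "is_graph G" using assms by (auto simp: embedding_def)
  have d: "d \<in> arcs H" using assms H by (simp add: attached_arcs)
  show "dagger G (on_arcs f d) \<in> on_arcs f ` bdry H" if "dagger H d \<in> bdry H"
    using that d et by (metis etale_dagger image_eqI)
  assume "dagger G (on_arcs f d) \<in> on_arcs f ` bdry H"
  then obtain b where b: "b \<in> bdry H" "on_arcs f b = dagger G (on_arcs f d)" by auto
  have bA: "b \<in> arcs H" using b by (auto simp: bdry_def)
  have "dagger H b \<in> attached H"
    using connected_arc_attached[OF con assms(2) bA] b by (auto simp: bdry_def)
  moreover have "on_arcs f (dagger H b) = on_arcs f d"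
    using b bA et d G by (simp add: etale_dagger etale_arcs)
  ultimately have "dagger H b = d"
    using embedding_inj_attached[OF assms(1)] assms(3) by (auto dest: inj_onD)
  then show "dagger H d \<in> bdry H" using b bA H by auto
qed

lemma embedding_admissible:
  assumes "embedding H G f"
  shows "admissible G (on_verts f ` verts H) (on_arcs f ` bdry H)"
proof -
  have et: "etale H G f" and H: "is_graph H" and con: "connected_graph H"
    and G: "is_graph G" and inj: "inj_on (on_verts f) (verts H)"
    using assms by (auto simp: embedding_def)
  have V: "on_verts f ` verts H \<subseteq> verts G" using etale_verts[OF et] by auto
  show ?thesis
  proof (cases "verts H = {}")
    case True
    then obtain c where "c \<in> arcs H" "bdry H = {c, dagger H c}"
      using connected_no_verts[OF con] by metis
    then show ?thesis using True et by (auto simp: admissible_def etale_dagger etale_arcs)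
  next
    case False
    let ?S = "on_verts f ` verts H" and ?B = "on_arcs f ` bdry H"
    have D: "darts G ?S = on_arcs f ` attached H" using embedding_image_attached[OF assms] by simp
    have 1: "dagger G (on_arcs f b) \<in> darts G ?S" if "b \<in> bdry H" for b
    proof -
      have "b \<in> arcs H" "dagger H b \<in> attached H"
        using that connected_arc_attached[OF con False] by (auto simp: bdry_def)
      then show ?thesis unfolding D using et by (metis etale_dagger image_eqI)
    qed
    have int: "dagger G (on_arcs f d) \<in> ?B \<longleftrightarrow> dagger H d \<in> bdry H" if "d \<in> attached H" for d
      using embedding_bdry_dagger[OF assms False that] by simp
    have 2: "dagger G (on_arcs f d) \<in> darts G ?S"
      if "d \<in> attached H" "dagger G (on_arcs f d) \<notin> ?B" for d
    proof -
      have "dagger H d \<in> attached H" using that int[OF that(1)] H by (auto simp: bdry_def attached_arcs)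
      then show ?thesis unfolding D using et that H by (metis attached_arcs etale_dagger image_eqI)
    qed
    \<comment> \<open>An edge with both ends at the image is cut at both ends or at neither: were it
      uncut at \<open>d\<close>, the opposite of \<open>d\<close> would be attached, and
      \<open>int\<close> there would make \<open>d\<close> a boundary arc.\<close>
    have 3: "dagger G (on_arcs f d) \<in> ?B" if "d \<in> attached H" "on_arcs f d \<in> ?B" for d
    proof (rule ccontr)
      assume "\<not> ?thesis"
      then have e: "dagger H d \<in> attached H" using that int[OF that(1)] H by (auto simp: bdry_def attached_arcs)
      have "dagger G (on_arcs f (dagger H d)) = on_arcs f d"
        using that H G et by (simp add: etale_dagger attached_arcs etale_arcs)
      then have "dagger H (dagger H d) \<in> bdry H" using int[OF e] that by simp
      then show False using that H by (auto simp: bdry_def attached_arcs)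
    qed
    have 4: "\<exists>x\<in>darts G T. dagger G x \<in> darts G (?S - T) \<and> dagger G x \<notin> ?B"
      if T: "T \<noteq> {}" "T \<subset> ?S" for T
    proof -
      let ?T = "{v \<in> verts H. on_verts f v \<in> T}"
      obtain x where x: "x \<in> darts H ?T" "dagger H x \<in> darts H (verts H - ?T)"
      proof (rule connected_cross[OF con, of ?T])
        show "?T \<subset> verts H" "?T \<noteq> {}" using T by auto
      qed
      have xa: "x \<in> attached H" "x \<in> arcs H" using x H by (auto simp: darts_def attached_arcs)
      have "on_arcs f x \<in> darts G T" using x et by (auto simp: darts_def etale_attached etale_tgt)
      moreover have "dagger G (on_arcs f x) \<in> darts G (?S - T)"
        unfolding etale_dagger[OF et xa(2), symmetric]
        using x et by (auto simp: darts_def etale_attached etale_tgt)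
      moreover have "dagger G (on_arcs f x) \<notin> ?B"
        using int[OF xa(1)] x by (auto simp: darts_def bdry_def)
      ultimately show ?thesis by blast
    qed
    have "?B \<subseteq> arcs G" using et by (auto simp: etale_arcs bdry_def)
    then show ?thesis unfolding admissible_def using V False 1 2 3 4
      by (auto simp: D)
  qed
qed

text \<open>On attached arcs \<open>j\<close> is forced, since \<open>k\<close> is injective there,
  and on the remaining arcs it is forced by the involution. What has to be checked is that the two
  prescriptions agree on an edge of \<open>H\<close> with both arcs attached, and
  \<open>sub_le\<close> says that such an edge is not cut in \<open>K\<close>.\<close>

lemma embedding_factor:
  assumes h: "embedding H G h" and k: "embedding K G k"
    and le: "sub_le G (on_verts h ` verts H) (on_arcs h ` bdry H) (on_verts k ` verts K) (on_arcs k ` bdry K)"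
  obtains j where "embedding H K j" "h = comp_fun H k j"
proof -
  have eh: "etale H G h" and ek: "etale K G k" and H: "is_graph H" and K: "is_graph K"
    and G: "is_graph G" and cH: "connected_graph H" and cK: "connected_graph K"
    using h k by (auto simp: embedding_def)
  have "\<exists>j. etale H K j \<and> h = comp_fun H k j"
  proof (cases "verts H = {}")
    case True
    then obtain p where p: "p \<in> arcs H" "arcs H = {p, dagger H p}" "attached H = {}" "bdry H = {p, dagger H p}"
      using connected_no_verts[OF cH] by metis
    have "on_arcs h p \<in> darts G (on_verts k ` verts K) \<union> on_arcs k ` bdry K"
      using le True p by (auto simp: sub_le_def)
    then obtain q where q: "q \<in> arcs K" "on_arcs h p = on_arcs k q"
      unfolding embedding_image_attached[OF k, symmetric] using K
      by (auto simp: bdry_def dest: attached_arcs)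
    define j where "j = \<lparr>on_arcs = (\<lambda>a\<in>arcs H. if a = p then q else dagger K q), on_verts = (\<lambda>v\<in>verts H. on_verts h v)\<rparr>"
    have pp: "dagger H p \<noteq> p" "dagger H (dagger H p) = p" using p(1) H by simp_all
    have "on_arcs j \<in> arcs H \<rightarrow>\<^sub>E arcs K" using q K by (simp add: j_def)
    moreover have "\<forall>a\<in>arcs H. on_arcs j (dagger H a) = dagger K (on_arcs j a)"
      unfolding p(2) using pp q K p(2) by (simp add: j_def)
    ultimately have "etale H K j" unfolding etale_def using p(3) True H K
      by (simp add: j_def restrict_def)
    moreover have "h = comp_fun H k j"
    proof (rule graph_fun_eqI[of _ "arcs H" _ "verts H"])
      show "on_arcs h a = on_arcs (comp_fun H k j) a" if "a \<in> arcs H" for a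
        using that p(2) q pp etale_dagger[OF eh p(1)] etale_dagger[OF ek q(1)] by (auto simp: j_def)
    qed (use True etale_extensional[OF eh] comp_fun_extensional[of H k j] in simp_all)
    ultimately show ?thesis by blast
  next
    case False
    let ?iv = "inv_into (verts K) (on_verts k)" and ?ia = "inv_into (attached K) (on_arcs k)"
    have le1: "on_verts h ` verts H \<subseteq> on_verts k ` verts K" using le by (auto simp: sub_le_def)
    have le2: "dagger G x \<in> on_arcs h ` bdry H"
      if "x \<in> darts G (on_verts h ` verts H)" "dagger G x \<in> on_arcs k ` bdry K" for x
      using le False that by (auto simp: sub_le_def)
    have iv: "?iv (on_verts h v) \<in> verts K" "on_verts k (?iv (on_verts h v)) = on_verts h v"
      if "v \<in> verts H" for v
      using that le1 by (auto intro!: inv_into_into f_inv_into_f)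
    have sub: "on_arcs h ` attached H \<subseteq> on_arcs k ` attached K"
      unfolding embedding_image_attached[OF h] embedding_image_attached[OF k]
      using le1 by (rule darts_mono)
    have ia: "?ia (on_arcs h d) \<in> attached K" "on_arcs k (?ia (on_arcs h d)) = on_arcs h d"
      if "d \<in> attached H" for d
      using that sub by (auto intro!: inv_into_into f_inv_into_f)
    define ja where "ja = (\<lambda>a\<in>arcs H. if a \<in> attached H then ?ia (on_arcs h a)
      else dagger K (?ia (on_arcs h (dagger H a))))"
    define j where "j = \<lparr>on_arcs = ja, on_verts = (\<lambda>v\<in>verts H. ?iv (on_verts h v))\<rparr>"
    have jad: "ja d = ?ia (on_arcs h d)" if "d \<in> attached H" for d
      using that H by (simp add: ja_def attached_arcs)
    have att: "dagger H a \<in> attached H" if "a \<in> arcs H" "a \<notin> attached H" for a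
      using connected_arc_attached[OF cH False] that by auto
    have jaK: "ja a \<in> arcs K" if "a \<in> arcs H" for a
      using that ia att K by (auto simp: ja_def attached_arcs)
    have kja: "on_arcs k (ja a) = on_arcs h a" if a: "a \<in> arcs H" for a
    proof (cases "a \<in> attached H")
      case True
      then show ?thesis using ia by (simp add: jad)
    next
      case False
      note e = ia[OF att[OF a False]]
      have "on_arcs k (ja a) = dagger G (on_arcs h (dagger H a))"
        using False a e etale_dagger[OF ek attached_arcs[OF K e(1)]] by (simp add: ja_def)
      then show ?thesis using etale_dagger[OF eh, of "dagger H a"] a H by simp
    qed
    have jdag: "ja (dagger H a) = dagger K (ja a)" if a: "a \<in> arcs H" for a
    proof (cases "a \<in> attached H \<and> dagger H a \<in> attached H")
      case True
      \<comment> \<open>If this arc were on the boundary, the edge would be cut in \<open>K\<close>,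
        hence cut in \<open>H\<close> by \<open>le2\<close>, although both of its arcs are attached
        in \<open>H\<close>.\<close>
      have "dagger K (ja a) \<in> attached K"
      proof (rule ccontr)
        assume "dagger K (ja a) \<notin> attached K"
        then have "dagger K (ja a) \<in> bdry K" using jaK[OF a] K by (auto simp: bdry_def)
        then have "dagger G (on_arcs h a) \<in> on_arcs k ` bdry K"
          using kja[OF a] jaK[OF a] ek by (metis etale_dagger image_eqI)
        then have "dagger G (on_arcs h a) \<in> on_arcs h ` bdry H"
          using le2[of "on_arcs h a"] True embedding_image_attached[OF h] by auto
        then have "dagger H a \<in> bdry H"
          using embedding_bdry_dagger[OF h False, of a] True by simp
        then show False using True by (auto simp: bdry_def)
      qed
      moreover have "ja (dagger H a) \<in> attached K" using True ia by (simp add: jad)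
      moreover have "on_arcs k (ja (dagger H a)) = on_arcs k (dagger K (ja a))"
        using a H ek eh jaK by (simp add: kja etale_dagger)
      ultimately show ?thesis using embedding_inj_attached[OF k] by (auto dest: inj_onD)
    next
      case False
      then show ?thesis
      proof (cases "a \<in> attached H")
        case True
        then show ?thesis using False a H by (auto simp: ja_def)
      next
        case False
        then have "dagger H a \<in> attached H" using att a by auto
        then show ?thesis using False a H K ia by (auto simp: ja_def attached_arcs)
      qed
    qed
    have jt: "?iv (on_verts h (tgt H d)) = tgt K (ja d)" if d: "d \<in> attached H" for d
    proof -
      have "on_verts k (tgt K (ja d)) = on_verts h (tgt H d)"
        using ia[OF d] d eh ek by (metis jad etale_tgt)
      moreover have "tgt K (ja d) \<in> verts K" using ia[OF d] d K by (simp add: jad tgt_verts)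
      ultimately show ?thesis
        using iv[of "tgt H d"] k d H unfolding embedding_def inj_on_def by (metis tgt_verts)
    qed
    have "bij_betw ja (nb H v) (nb K (?iv (on_verts h v)))" if v: "v \<in> verts H" for v
    proof -
      have bk: "bij_betw (on_arcs k) (nb K (?iv (on_verts h v))) (nb G (on_verts h v))"
        using etale_nb[OF ek iv(1)[OF v]] iv(2)[OF v] by simp
      have bh: "bij_betw (on_arcs k \<circ> ja) (nb H v) (nb G (on_verts h v))"
        using etale_nb[OF eh v] H kja by (auto simp: nb_arcs cong: bij_betw_cong)
      have m: "ja ` nb H v \<subseteq> nb K (?iv (on_verts h v))"
        using jt ia by (auto simp: nb_def jad)
      show ?thesis
        using bij_betw_comp_iff2[OF bk, of ja "nb H v"] bh m by simp
    qed
    moreover have "ja \<in> extensional (arcs H)" by (simp add: ja_def)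
    ultimately have "etale H K j" unfolding etale_def j_def
      using H K jaK iv(1) jdag ia(1) jt jad by (auto simp: PiE_def tgt_verts)
    moreover have "h = comp_fun H k j"
      by (rule graph_fun_eqI[of _ "arcs H" _ "verts H"])
        (use eh kja iv(2) in \<open>auto simp: etale_extensional comp_fun_def j_def compose_def\<close>)
    ultimately show ?thesis by blast
  qed
  then obtain j where j: "etale H K j" "h = comp_fun H k j" by blast
  have "inj_on (on_verts j) (verts H)"
    using h j(2) unfolding embedding_def inj_on_def by (metis comp_fun_apply(2))
  then show thesis using that[of j] j cH cK by (simp add: embedding_def)
qed

lemma sub_le_refl [simp]: "sub_le G S B S B"
  by (auto simp: sub_le_def)

section \<open>Classes of embeddings as admissible pairs\<close>

lemma comp_fun_assoc:
  "etale H K f \<Longrightarrow> comp_fun H (comp_fun K h g) f = comp_fun H h (comp_fun H g f)"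
  by (auto simp: comp_fun_def compose_def etale_arcs etale_verts fun_eq_iff restrict_def)

text \<open>As \<open>h\<close> need not be injective on arcs, it cannot simply be cancelled. It can
  be cancelled on vertices and on attached arcs, and the remaining arcs are opposite to attached
  ones; a graph without vertices consists of boundary arcs, where \<open>h\<close> is injective
  too.\<close>

lemma embedding_endo_id:
  assumes h: "embedding H G h" and e: "etale H H e" and eq: "comp_fun H h e = h"
  shows "e = id_fun H"
proof -
  have H: "is_graph H" and con: "connected_graph H" using h by (auto simp: embedding_def)
  have ha: "on_arcs h (on_arcs e a) = on_arcs h a" if "a \<in> arcs H" for a
    using comp_fun_apply(1)[OF that, of h e] eq by simp
  have hv: "on_verts h (on_verts e v) = on_verts h v" if "v \<in> verts H" for v
    using comp_fun_apply(2)[OF that, of h e] eq by simp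
  have ev: "on_verts e v = v" if "v \<in> verts H" for v
    using hv[OF that] that h etale_verts[OF e that] by (auto simp: embedding_def dest: inj_onD)
  have ed: "on_arcs e d = d" if "d \<in> attached H" for d
    using inj_onD[OF embedding_inj_attached[OF h] ha] that etale_attached[OF e that] H
    by (simp add: attached_arcs)
  have ea: "on_arcs e a = a" if a: "a \<in> arcs H" for a
  proof (cases "verts H = {}")
    case True
    then have "arcs H = bdry H" using tgt_verts[OF H] by (auto simp: bdry_def)
    then show ?thesis
      using inj_onD[OF embedding_inj_bdry[OF h] ha[OF a]] a etale_arcs[OF e a] by simp
  next
    case False
    have "on_arcs e a = a" if "dagger H a \<in> attached H"
      using ed[OF that] e a H by (metis dagger_dagger etale_arcs etale_dagger)
    then show ?thesis using connected_arc_attached[OF con False a] ed by blast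
  qed
  show ?thesis
    by (rule graph_fun_eqI[of _ "arcs H" _ "verts H"])
      (use ea ev etale_extensional[OF e] in \<open>auto simp: id_fun_def\<close>)
qed

lemma graph_iso_images:
  assumes "graph_iso H K z"
  shows "on_verts z ` verts H = verts K" "on_arcs z ` bdry H = bdry K"
proof -
  obtain y where z: "etale H K z" and y: "etale K H y"
    and yz: "comp_fun H y z = id_fun H" and zy: "comp_fun K z y = id_fun K"
    using assms by (auto simp: graph_iso_def)
  have yza: "on_arcs y (on_arcs z a) = a" if "a \<in> arcs H" for a
    using comp_fun_apply(1)[OF that, of y z] yz that by simp
  have zya: "on_arcs z (on_arcs y a) = a" if "a \<in> arcs K" for a
    using comp_fun_apply(1)[OF that, of z y] zy that by simp
  have zyv: "on_verts z (on_verts y v) = v" if "v \<in> verts K" for v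
    using comp_fun_apply(2)[OF that, of z y] zy that by simp
  show "on_verts z ` verts H = verts K"
    using zyv etale_verts[OF y] etale_verts[OF z] by (auto simp: image_iff) metis
  show "on_arcs z ` bdry H = bdry K"
  proof (intro equalityI subsetI)
    fix b assume "b \<in> on_arcs z ` bdry H"
    then show "b \<in> bdry K"
      using yza etale_arcs[OF z] etale_attached[OF y] by (auto simp: bdry_def) metis
  next
    fix b assume b: "b \<in> bdry K"
    then have "on_arcs y b \<in> bdry H"
      using zya etale_arcs[OF y] etale_attached[OF z] by (auto simp: bdry_def) metis
    moreover have "b = on_arcs z (on_arcs y b)" using zya[of b] b by (simp add: bdry_def)
    ultimately show "b \<in> on_arcs z ` bdry H" by (rule rev_image_eqI)
  qed
qed

text \<open>Equal pairs are comparable in both directions, so \<open>embedding_factor\<close> yields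
  embeddings \<open>j\<close> and \<open>i\<close> over \<open>G\<close>; their composites are
  endomorphisms over \<open>G\<close> and hence identities by \<open>embedding_endo_id\<close>. A
  class is therefore determined by its vertices and its boundary.\<close>

lemma emb_class_iff:
  assumes f: "embedding H G f"
  shows "(K, h) \<in> emb_class G H f \<longleftrightarrow> embedding K G h \<and>
    on_verts h ` verts K = on_verts f ` verts H \<and> on_arcs h ` bdry K = on_arcs f ` bdry H"
    (is "_ \<longleftrightarrow> ?R")
proof
  assume "(K, h) \<in> emb_class G H f"
  then obtain z where h: "embedding K G h" and z: "graph_iso H K z" and eq: "f = comp_fun H h z"
    by (auto simp: emb_class_def)
  have "on_verts f ` verts H = on_verts h ` on_verts z ` verts H"
    "on_arcs f ` bdry H = on_arcs h ` on_arcs z ` bdry H"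
    unfolding eq by (auto simp: bdry_def image_image)
  then show ?R using h graph_iso_images[OF z] by simp
next
  assume R: ?R
  then have h: "embedding K G h" and hf: "on_verts h ` verts K = on_verts f ` verts H"
    "on_arcs h ` bdry K = on_arcs f ` bdry H" by simp_all
  obtain j where j: "embedding H K j" "f = comp_fun H h j"
    by (rule embedding_factor[OF f h]) (simp add: hf)
  obtain i where i: "embedding K H i" "h = comp_fun K f i"
    by (rule embedding_factor[OF h f]) (simp add: hf)
  have "comp_fun H f (comp_fun H i j) = f"
    using comp_fun_assoc[OF embedding_etale[OF j(1)], of f i] i(2) j(2) by metis
  then have 1: "comp_fun H i j = id_fun H"
    using embedding_endo_id[OF f] etale_comp embedding_etale i j by blast
  have "comp_fun K h (comp_fun K j i) = h"
    using comp_fun_assoc[OF embedding_etale[OF i(1)], of h j] i(2) j(2) by metis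
  then have 2: "comp_fun K j i = id_fun K"
    using embedding_endo_id[OF h] etale_comp embedding_etale i j by blast
  show "(K, h) \<in> emb_class G H f"
    unfolding emb_class_def graph_iso_def using h i j 1 2 embedding_etale by blast
qed

lemma emb_class_self: "embedding H G f \<Longrightarrow> (H, f) \<in> emb_class G H f"
  by (simp add: emb_class_iff)

lemma emb_class_Emb: "embedding H G f \<Longrightarrow> emb_class G H f \<in> Emb G"
  by (auto simp: Emb_def)

lemma emb_verts_class: "embedding H G f \<Longrightarrow> emb_verts (emb_class G H f) = on_verts f ` verts H"
  unfolding emb_verts_def using emb_class_iff[of H G f] by fast

lemma emb_bdry_class: "embedding H G f \<Longrightarrow> emb_bdry (emb_class G H f) = on_arcs f ` bdry H"
  unfolding emb_bdry_def using emb_class_iff[of H G f] by fast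

lemma Emb_cases:
  assumes "c \<in> Emb G"
  obtains H f where "embedding H G f" "c = emb_class G H f" "(H, f) \<in> c"
    "emb_verts c = on_verts f ` verts H" "emb_bdry c = on_arcs f ` bdry H"
  using assms unfolding Emb_def
  by (auto simp: emb_verts_class emb_bdry_class emb_class_self)

lemma emb_class_eqI:
  assumes "embedding H G f" "embedding K G h"
    "on_verts h ` verts K = on_verts f ` verts H" "on_arcs h ` bdry K = on_arcs f ` bdry H"
  shows "emb_class G H f = emb_class G K h"
  using assms by (auto simp: emb_class_iff)

lemma Emb_eqI:
  assumes "c \<in> Emb G" "d \<in> Emb G" "emb_verts c = emb_verts d" "emb_bdry c = emb_bdry d"
  shows "c = d"
  by (metis assms Emb_cases emb_class_eqI)

lemma Emb_mem:
  assumes "c \<in> Emb G" "(H, f) \<in> c"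
  shows "embedding H G f" "emb_verts c = on_verts f ` verts H" "emb_bdry c = on_arcs f ` bdry H"
proof -
  obtain K k where "embedding K G k" "c = emb_class G K k" using assms(1) by (auto simp: Emb_def)
  then show "embedding H G f" "emb_verts c = on_verts f ` verts H" "emb_bdry c = on_arcs f ` bdry H"
    using assms(2) by (simp_all add: emb_verts_class emb_bdry_class emb_class_iff)
qed

lemma Emb_admissible: "c \<in> Emb G \<Longrightarrow> admissible G (emb_verts c) (emb_bdry c)"
  by (metis Emb_cases embedding_admissible)

lemma Emb_connected: "c \<in> Emb G \<Longrightarrow> connected_graph G"
  by (metis Emb_cases embedding_connected(2))

text \<open>The backward direction is \<open>embedding_factor\<close>. Forward, an etale map keeps
  attached arcs attached, so an edge that is cut in the larger subgraph cannot come from one that is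
  internal in the smaller one.\<close>

lemma emb_le_iff:
  assumes c: "c \<in> Emb G" and d: "d \<in> Emb G"
  shows "emb_le c d \<longleftrightarrow> sub_le G (emb_verts c) (emb_bdry c) (emb_verts d) (emb_bdry d)"
proof
  assume "emb_le c d"
  then obtain H h K k j where hk: "(H, h) \<in> c" "(K, k) \<in> d"
    and j: "embedding H K j" and eq: "h = comp_fun H k j"
    by (auto simp: emb_le_def)
  note h = Emb_mem[OF c hk(1)] and k = Emb_mem[OF d hk(2)]
  have ej: "etale H K j" and ek: "etale K G k" and H: "is_graph H" and K: "is_graph K"
    using j k by (auto simp: embedding_def)
  have vs: "on_verts h ` verts H \<subseteq> on_verts k ` verts K"
    unfolding eq using etale_verts[OF ej] by auto
  show "sub_le G (emb_verts c) (emb_bdry c) (emb_verts d) (emb_bdry d)"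
  proof (cases "verts H = {}")
    case True
    have "on_arcs h b \<in> darts G (on_verts k ` verts K) \<union> on_arcs k ` bdry K" if "b \<in> bdry H" for b
      unfolding embedding_image_attached[OF k(1), symmetric] eq
      using that etale_arcs[OF ej, of b] by (auto simp: bdry_def)
    then show ?thesis unfolding h k sub_le_def using True by auto
  next
    case False
    then have K0: "verts K \<noteq> {}" using etale_verts[OF ej] by auto
    have "dagger G x \<in> on_arcs h ` bdry H"
      if x: "x \<in> darts G (on_verts h ` verts H)" "dagger G x \<in> on_arcs k ` bdry K" for x
    proof -
      obtain d where d: "d \<in> attached H" "x = on_arcs h d"
        using x(1) embedding_image_attached[OF h(1)] by auto
      have dA: "d \<in> arcs H" using d H by (simp add: attached_arcs)
      have "dagger K (on_arcs j d) \<in> bdry K"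
        using embedding_bdry_dagger[OF k(1) K0, of "on_arcs j d"] etale_attached[OF ej d(1)] x(2) d(2) dA
        by (simp add: eq)
      then have "on_arcs j (dagger H d) \<notin> attached K"
        using etale_dagger[OF ej dA] by (simp add: bdry_def)
      then have "dagger H d \<in> bdry H" using etale_attached[OF ej] dA H by (auto simp: bdry_def)
      then show ?thesis using embedding_bdry_dagger[OF h(1) False d(1)] d(2) by simp
    qed
    then show ?thesis unfolding h k sub_le_def using False vs by auto
  qed
next
  assume le: "sub_le G (emb_verts c) (emb_bdry c) (emb_verts d) (emb_bdry d)"
  obtain H h where h: "embedding H G h" "(H, h) \<in> c" "emb_verts c = on_verts h ` verts H"
    "emb_bdry c = on_arcs h ` bdry H" using Emb_cases[OF c] by metis
  obtain K k where k: "embedding K G k" "(K, k) \<in> d" "emb_verts d = on_verts k ` verts K"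
    "emb_bdry d = on_arcs k ` bdry K" using Emb_cases[OF d] by metis
  obtain j where j: "embedding H K j" "h = comp_fun H k j"
    by (rule embedding_factor[OF h(1) k(1)]) (use le in \<open>simp only: h(3,4) k(3,4)\<close>)
  show "emb_le c d" unfolding emb_le_def by (intro exI conjI) (fact h(2) k(2) j)+
qed

text \<open>Equality rather than mere isomorphism is available because \<open>is_graph\<close> fixes
  \<open>dagger\<close> and \<open>tgt\<close> outside their domains; the identity then witnesses
  \<open>is_edge\<close>.\<close>

lemma graph_eq_edge_graph:
  fixes H :: "('a, 'v) graph"
  assumes "is_graph H" "a \<in> arcs H" "arcs H = {a, dagger H a}" "attached H = {}" "verts H = {}"
  shows "H = edge_graph a (dagger H a)"
proof -
  have "dagger H x = (\<lambda>x\<in>{a, dagger H a}. if x = a then dagger H a else a) x" for x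
  proof (cases "x \<in> arcs H")
    case True
    then have "x = a \<or> x = dagger H a" using assms(3) by blast
    then show ?thesis by (elim disjE) (simp_all add: assms(1,2))
  next
    case False
    have "dagger H \<in> arcs H \<rightarrow>\<^sub>E arcs H" using assms(1) unfolding is_graph_def by blast
    then have "dagger H \<in> extensional (arcs H)" by (simp add: PiE_iff)
    then show ?thesis using False assms(3) by (simp add: extensional_def)
  qed
  then have "dagger H = (\<lambda>x\<in>{a, dagger H a}. if x = a then dagger H a else a)" ..
  moreover have "tgt H \<in> attached H \<rightarrow>\<^sub>E verts H" using assms(1) unfolding is_graph_def by blast
  then have "tgt H = (\<lambda>d\<in>{}. undefined)" using assms(4) by (simp add: restrict_def)
  ultimately show ?thesis unfolding edge_graph_def
    by (intro graph.equality) (simp_all only: graph.simps assms(3-5) unit_eq)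
qed

lemma is_edge_iff:
  assumes c: "c \<in> Emb G" shows "is_edge c \<longleftrightarrow> emb_verts c = {}"
proof
  assume "is_edge c"
  then obtain H f a b z where "(H, f) \<in> c" "graph_iso H (edge_graph a b) z"
    unfolding is_edge_def by blast
  then show "emb_verts c = {}"
    using Emb_mem(2)[OF c] graph_iso_images(1)[of H "edge_graph a b" z]
    by (auto simp: edge_graph_def)
next
  assume v: "emb_verts c = {}"
  obtain H f where f: "embedding H G f" "(H, f) \<in> c" "emb_verts c = on_verts f ` verts H"
    using Emb_cases[OF c] by metis
  have H: "is_graph H" "connected_graph H" using f by (auto simp: embedding_def)
  have v0: "verts H = {}" using f v by simp
  obtain a where a: "a \<in> arcs H" "arcs H = {a, dagger H a}" "attached H = {}"
    using connected_no_verts[OF H(2) v0] by metis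
  have "H = edge_graph a (dagger H a)" by (rule graph_eq_edge_graph[OF H(1) a v0])
  moreover have "graph_iso H H (id_fun H)"
    unfolding graph_iso_def
    by (intro conjI exI[of _ "id_fun H"] etale_id H(1))
      (auto simp: comp_fun_def id_fun_def compose_def restrict_def)
  ultimately show "is_edge c" unfolding is_edge_def using f(2) a(1) H(1) dagger_neq by metis
qed

text \<open>A nonempty part without vertices is closed under the involution and so contains both
  arcs; two such parts cannot be disjoint.\<close>

lemma connected_edge_graph:
  assumes "a \<noteq> b" shows "connected_graph (edge_graph a b :: ('a, 'v) graph)"
proof -
  let ?E = "edge_graph a b :: ('a, 'v) graph"
  have E: "is_graph ?E" using assms by (auto simp: is_graph_def edge_graph_def)
  have False
    if "is_graph H" "is_graph K" "nonempty_graph H" "nonempty_graph K" "is_disjoint_union ?E H K" for H K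
  proof -
    have v: "verts H = {}" "verts K = {}" and A: "arcs H \<union> arcs K = {a, b}" "arcs H \<inter> arcs K = {}"
      using that(5) by (auto simp: is_disjoint_union_def edge_graph_def)
    have dH: "\<And>x. x \<in> arcs H \<Longrightarrow> dagger H x = dagger ?E x"
      and dK: "\<And>x. x \<in> arcs K \<Longrightarrow> dagger K x = dagger ?E x"
      using that(5) unfolding is_disjoint_union_def by simp_all
    have all: "arcs L = {a, b}" if "is_graph L" "arcs L \<noteq> {}" "arcs L \<subseteq> {a, b}"
      "\<And>x. x \<in> arcs L \<Longrightarrow> dagger L x = dagger ?E x" for L :: "('a, 'v) graph"
    proof -
      have E: "dagger ?E a = b" "dagger ?E b = a" using assms by (auto simp: edge_graph_def)
      have "dagger ?E x \<in> arcs L" if "x \<in> arcs L" for x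
        using dagger_arcs[OF \<open>is_graph L\<close> that] \<open>\<And>x. x \<in> arcs L \<Longrightarrow> _ x\<close>[OF that] by simp
      then have "a \<in> arcs L \<longleftrightarrow> b \<in> arcs L" using E by metis
      then show ?thesis using that(2,3) by blast
    qed
    have ne: "arcs H \<noteq> {}" "arcs K \<noteq> {}" using that(3,4) v by (auto simp: nonempty_graph_def)
    have "arcs H = {a, b}" "arcs K = {a, b}"
      by (rule all; use that(1,2) ne A(1) dH dK in auto)+
    then show False using A(2) by auto
  qed
  moreover have "nonempty_graph ?E" by (simp add: nonempty_graph_def edge_graph_def)
  ultimately show ?thesis unfolding connected_graph_def using E by blast
qed

text \<open>The graph with vertices \<open>S\<close> in which exactly the arcs in \<open>I\<close> are internal, the new arc
  opposite to a dart \<open>d\<close> outside \<open>I\<close> being \<open>b d\<close>.\<close>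

definition model :: "('a, 'v) graph \<Rightarrow> 'v set \<Rightarrow> 'a set \<Rightarrow> ('a \<Rightarrow> 'a) \<Rightarrow> ('a, 'v) graph" where
  "model G S I b =
     (let N = darts G S in
      \<lparr>arcs = N \<union> b ` (N - I), verts = S,
       dagger = (\<lambda>a\<in>N \<union> b ` (N - I). if a \<in> I then dagger G a else if a \<in> N then b a
         else inv_into (N - I) b a),
       attached = N, tgt = restrict (tgt G) N\<rparr>)"

definition model_incl ::
  "('a, 'v) graph \<Rightarrow> 'v set \<Rightarrow> 'a set \<Rightarrow> ('a \<Rightarrow> 'a) \<Rightarrow> ('a, 'v) graph_fun" where
  "model_incl G S I b =
     (let N = darts G S in
      \<lparr>on_arcs = (\<lambda>a\<in>N \<union> b ` (N - I). if a \<in> N then a else dagger G (inv_into (N - I) b a)),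
       on_verts = (\<lambda>v\<in>S. v)\<rparr>)"

text \<open>A star is the model with no internal edges, so \<open>model_embedding\<close> covers
  stars as well.\<close>

lemma star_model: "star G v = model G {v} {} (star_new G v)"
  unfolding star_def model_def Let_def darts_singleton
  by (auto simp: nb_def restrict_def fun_eq_iff)

lemma star_incl_model: "star_incl G v = model_incl G {v} {} (star_new G v)"
  unfolding star_incl_def model_incl_def Let_def darts_singleton
  by (auto simp: restrict_def fun_eq_iff)

section \<open>Realization of an admissible pair by an embedding\<close>

lemma ex_fresh_inj:
  assumes "finite X" "finite (Y :: 'a :: infinite set)"
  shows "\<exists>b :: 'a \<Rightarrow> 'a. inj_on b X \<and> b ` X \<inter> Y = {}"
proof -
  have "infinite (- Y)" using assms(2) infinite_UNIV by simp
  then obtain C where C: "finite C" "card C = card X" "C \<subseteq> - Y"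
    using infinite_arbitrarily_large[of "- Y" "card X"] by blast
  then obtain b where "bij_betw b X C" using finite_same_card_bij[of X C] assms by auto
  then show ?thesis using C by (auto simp: bij_betw_def)
qed

text \<open>Converse of \<open>embedding_admissible\<close> for nonempty \<open>S\<close>:
  \<open>Id\<close> makes the involution of the model well defined, \<open>cross\<close> makes the
  model connected, and the values of \<open>b\<close> serve as the cut ends.\<close>

lemma model_embedding:
  assumes G: "connected_graph G" and S: "S \<subseteq> verts G" "S \<noteq> {}" and I: "I \<subseteq> darts G S"
    and Id: "\<And>x. x \<in> I \<Longrightarrow> dagger G x \<in> I"
    and b: "inj_on b (darts G S - I)" "b ` (darts G S - I) \<inter> darts G S = {}"
    and cross: "\<And>T. T \<noteq> {} \<Longrightarrow> T \<subset> S \<Longrightarrow> \<exists>x\<in>darts G T. x \<in> I \<and> dagger G x \<in> darts G (S - T)"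
  shows "embedding (model G S I b) G (model_incl G S I b)"
    and "on_arcs (model_incl G S I b) ` bdry (model G S I b) = dagger G ` (darts G S - I)"
proof -
  let ?N = "darts G S" and ?M = "model G S I b" and ?f = "model_incl G S I b"
  have gG: "is_graph G" using G by simp
  have M: "arcs ?M = ?N \<union> b ` (?N - I)" "verts ?M = S" "attached ?M = ?N" "tgt ?M = restrict (tgt G) ?N"
    by (simp_all add: model_def Let_def)
  have inv: "inv_into (?N - I) b (b d) = d" if "d \<in> ?N" "d \<notin> I" for d
    using that b(1) by simp
  have bN: "b d \<notin> ?N" "b d \<notin> I" if "d \<in> ?N" "d \<notin> I" for d
    using that b(2) I by auto
  have d1: "dagger ?M d = dagger G d" if "d \<in> I" for d
    using that I by (auto simp: model_def Let_def)
  have d2: "dagger ?M d = b d" if "d \<in> ?N" "d \<notin> I" for d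
    using that by (simp add: model_def Let_def)
  have d3: "dagger ?M (b d) = d" if "d \<in> ?N" "d \<notin> I" for d
    using that bN[OF that] inv[OF that] by (simp add: model_def Let_def)
  have f1: "on_arcs ?f d = d" if "d \<in> ?N" for d
    using that by (simp add: model_incl_def Let_def)
  have f2: "on_arcs ?f (b d) = dagger G d" if "d \<in> ?N" "d \<notin> I" for d
    using that bN[OF that] inv[OF that] by (simp add: model_incl_def Let_def)
  have fv: "on_verts ?f v = v" if "v \<in> S" for v
    using that by (simp add: model_incl_def Let_def)
  have arc_cases: "P a" if "a \<in> arcs ?M" "\<And>d. d \<in> I \<Longrightarrow> P d"
    "\<And>d. d \<in> ?N \<Longrightarrow> d \<notin> I \<Longrightarrow> P d" "\<And>d. d \<in> ?N \<Longrightarrow> d \<notin> I \<Longrightarrow> P (b d)" for P a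
    using that(1) unfolding M using that(2-4) by blast
  have NA: "d \<in> arcs G" if "d \<in> ?N" for d using that gG by (simp add: darts_arcs)
  have bd: "bdry ?M = b ` (?N - I)" unfolding bdry_def M using b(2) by auto
  have gM: "is_graph ?M"
    unfolding is_graph_def
  proof (intro conjI)
    show "finite (arcs ?M)" unfolding M using graph_finite[OF gG] NA
      by (auto intro!: finite_imageI intro: finite_subset)
    show "finite (verts ?M)" unfolding M using graph_finite[OF gG] S by (auto intro: finite_subset)
    have "dagger ?M a \<in> arcs ?M" if "a \<in> arcs ?M" for a
      by (rule arc_cases[OF that]) (use I Id d1 d2 d3 M(1) in auto)
    moreover have "dagger ?M \<in> extensional (arcs ?M)" unfolding model_def Let_def by simp
    ultimately show "dagger ?M \<in> arcs ?M \<rightarrow>\<^sub>E arcs ?M" by (auto simp: PiE_def)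
    have "dagger ?M (dagger ?M a) = a \<and> dagger ?M a \<noteq> a" if "a \<in> arcs ?M" for a
      by (rule arc_cases[OF that]; insert I Id gG bN; force simp: d1 d2 d3 NA)
    then show "\<forall>a\<in>arcs ?M. dagger ?M (dagger ?M a) = a \<and> dagger ?M a \<noteq> a" by blast
    show "attached ?M \<subseteq> arcs ?M" unfolding M by blast
    show "tgt ?M \<in> attached ?M \<rightarrow>\<^sub>E verts ?M" unfolding M by (auto simp: darts_def)
  qed
  have et: "etale ?M G ?f"
    unfolding etale_def
  proof (intro conjI ballI gM gG)
    have fa: "on_arcs ?f a \<in> arcs G" if "a \<in> arcs ?M" for a
      by (rule arc_cases[OF that]) (use I gG f1 f2 NA in auto)
    moreover have "on_arcs ?f \<in> extensional (arcs ?M)"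
      by (simp add: model_incl_def model_def Let_def)
    ultimately show "on_arcs ?f \<in> arcs ?M \<rightarrow>\<^sub>E arcs G" by (auto simp: PiE_iff)
    show "on_verts ?f \<in> verts ?M \<rightarrow>\<^sub>E verts G" unfolding M using S by (auto simp: model_incl_def Let_def)
    show "on_arcs ?f (dagger ?M a) = dagger G (on_arcs ?f a)" if "a \<in> arcs ?M" for a
    proof (rule arc_cases[OF that])
      show "on_arcs ?f (dagger ?M d) = dagger G (on_arcs ?f d)" if "d \<in> I" for d
        using that I Id by (simp add: d1 f1 subset_iff)
      show "on_arcs ?f (dagger ?M d) = dagger G (on_arcs ?f d)" if "d \<in> ?N" "d \<notin> I" for d
        using that by (simp add: d2 f1 f2)
      show "on_arcs ?f (dagger ?M (b d)) = dagger G (on_arcs ?f (b d))" if "d \<in> ?N" "d \<notin> I" for d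
        using that gG by (simp add: d3 f1 f2 NA)
    qed
    show "on_arcs ?f ` attached ?M \<subseteq> attached G" unfolding M using f1 by (auto simp: darts_def)
    show "on_verts ?f (tgt ?M d) = tgt G (on_arcs ?f d)" if "d \<in> attached ?M" for d
      using that unfolding M by (simp add: f1 fv darts_def)
    show "bij_betw (on_arcs ?f) (nb ?M v) (nb G (on_verts ?f v))" if "v \<in> verts ?M" for v
    proof -
      have "nb ?M v = nb G v" using that unfolding nb_def M by (auto simp: darts_def)
      moreover have "on_arcs ?f d = d" if "d \<in> nb G v" for d
        using that \<open>v \<in> verts ?M\<close> unfolding M by (intro f1) (auto simp: nb_def darts_def)
      ultimately show ?thesis using that unfolding M by (simp add: fv bij_betw_def inj_on_def)
    qed
  qed
  have "connected_graph ?M"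
    unfolding connected_graph_def
  proof (intro conjI gM notI)
    show "nonempty_graph ?M" unfolding nonempty_graph_def M using S by simp
    assume "\<exists>H K. is_graph H \<and> is_graph K \<and> nonempty_graph H \<and> nonempty_graph K \<and> is_disjoint_union ?M H K"
    then obtain H K where HK: "is_graph H" "is_graph K" "nonempty_graph H" "nonempty_graph K"
      and u: "is_disjoint_union ?M H K" by blast
    have uA: "arcs ?M = arcs H \<union> arcs K" "arcs H \<inter> arcs K = {}"
      and uV: "S = verts H \<union> verts K" "verts H \<inter> verts K = {}"
      and uN: "?N = attached H \<union> attached K"
      and uH: "\<And>a. a \<in> arcs H \<Longrightarrow> dagger ?M a = dagger H a" "\<And>d. d \<in> attached H \<Longrightarrow> tgt ?M d = tgt H d"
      and uK: "\<And>a. a \<in> arcs K \<Longrightarrow> dagger ?M a = dagger K a" "\<And>d. d \<in> attached K \<Longrightarrow> tgt ?M d = tgt K d"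
      using u unfolding is_disjoint_union_def M by auto
    \<comment> \<open>A part without vertices has no attached arc, but of two opposite arcs of the
      model at least one is a dart.\<close>
    have vne: "verts X \<noteq> {}" if X: "is_graph X" "nonempty_graph X" "arcs X \<subseteq> arcs ?M"
      "\<And>a. a \<in> arcs X \<Longrightarrow> dagger ?M a = dagger X a" "?N \<inter> arcs X \<subseteq> attached X" for X
    proof
      assume v: "verts X = {}"
      then have att: "attached X = {}" using tgt_verts[OF X(1)] by auto
      obtain a where a: "a \<in> arcs X" using X(2) v by (auto simp: nonempty_graph_def)
      then have "dagger ?M a \<in> arcs X" using X(1,4) by auto
      then have no: "a \<notin> ?N" "dagger ?M a \<notin> ?N" using att X(5) a by auto
      have aM: "a \<in> arcs ?M" using a X(3) by blast
      have "a \<in> ?N \<or> dagger ?M a \<in> ?N"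
        by (rule arc_cases[OF aM]) (use I d3 in auto)
      then show False using no by simp
    qed
    have "?N \<inter> arcs H \<subseteq> attached H" "?N \<inter> arcs K \<subseteq> attached K"
      using uN uA(2) attached_arcs[OF HK(1)] attached_arcs[OF HK(2)] by blast+
    then have "verts H \<noteq> {}" "verts K \<noteq> {}"
      using vne[OF HK(1,3) _ uH(1)] vne[OF HK(2,4) _ uK(1)] uA(1) by blast+
    \<comment> \<open>An internal edge from \<open>verts H\<close> to \<open>verts K\<close> would
      have its two arcs in different parts, against the involution.\<close>
    then have "verts H \<noteq> {}" "verts H \<subset> S" using uV by auto
    from cross[OF this] obtain x where x: "x \<in> darts G (verts H)" "x \<in> I"
      "dagger G x \<in> darts G (S - verts H)" by blast
    have xN: "x \<in> ?N" "dagger G x \<in> ?N" using x I Id by auto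
    have "tgt G d \<in> verts H" if "d \<in> attached H" for d
      using uH(2)[OF that] tgt_verts[OF HK(1) that] uN that M(4) by simp
    moreover have "tgt G d \<in> verts K" if "d \<in> attached K" for d
      using uK(2)[OF that] tgt_verts[OF HK(2) that] uN that M(4) by simp
    ultimately have "x \<in> attached H" "dagger G x \<in> attached K"
      using xN x(1,3) uV uN unfolding darts_def by blast+
    then have "x \<in> arcs H" "dagger G x \<in> arcs K" using HK by (auto simp: attached_arcs)
    then show False using uH(1)[of x] d1[OF x(2)] HK(1) uA(2) by (metis IntI dagger_arcs emptyE)
  qed
  moreover have "inj_on (on_verts ?f) (verts ?M)" unfolding M using fv by (auto simp: inj_on_def)
  ultimately show "embedding ?M G ?f" using G et by (simp add: embedding_def)
  show "on_arcs ?f ` bdry ?M = dagger G ` (?N - I)"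
    unfolding bd image_image using f2 by (intro image_cong) auto
qed

lemma model_verts: "on_verts (model_incl G S I b) ` verts (model G S I b) = S"
  by (auto simp: model_def model_incl_def Let_def)

lemma star_class_Emb:
  fixes G :: "('a::infinite, 'v) graph"
  assumes G: "connected_graph G" and v: "v \<in> verts G"
  shows "star_class G v \<in> Emb G" "emb_verts (star_class G v) = {v}"
    "emb_bdry (star_class G v) = dagger G ` nb G v"
proof -
  have "finite (nb G v)" using nb_arcs[of G] graph_finite(1)[of G] G
    by (auto intro: finite_subset)
  then have b: "inj_on (star_new G v) (nb G v) \<and> star_new G v ` nb G v \<inter> nb G v = {}"
    unfolding star_new_def by (intro someI_ex[OF ex_fresh_inj]) auto
  have e: "embedding (star G v) G (star_incl G v)"
    "on_arcs (star_incl G v) ` bdry (star G v) = dagger G ` (darts G {v} - {})"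
    unfolding star_model star_incl_model
    by (rule model_embedding; use G v b in \<open>auto simp: darts_singleton\<close>)+
  show "star_class G v \<in> Emb G" "emb_verts (star_class G v) = {v}"
    "emb_bdry (star_class G v) = dagger G ` nb G v"
    unfolding star_class_def
    using e model_verts[of G "{v}" "{}" "star_new G v"]
    by (auto simp: emb_class_Emb emb_verts_class emb_bdry_class darts_singleton star_model star_incl_model)
qed

text \<open>With \<open>Emb_eqI\<close> this makes \<open>Emb G\<close> a copy of the set of
  admissible pairs. The infinite type of arcs supplies new arcs for the cut ends.\<close>

lemma admissible_class:
  fixes G :: "('a::infinite, 'v) graph"
  assumes G: "connected_graph G" and adm: "admissible G S B"
  shows "\<exists>c\<in>Emb G. emb_verts c = S \<and> emb_bdry c = B"
proof (cases "S = {}")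
  case True
  have gG: "is_graph G" using G by simp
  obtain a where a: "a \<in> arcs G" "B = {a, dagger G a}" using adm True by (auto simp: admissible_def)
  let ?E = "edge_graph a (dagger G a) :: ('a, 'v) graph"
  let ?f = "\<lparr>on_arcs = (\<lambda>x\<in>{a, dagger G a}. x), on_verts = (\<lambda>v\<in>{}. v)\<rparr>"
  have cE: "connected_graph ?E" using connected_edge_graph dagger_neq[OF gG a(1)] by metis
  have "etale ?E G ?f"
    unfolding etale_def using a gG cE dagger_neq[OF gG a(1)]
    by (auto simp: edge_graph_def restrict_def)
  then have f: "embedding ?E G ?f" using G cE by (simp add: embedding_def edge_graph_def)
  have "emb_verts (emb_class G ?E ?f) = {}" "emb_bdry (emb_class G ?E ?f) = {a, dagger G a}"
    using emb_verts_class[OF f] emb_bdry_class[OF f] by (auto simp: edge_graph_def bdry_def)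
  then show ?thesis using emb_class_Emb[OF f] True a by blast
next
  case False
  have gG: "is_graph G" using G by simp
  let ?N = "darts G S"
  \<comment> \<open>The darts on uncut edges. The clauses of \<open>admissible\<close> on cut edges
    make this set closed under \<open>dagger G\<close>, and the clause on subsets makes it connect
    \<open>S\<close>.\<close>
  let ?I = "{x \<in> ?N. dagger G x \<notin> B}"
  have S: "S \<subseteq> verts G" and BA: "B \<subseteq> arcs G" and B1: "\<And>b. b \<in> B \<Longrightarrow> dagger G b \<in> ?N"
    and B2: "\<And>x. x \<in> ?N \<Longrightarrow> dagger G x \<notin> ?N \<Longrightarrow> dagger G x \<in> B"
    and B3: "\<And>x. x \<in> ?N \<Longrightarrow> x \<in> B \<Longrightarrow> dagger G x \<in> B"
    and B4: "\<And>T. T \<noteq> {} \<Longrightarrow> T \<subset> S \<Longrightarrow> \<exists>x\<in>darts G T. dagger G x \<in> darts G (S - T) \<and> dagger G x \<notin> B"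
    using adm False by (auto simp: admissible_def)
  have fin: "finite ?N" using darts_arcs[OF gG] graph_finite(1)[OF gG] by (auto intro: finite_subset)
  then obtain b where b: "inj_on b (?N - ?I)" "b ` (?N - ?I) \<inter> ?N = {}"
    using ex_fresh_inj[of "?N - ?I" ?N] by auto
  have Id: "dagger G x \<in> ?I" if "x \<in> ?I" for x
    using that B2[of x] B3[of x] gG by (auto simp: darts_arcs)
  have cr: "\<exists>x\<in>darts G T. x \<in> ?I \<and> dagger G x \<in> darts G (S - T)" if "T \<noteq> {}" "T \<subset> S" for T
    using B4[OF that] that(2) darts_mono[of T S G] by blast
  have m: "embedding (model G S ?I b) G (model_incl G S ?I b)"
    "on_arcs (model_incl G S ?I b) ` bdry (model G S ?I b) = dagger G ` (?N - ?I)"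
    by (rule model_embedding[OF G S False]; use Id b cr in blast)+
  have "dagger G ` (?N - ?I) = B"
  proof (intro equalityI subsetI)
    fix x assume x: "x \<in> B"
    then have "dagger G x \<in> ?N - ?I" "x = dagger G (dagger G x)" using B1 BA gG by auto
    then show "x \<in> dagger G ` (?N - ?I)" by blast
  qed auto
  then have "emb_verts (emb_class G (model G S ?I b) (model_incl G S ?I b)) = S"
    "emb_bdry (emb_class G (model G S ?I b) (model_incl G S ?I b)) = B"
    using emb_verts_class[OF m(1)] emb_bdry_class[OF m(1)] m(2)
    by (simp_all only: model_verts)
  then show ?thesis using emb_class_Emb[OF m(1)] by blast
qed

section \<open>Gluing admissible pairs\<close>

lemma admissible_empty: "admissible G {} B \<longleftrightarrow> (\<exists>a\<in>arcs G. B = {a, dagger G a})"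
  by (simp add: admissible_def)

lemma admissible_subset: "admissible G S B \<Longrightarrow> S \<subseteq> verts G"
  by (simp add: admissible_def)

lemma admissible_arcs: "is_graph G \<Longrightarrow> admissible G S B \<Longrightarrow> B \<subseteq> arcs G"
  by (auto simp: admissible_def split: if_splits)

lemma admissibleD:
  assumes "admissible G S B" "S \<noteq> {}"
  shows "b \<in> B \<Longrightarrow> dagger G b \<in> darts G S"
    and "x \<in> darts G S \<Longrightarrow> dagger G x \<notin> darts G S \<Longrightarrow> dagger G x \<in> B"
    and "x \<in> darts G S \<Longrightarrow> x \<in> B \<Longrightarrow> dagger G x \<in> B"
    and "T \<noteq> {} \<Longrightarrow> T \<subset> S \<Longrightarrow>
      \<exists>x\<in>darts G T. dagger G x \<in> darts G (S - T) \<and> dagger G x \<notin> B"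
  using assms unfolding admissible_def by auto

lemma admissibleI:
  assumes "S \<subseteq> verts G" "S \<noteq> {}" "B \<subseteq> arcs G" "\<And>b. b \<in> B \<Longrightarrow> dagger G b \<in> darts G S"
    "\<And>x. x \<in> darts G S \<Longrightarrow> dagger G x \<notin> darts G S \<Longrightarrow> dagger G x \<in> B"
    "\<And>x. x \<in> darts G S \<Longrightarrow> x \<in> B \<Longrightarrow> dagger G x \<in> B"
    "\<And>T. T \<noteq> {} \<Longrightarrow> T \<subset> S \<Longrightarrow>
      \<exists>x\<in>darts G T. dagger G x \<in> darts G (S - T) \<and> dagger G x \<notin> B"
  shows "admissible G S B"
  using assms unfolding admissible_def by simp

lemma admissible_edge_eq:
  assumes "is_graph G" "admissible G {} B" "a \<in> B"
  shows "B = {a, dagger G a}"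
  using assms by (auto simp: admissible_empty)

lemma admissible_darts_bdry:
  assumes "is_graph G" "admissible G S B" "b \<in> B" "dagger G b \<in> B" "S \<noteq> {}"
  shows "b \<in> darts G S"
  using admissibleD(1)[OF assms(2,5) assms(4)] admissible_arcs[OF assms(1,2)] assms by auto

lemma star_admissible:
  assumes "is_graph G" "v \<in> verts G"
  shows "admissible G {v} (dagger G ` nb G v)"
  by (rule admissibleI) (use assms in \<open>auto simp: darts_singleton nb_arcs image_iff\<close>)

text \<open>Arcs of \<open>B1\<close> and \<open>B2\<close> have their opposites at the disjoint
  sets \<open>S1\<close> and \<open>S2\<close>; when one of the pairs is an edge, only one arc of it
  survives, and that arc is removed on the other side. This disjointness keeps
  \<open>\<phi>0\<close> injective on a glued boundary.\<close>

lemma glue_disjoint: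
  assumes G: "is_graph G" and 1: "admissible G S1 B1" and 2: "admissible G S2 B2"
    and S: "S1 \<inter> S2 = {}" and a: "a \<in> B1" "dagger G a \<in> B2"
  shows "(B1 - {a}) \<inter> (B2 - {dagger G a}) = {}"
proof (cases "S1 = {} \<or> S2 = {}")
  case True
  have "a \<in> arcs G" using a(1) admissible_arcs[OF G 1] by auto
  then have "S1 = {} \<Longrightarrow> B1 = {a, dagger G a}" "S2 = {} \<Longrightarrow> B2 = {dagger G a, a}"
    using admissible_edge_eq[OF G] 1 2 a G by (metis dagger_dagger)+
  then show ?thesis using True by auto
next
  case False
  then show ?thesis
    using admissibleD(1)[OF 1] admissibleD(1)[OF 2] darts_disjoint[OF S, of G] by blast
qed

text \<open>Two subgraphs with disjoint vertices are joined along the edge of \<open>a\<close>.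
  Neither is assumed to be a star, because in the codomain the second one is an arbitrary class
  \<open>\<phi>1 w\<close>. If one of them is an edge, the result is the other one.\<close>

lemma glue_admissible:
  assumes G: "is_graph G" and 1: "admissible G S1 B1" and 2: "admissible G S2 B2"
    and S: "S1 \<inter> S2 = {}" and a: "a \<in> B1" "dagger G a \<in> B2"
  shows "admissible G (S1 \<union> S2) ((B1 - {a}) \<union> (B2 - {dagger G a}))"
proof (cases "S1 = {} \<or> S2 = {}")
  case True
  have "a \<in> arcs G" using a(1) admissible_arcs[OF G 1] by auto
  then have "S1 = {} \<Longrightarrow> (B1 - {a}) \<union> (B2 - {dagger G a}) = B2"
    "S2 = {} \<Longrightarrow> (B1 - {a}) \<union> (B2 - {dagger G a}) = B1"
    using admissible_edge_eq[OF G, of B1 a] admissible_edge_eq[OF G, of B2 "dagger G a"] 1 2 a G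
    by auto
  then show ?thesis using True 1 2 by auto
next
  case False
  then have n1: "S1 \<noteq> {}" and n2: "S2 \<noteq> {}" by auto
  have aA: "a \<in> arcs G" and da: "dagger G (dagger G a) = a"
    using a(1) admissible_arcs[OF G 1] G by auto
  note D1 = admissibleD[OF 1 n1] and D2 = admissibleD[OF 2 n2]
  have a1: "dagger G a \<in> darts G S1" and a2: "a \<in> darts G S2"
    using D1(1)[OF a(1)] D2(1)[OF a(2)] da by auto
  have dj: "darts G S1 \<inter> darts G S2 = {}" by (rule darts_disjoint[OF S])
  have dd: "x \<in> darts G S \<Longrightarrow> dagger G (dagger G x) = x" for x S using G by (simp add: darts_arcs)
  \<comment> \<open>An arc whose opposite lies at one piece is not on the boundary of the other, so
    internal edges of a piece stay internal after gluing.\<close>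
  have n12: "b \<notin> B2" if "dagger G b \<in> darts G S1" for b using D2(1)[of b] that dj by blast
  have n21: "b \<notin> B1" if "dagger G b \<in> darts G S2" for b using D1(1)[of b] that dj by blast
  show ?thesis
  proof (rule admissibleI, goal_cases)
    case 1 then show ?case using admissible_subset[OF \<open>admissible G S1 B1\<close>] admissible_subset[OF 2] by auto
  next
    case 2 then show ?case using n1 by auto
  next
    case 3 then show ?case
      using admissible_arcs[OF G \<open>admissible G S1 B1\<close>] admissible_arcs[OF G \<open>admissible G S2 B2\<close>] by auto
  next
    case (4 b) then show ?case using D1(1) D2(1) by (auto simp: darts_Un)
  next
    case (5 x)
    then show ?case using D1(2)[of x] D2(2)[of x] a1 a2 unfolding darts_Un by auto
  next
    case (6 x)
    show ?case
    proof (cases "x \<in> darts G S1")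
      case x1: True
      show ?thesis
      proof (cases "x \<in> B1")
        case True
        have "dagger G x \<in> darts G S1" using D1(1)[OF True] .
        then have "dagger G x \<noteq> a" using a2 dj by blast
        then show ?thesis using D1(3)[OF x1 True] by blast
      next
        case False
        then have xb: "x \<in> B2" "x \<noteq> dagger G a" using 6 by auto
        then have "dagger G x \<notin> darts G S1" using D2(1) dj by blast
        moreover have "dagger G x \<noteq> a" using xb dd[OF x1] by metis
        ultimately show ?thesis using D1(2)[OF x1] by blast
      qed
    next
      case False
      then have x2: "x \<in> darts G S2" using 6 by (auto simp: darts_Un)
      show ?thesis
      proof (cases "x \<in> B2")
        case True
        have "dagger G x \<in> darts G S2" using D2(1)[OF True] .
        then have "dagger G x \<noteq> dagger G a" using a1 dj by auto
        then show ?thesis using D2(3)[OF x2 True] by blast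
      next
        case False
        then have xb: "x \<in> B1" "x \<noteq> a" using 6 by auto
        then have "dagger G x \<notin> darts G S2" using D1(1) dj by blast
        moreover have "dagger G x \<noteq> dagger G a" using xb dd[OF x2] da by metis
        ultimately show ?thesis using D2(2)[OF x2] by blast
      qed
    qed
  next
    case (7 T)
    \<comment> \<open>A proper subset either splits one of the pieces, and an internal edge of that
      piece crosses, or is one of the pieces, and the edge of \<open>a\<close> crosses.\<close>
    consider "T \<inter> S1 \<noteq> {}" "T \<inter> S1 \<subset> S1" | "T \<inter> S2 \<noteq> {}" "T \<inter> S2 \<subset> S2" | "T = S1" | "T = S2"
      using 7 S by blast
    then show ?case
    proof cases
      case i: 1
      obtain x where x: "x \<in> darts G (T \<inter> S1)" "dagger G x \<in> darts G (S1 - T \<inter> S1)" "dagger G x \<notin> B1"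
        using D1(4)[OF i] by blast
      have "x \<in> darts G S1" using x(1) by (auto simp: darts_def)
      then have "dagger G x \<notin> B2" using n12 dd by metis
      moreover have "dagger G x \<in> darts G (S1 \<union> S2 - T)" "x \<in> darts G T"
        using x by (auto simp: darts_def)
      ultimately show ?thesis using x(3) by blast
    next
      case i: 2
      obtain x where x: "x \<in> darts G (T \<inter> S2)" "dagger G x \<in> darts G (S2 - T \<inter> S2)" "dagger G x \<notin> B2"
        using D2(4)[OF i] by blast
      have "x \<in> darts G S2" using x(1) by (auto simp: darts_def)
      then have "dagger G x \<notin> B1" using n21 dd by metis
      moreover have "dagger G x \<in> darts G (S1 \<union> S2 - T)" "x \<in> darts G T"
        using x by (auto simp: darts_def)
      ultimately show ?thesis using x(3) by blast
    next
      case 3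
      then have "S1 \<union> S2 - T = S2" using S by blast
      then show ?thesis using 3 a1 a2 da n12[of a]
        by (intro bexI[of _ "dagger G a"]) auto
    next
      case 4
      then have "S1 \<union> S2 - T = S1" using S by blast
      then show ?thesis using 4 a1 a2 da n21[of "dagger G a"]
        by (intro bexI[of _ a]) auto
    qed
  qed
qed

lemma glue_le:
  assumes G: "is_graph G" and 1: "admissible G S1 B1" and 2: "admissible G S2 B2"
    and S: "S1 \<inter> S2 = {}" and a: "a \<in> B1" "dagger G a \<in> B2"
  shows "sub_le G S1 B1 (S1 \<union> S2) ((B1 - {a}) \<union> (B2 - {dagger G a}))"
proof -
  have aA: "a \<in> arcs G" and da: "dagger G (dagger G a) = a"
    using a(1) admissible_arcs[OF G 1] G by auto
  show ?thesis
  proof (cases "S1 = {}")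
    case True
    then have "B1 = {a, dagger G a}" using admissible_edge_eq[OF G, of B1 a] 1 a by auto
    moreover have "S2 \<noteq> {} \<Longrightarrow> a \<in> darts G S2" using admissibleD(1)[OF 2 _ a(2)] da by simp
    moreover have "S2 = {} \<Longrightarrow> B2 = {dagger G a, a}"
      using admissible_edge_eq[OF G, of B2 "dagger G a"] 2 a da by auto
    ultimately show ?thesis using True a(2) dagger_neq[OF G aA] by (auto simp: sub_le_def)
  next
    case False
    have "dagger G x \<in> B1" if x: "x \<in> darts G S1" "dagger G x \<in> B2" "dagger G x \<noteq> dagger G a" for x
    proof (cases "S2 = {}")
      case True
      then show ?thesis using admissible_edge_eq[OF G, of B2 "dagger G a"] 2 a da x by auto
    next
      case False
      have "x \<in> darts G S2" using admissibleD(1)[OF 2 False x(2)] x(1) G by (simp add: darts_arcs)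
      then show ?thesis using x(1) darts_disjoint[OF S, of G] by blast
    qed
    then show ?thesis using False by (auto simp: sub_le_def)
  qed
qed

text \<open>The cut edge of \<open>a\<close> has both ends at \<open>S\<close> and becomes internal.
  For \<open>S = {}\<close> this would leave an empty boundary, that is a circle without vertices,
  which is not a graph.\<close>

lemma close_admissible:
  assumes G: "is_graph G" and adm: "admissible G S B" and ne: "S \<noteq> {}" and a: "a \<in> B" "dagger G a \<in> B"
  shows "admissible G S (B - {a, dagger G a})"
proof -
  note D = admissibleD[OF adm ne]
  have da: "dagger G (dagger G a) = a" using a(1) admissible_arcs[OF G adm] G by auto
  have aD: "a \<in> darts G S" "dagger G a \<in> darts G S" using D(1)[OF a(1)] D(1)[OF a(2)] da by auto
  have dd: "x \<in> darts G S \<Longrightarrow> dagger G (dagger G x) = x" for x using G by (simp add: darts_arcs)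
  show ?thesis
  proof (rule admissibleI, goal_cases)
    case (6 x)
    then have "dagger G x \<noteq> a" "dagger G x \<noteq> dagger G a" using dd[of x] da by auto
    then show ?case using 6 D(3)[of x] by blast
  next
    case (7 T) then show ?case using D(4)[of T] by blast
  qed (use ne admissible_subset[OF adm] admissible_arcs[OF G adm] D aD in auto)
qed

lemma close_le: "S \<noteq> {} \<Longrightarrow> sub_le G S B S (B - X)"
  by (auto simp: sub_le_def)

text \<open>The two forms of \<open>sub_le\<close> do not compose formally when the first pair is an
  edge and the second is not. In that case an arc of \<open>B2\<close> has its opposite at
  \<open>S3\<close>, and by admissibility of the third pair it lies at \<open>S3\<close> itself or
  in \<open>B3\<close>.\<close>

lemma sub_le_trans:
  assumes G: "is_graph G" and adm: "admissible G S1 B1" "admissible G S2 B2" "admissible G S3 B3"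
    and le: "sub_le G S1 B1 S2 B2" "sub_le G S2 B2 S3 B3"
  shows "sub_le G S1 B1 S3 B3"
proof (cases "S1 = {}")
  case False
  then have "S2 \<noteq> {}" using le by (auto simp: sub_le_def)
  then have "S1 \<subseteq> S2" "\<forall>x\<in>darts G S1. dagger G x \<in> B2 \<longrightarrow> dagger G x \<in> B1"
    "S2 \<subseteq> S3" "\<forall>x\<in>darts G S2. dagger G x \<in> B3 \<longrightarrow> dagger G x \<in> B2"
    using le False unfolding sub_le_def by simp_all
  moreover from this(1) have "darts G S1 \<subseteq> darts G S2" by (rule darts_mono)
  ultimately show ?thesis unfolding sub_le_def using False by auto
next
  case True
  have B1: "B1 \<subseteq> darts G S2 \<union> B2" using le(1) True by (simp add: sub_le_def)
  have S: "S2 \<subseteq> S3" using le(2) by (auto simp: sub_le_def)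
  show ?thesis
  proof (cases "S2 = {}")
    case True
    then show ?thesis using le(2) B1 \<open>S1 = {}\<close> by (auto simp: sub_le_def)
  next
    case False
    then have 3: "S3 \<noteq> {}" using S by auto
    have "b \<in> darts G S3 \<union> B3" if "b \<in> B2" for b
    proof -
      have "dagger G b \<in> darts G S3" using admissibleD(1)[OF adm(2) False that] darts_mono[OF S, of G] by blast
      moreover have "dagger G (dagger G b) = b" using that admissible_arcs[OF G adm(2)] G by auto
      ultimately show ?thesis using admissibleD(2)[OF adm(3) 3] by (metis UnCI)
    qed
    then show ?thesis using B1 True darts_mono[OF S, of G] by (auto simp: sub_le_def)
  qed
qed

text \<open>Gluing adds a whole star along a single edge; other edges from \<open>w\<close> to
  \<open>S\<close> or to \<open>w\<close> itself stay cut at first and are repaired by later closing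
  moves. Each of the two moves has a simple image under a graphical map.\<close>

inductive grow :: "('a, 'v) graph \<Rightarrow> 'v set \<times> 'a set \<Rightarrow> 'v set \<times> 'a set \<Rightarrow> bool" for G where
  glue: "w \<in> verts G \<Longrightarrow> w \<notin> S \<Longrightarrow> x \<in> nb G w \<Longrightarrow> x \<in> B \<Longrightarrow>
    grow G (S, B) (S \<union> {w}, (B - {x}) \<union> (dagger G ` nb G w - {dagger G x}))"
| close: "x \<in> B \<Longrightarrow> dagger G x \<in> B \<Longrightarrow> grow G (S, B) (S, B - {x, dagger G x})"

lemma grow_admissible:
  assumes "grow G p q" "is_graph G" "admissible G (fst p) (snd p)" "fst p \<noteq> {}"
  shows "admissible G (fst q) (snd q)" "fst q \<noteq> {}"
  using assms
proof (induction rule: grow.cases)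
  case (glue w S x B)
  { case 1 then show ?case
      using glue glue_admissible[of G S B "{w}" "dagger G ` nb G w" x] star_admissible[of G w]
      by simp
  next case 2 then show ?case using glue by simp }
next
  case (close x B S)
  { case 1 then show ?case using close by (simp add: close_admissible)
  next case 2 then show ?case using close by simp }
qed

lemma grow_reaches:
  assumes G: "is_graph G" and adm: "admissible G S B"
    and "admissible G S0 B0" "S0 \<noteq> {}" "sub_le G S0 B0 S B"
  shows "(grow G)\<^sup>*\<^sup>* (S0, B0) (S, B)"
  using assms(3-)
proof (induction "(S0, B0)" arbitrary: S0 B0
    rule: wf_induct_rule[OF wf_measures, of "[\<lambda>(S', B'). card (S - S'), \<lambda>(S', B'). card B']"])
  case (1 S0 B0)
  note adm0 = \<open>admissible G S0 B0\<close> and ne = \<open>S0 \<noteq> {}\<close>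
  have sub: "S0 \<subseteq> S" and le: "\<And>x. x \<in> darts G S0 \<Longrightarrow> dagger G x \<in> B \<Longrightarrow> dagger G x \<in> B0"
    using \<open>sub_le G S0 B0 S B\<close> ne by (auto simp: sub_le_def)
  have neS: "S \<noteq> {}" using ne sub by auto
  have fin: "finite S" "finite B0"
    using admissible_subset[OF adm] admissible_arcs[OF G adm0] graph_finite[OF G]
    by (auto intro: finite_subset)
  have step: ?case if "grow G (S0, B0) (S1, B1)" "sub_le G S1 B1 S B"
    "card (S - S1) < card (S - S0) \<or> card (S - S1) = card (S - S0) \<and> card B1 < card B0" for S1 B1
  proof -
    have "(grow G)\<^sup>*\<^sup>* (S1, B1) (S, B)"
      using 1(1)[of S1 B1] grow_admissible[OF that(1) G] adm0 ne that by auto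
    then show ?thesis using that(1) by (rule converse_rtranclp_into_rtranclp[rotated])
  qed
  show ?case
  proof (cases "S0 = S")
    case False
    then obtain x where x: "x \<in> darts G S0" "dagger G x \<in> darts G (S - S0)" "dagger G x \<notin> B"
      using admissibleD(4)[OF adm neS ne] sub by blast
    let ?y = "dagger G x" and ?w = "tgt G (dagger G x)"
    have yx: "dagger G ?y = x" using x G by (simp add: darts_arcs)
    have w: "?w \<in> S" "?w \<notin> S0" "?w \<in> verts G" "?y \<in> nb G ?w"
      using x admissible_subset[OF adm] by (auto simp: darts_def nb_def)
    have y: "?y \<in> B0" using admissibleD(2)[OF adm0 ne x(1)] w(2) by (auto simp: darts_def)
    have xB: "x \<notin> B" using admissibleD(3)[OF adm neS, of x] x darts_mono[OF sub, of G] by blast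
    show ?thesis
    proof (rule step)
      show "grow G (S0, B0) (S0 \<union> {?w}, (B0 - {?y}) \<union> (dagger G ` nb G ?w - {dagger G ?y}))"
        by (rule grow.glue) (use w y in auto)
      show "sub_le G (S0 \<union> {?w}) ((B0 - {?y}) \<union> (dagger G ` nb G ?w - {dagger G ?y})) S B"
        using sub w(1) le x(3) xB yx unfolding sub_le_def darts_Un darts_singleton by auto
      have "S - (S0 \<union> {?w}) \<subset> S - S0" using w by auto
      then show "card (S - (S0 \<union> {?w})) < card (S - S0) \<or> card (S - (S0 \<union> {?w})) = card (S - S0) \<and>
          card ((B0 - {?y}) \<union> (dagger G ` nb G ?w - {dagger G ?y})) < card B0"
        using fin by (auto intro!: psubset_card_mono)
    qed
  next
    case True
    have BB: "B \<subseteq> B0"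
    proof
      fix b assume b: "b \<in> B"
      then have "dagger G (dagger G b) = b" using admissible_arcs[OF G adm] G by auto
      then show "b \<in> B0" using le[of "dagger G b"] admissibleD(1)[OF adm neS b] b True by simp
    qed
    show ?thesis
    proof (cases "B = B0")
      case True
      then show ?thesis using \<open>S0 = S\<close> by simp
    next
      case False
      then obtain b where b: "b \<in> B0" "b \<notin> B" using BB by blast
      have bd: "dagger G b \<in> darts G S" "dagger G (dagger G b) = b"
        using admissibleD(1)[OF adm0 ne b(1)] True admissible_arcs[OF G adm0] b G by auto
      then have bS: "b \<in> darts G S" using admissibleD(2)[OF adm neS, of "dagger G b"] b by auto
      have db: "dagger G b \<in> B0" using admissibleD(3)[OF adm0 ne _ b(1)] bS True by simp
      have dB: "dagger G b \<notin> B" using admissibleD(3)[OF adm neS bd(1)] bd(2) b by auto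
      show ?thesis
      proof (rule step)
        show "grow G (S0, B0) (S0, B0 - {b, dagger G b})" by (rule grow.close) (use b db in auto)
        show "sub_le G S0 (B0 - {b, dagger G b}) S B"
          using ne sub le b dB by (auto simp: sub_le_def)
        have "B0 - {b, dagger G b} \<subset> B0" using b by auto
        then show "card (S - S0) < card (S - S0) \<or> card (S - S0) = card (S - S0) \<and>
            card (B0 - {b, dagger G b}) < card B0"
          using fin by (auto intro!: psubset_card_mono)
      qed
    qed
  qed
qed

text \<open>The star at any vertex of \<open>S\<close> can serve as the start: all its edges are
  cut, so it lies below every pair containing that vertex.\<close>

lemma grow_induct [consumes 3, case_names star glue close]:
  assumes G: "is_graph G" and adm: "admissible G S B" and ne: "S \<noteq> {}"
    and star: "\<And>v. v \<in> S \<Longrightarrow> P {v} (dagger G ` nb G v)"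
    and glue: "\<And>S B w x. admissible G S B \<Longrightarrow> S \<noteq> {} \<Longrightarrow> P S B \<Longrightarrow> w \<in> verts G \<Longrightarrow> w \<notin> S \<Longrightarrow>
      x \<in> nb G w \<Longrightarrow> x \<in> B \<Longrightarrow> P (S \<union> {w}) ((B - {x}) \<union> (dagger G ` nb G w - {dagger G x}))"
    and close: "\<And>S B x. admissible G S B \<Longrightarrow> S \<noteq> {} \<Longrightarrow> P S B \<Longrightarrow> x \<in> B \<Longrightarrow> dagger G x \<in> B \<Longrightarrow>
      P S (B - {x, dagger G x})"
  shows "P S B"
proof -
  obtain v where v: "v \<in> S" using ne by auto
  have st: "admissible G {v} (dagger G ` nb G v)"
    using star_admissible[OF G] v admissible_subset[OF adm] by auto
  have "sub_le G {v} (dagger G ` nb G v) S B" using v by (auto simp: sub_le_def darts_singleton)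
  then have "(grow G)\<^sup>*\<^sup>* ({v}, dagger G ` nb G v) (S, B)" using grow_reaches[OF G adm st] by simp
  moreover have "admissible G (fst q) (snd q) \<and> fst q \<noteq> {} \<and> P (fst q) (snd q)"
    if "(grow G)\<^sup>*\<^sup>* ({v}, dagger G ` nb G v) q" for q
    using that
  proof (induction rule: rtranclp_induct)
    case base
    then show ?case using star[OF v] st by simp
  next
    case (step q r)
    have "P (fst r) (snd r)" using step(2,3) by (cases rule: grow.cases) (auto intro: glue[simplified] close)
    then show ?case using step grow_admissible[OF step(2) G] by blast
  qed
  ultimately show ?thesis by fastforce
qed

section \<open>Images of admissible pairs under graphical maps\<close>

text \<open>The multiplicity of \<open>x\<close> on the left counts the \<open>v\<close> with
  \<open>x \<in> A v\<close>; the inclusion bounds it by 1 on \<open>W\<close> and by 0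
  elsewhere.\<close>

lemma sum_mset_set_subseteq_iff:
  assumes "finite V" "\<And>v. v \<in> V \<Longrightarrow> finite (A v)" "finite W"
  shows "(\<Sum>v\<in>V. mset_set (A v)) \<subseteq># mset_set W \<longleftrightarrow>
    (\<forall>v\<in>V. A v \<subseteq> W) \<and> (\<forall>v\<in>V. \<forall>w\<in>V. v \<noteq> w \<longrightarrow> A v \<inter> A w = {})"
proof -
  have cnt: "count (\<Sum>v\<in>V. mset_set (A v)) x = card {v \<in> V. x \<in> A v}" for x
  proof -
    have "count (\<Sum>v\<in>V. mset_set (A v)) x = (\<Sum>v\<in>V. if x \<in> A v then 1 else 0)"
      unfolding count_sum by (rule sum.cong) (use assms(2) in \<open>auto simp: count_mset_set'\<close>)
    then show ?thesis using assms(1) by (simp add: sum.If_cases Collect_conj_eq Int_commute)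
  qed
  have le1: "card {v \<in> V. x \<in> A v} \<le> Suc 0 \<longleftrightarrow> (\<forall>v\<in>V. \<forall>w\<in>V. x \<in> A v \<longrightarrow> x \<in> A w \<longrightarrow> v = w)" for x
    using assms(1) by (subst card_le_Suc0_iff_eq) auto
  have le0: "card {v \<in> V. x \<in> A v} = 0 \<longleftrightarrow> (\<forall>v\<in>V. x \<notin> A v)" for x
    using assms(1) by auto
  have "(\<Sum>v\<in>V. mset_set (A v)) \<subseteq># mset_set W \<longleftrightarrow>
      (\<forall>x. if x \<in> W then card {v \<in> V. x \<in> A v} \<le> Suc 0 else card {v \<in> V. x \<in> A v} = 0)"
    unfolding subseteq_mset_def cnt using assms(3) by (auto simp: count_mset_set')
  also have "\<dots> \<longleftrightarrow> (\<forall>v\<in>V. A v \<subseteq> W) \<and> (\<forall>v\<in>V. \<forall>w\<in>V. v \<noteq> w \<longrightarrow> A v \<inter> A w = {})"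
    unfolding le1 le0 by (auto split: if_splits) blast+
  finally show ?thesis .
qed

lemma emb_verts_finite: "c \<in> Emb G \<Longrightarrow> finite (emb_verts c)"
  using admissible_subset[OF Emb_admissible] Emb_connected
  by (metis connected_is_graph finite_subset graph_finite(2))

lemma emb_bdry_finite: "c \<in> Emb G \<Longrightarrow> finite (emb_bdry c)"
  using admissible_arcs[OF _ Emb_admissible] Emb_connected
  by (metis connected_is_graph finite_subset graph_finite(1))

lemma graphical_maps_iff:
  assumes "connected_graph G" "connected_graph G'"
  shows "(\<phi>0, \<phi>1) \<in> graphical_maps G G' \<longleftrightarrow>
    involutive_fun G G' \<phi>0 \<and> \<phi>1 \<in> verts G \<rightarrow>\<^sub>E Emb G' \<and>
    (\<forall>v\<in>verts G. \<forall>w\<in>verts G. v \<noteq> w \<longrightarrow> emb_verts (\<phi>1 v) \<inter> emb_verts (\<phi>1 w) = {}) \<and>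
    (\<forall>v\<in>verts G. inj_on \<phi>0 (dagger G ` nb G v) \<and> \<phi>0 ` dagger G ` nb G v = emb_bdry (\<phi>1 v)) \<and>
    (bdry G = {} \<longrightarrow> (\<exists>v\<in>verts G. emb_verts (\<phi>1 v) \<noteq> {}))"
proof (cases "\<phi>1 \<in> verts G \<rightarrow>\<^sub>E Emb G'")
  case False
  then show ?thesis by (auto simp: graphical_maps_def)
next
  case True
  then have E: "\<phi>1 v \<in> Emb G'" if "v \<in> verts G" for v using that by auto
  have gG: "is_graph G" "is_graph G'" using assms by auto
  have "bij_betw (\<lambda>a. \<phi>0 (dagger G a)) (nb G v) X \<longleftrightarrow>
      inj_on \<phi>0 (dagger G ` nb G v) \<and> \<phi>0 ` dagger G ` nb G v = X" for v X
  proof -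
    have "inj_on (dagger G) (nb G v)"
      by (rule inj_on_inverseI[of _ "dagger G"]) (use gG in \<open>simp add: nb_arcs\<close>)
    then show ?thesis unfolding bij_betw_def
      using inj_on_imageI[of \<phi>0 "dagger G" "nb G v"] comp_inj_on[of "dagger G" "nb G v" \<phi>0]
      by (auto simp: image_image comp_def)
  qed
  moreover have "(\<Sum>v\<in>verts G. mset_set (emb_verts (\<phi>1 v))) \<subseteq># mset_set (verts G') \<longleftrightarrow>
      (\<forall>v\<in>verts G. \<forall>w\<in>verts G. v \<noteq> w \<longrightarrow> emb_verts (\<phi>1 v) \<inter> emb_verts (\<phi>1 w) = {})"
    by (subst sum_mset_set_subseteq_iff)
      (use graph_finite gG emb_verts_finite[OF E] admissible_subset[OF Emb_admissible[OF E]] in auto)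
  ultimately show ?thesis using True is_edge_iff[OF E] by (auto simp: graphical_maps_def)
qed

section \<open>Image of a pair under a graphical map\<close>

locale graphical =
  fixes G G' :: "('a::infinite, 'v) graph" and \<phi>0 :: "'a \<Rightarrow> 'a" and \<phi>1 :: "'v \<Rightarrow> ('a, 'v) emb"
  assumes G: "connected_graph G" and G': "connected_graph G'"
    and graphical: "(\<phi>0, \<phi>1) \<in> graphical_maps G G'"
begin

abbreviation T :: "'v set \<Rightarrow> 'v set" where "T S \<equiv> \<Union>v\<in>S. emb_verts (\<phi>1 v)"

lemma gG [simp]: "is_graph G" and gG' [simp]: "is_graph G'"
  using G G' by auto

lemma \<phi>0_arcs: "a \<in> arcs G \<Longrightarrow> \<phi>0 a \<in> arcs G'"
  and \<phi>0_dagger: "a \<in> arcs G \<Longrightarrow> \<phi>0 (dagger G a) = dagger G' (\<phi>0 a)"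
  and \<phi>1_Emb: "v \<in> verts G \<Longrightarrow> \<phi>1 v \<in> Emb G'"
  and \<phi>1_disjoint: "v \<in> verts G \<Longrightarrow> w \<in> verts G \<Longrightarrow> v \<noteq> w \<Longrightarrow> emb_verts (\<phi>1 v) \<inter> emb_verts (\<phi>1 w) = {}"
  and \<phi>0_inj_star: "v \<in> verts G \<Longrightarrow> inj_on \<phi>0 (dagger G ` nb G v)"
  and \<phi>1_bdry: "v \<in> verts G \<Longrightarrow> emb_bdry (\<phi>1 v) = \<phi>0 ` dagger G ` nb G v"
  and \<phi>1_nonedge: "bdry G = {} \<Longrightarrow> \<exists>v\<in>verts G. emb_verts (\<phi>1 v) \<noteq> {}"
  using graphical unfolding graphical_maps_iff[OF G G'] by (auto simp: involutive_fun_def)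

text \<open>Injectivity belongs to the invariant: the induction needs it so that
  \<open>\<phi>0\<close> commutes with the removal of boundary arcs, and axiom (iv) counts
  multiplicities.\<close>

definition good :: "'v set \<Rightarrow> 'a set \<Rightarrow> bool" where
  "good S B \<longleftrightarrow> inj_on \<phi>0 B \<and> admissible G' (T S) (\<phi>0 ` B)"

lemma good_star:
  assumes "v \<in> verts G" shows "good {v} (dagger G ` nb G v)"
  using Emb_admissible[OF \<phi>1_Emb[OF assms]] \<phi>1_bdry[OF assms] \<phi>0_inj_star[OF assms]
  by (simp add: good_def)

lemma T_disjoint:
  assumes "S \<subseteq> verts G" "w \<in> verts G" "w \<notin> S"
  shows "T S \<inter> emb_verts (\<phi>1 w) = {}"
proof -
  have "emb_verts (\<phi>1 v) \<inter> emb_verts (\<phi>1 w) = {}" if "v \<in> S" for v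
    using that assms \<phi>1_disjoint[of v w] by blast
  then show ?thesis by blast
qed

text \<open>Attaching the star of \<open>w\<close> is carried to gluing the class
  \<open>\<phi>1 w\<close>, which condition (a) makes vertex disjoint from the image so far. If
  \<open>\<phi>1 w\<close> is an edge, the image does not change.\<close>

lemma image_glue:
  assumes adm: "admissible G S B" and good: "good S B" and w: "w \<in> verts G" "w \<notin> S"
    and x: "x \<in> nb G w" "x \<in> B"
  shows "good (S \<union> {w}) ((B - {x}) \<union> (dagger G ` nb G w - {dagger G x}))"
    and "\<phi>0 ` ((B - {x}) \<union> (dagger G ` nb G w - {dagger G x})) =
      (\<phi>0 ` B - {\<phi>0 x}) \<union> (emb_bdry (\<phi>1 w) - {dagger G' (\<phi>0 x)})"
    and "sub_le G' (T S) (\<phi>0 ` B) (T (S \<union> {w})) (\<phi>0 ` ((B - {x}) \<union> (dagger G ` nb G w - {dagger G x})))"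
proof -
  let ?C = "dagger G ` nb G w"
  have xA: "x \<in> arcs G" using x by (simp add: nb_arcs)
  have 1: "admissible G' (T S) (\<phi>0 ` B)" and i1: "inj_on \<phi>0 B" using good by (auto simp: good_def)
  have 2: "admissible G' (emb_verts (\<phi>1 w)) (\<phi>0 ` ?C)" and i2: "inj_on \<phi>0 ?C"
    using good_star[OF w(1)] by (auto simp: good_def)
  have dj: "T S \<inter> emb_verts (\<phi>1 w) = {}" by (rule T_disjoint[OF admissible_subset[OF adm] w])
  have a: "\<phi>0 x \<in> \<phi>0 ` B" "dagger G' (\<phi>0 x) \<in> \<phi>0 ` ?C"
    using x xA by (auto simp: \<phi>0_dagger[symmetric])
  have e1: "\<phi>0 ` (B - {x}) = \<phi>0 ` B - {\<phi>0 x}"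
    using i1 x(2) by (auto simp: inj_on_def)
  have e2: "\<phi>0 ` (?C - {dagger G x}) = \<phi>0 ` ?C - {dagger G' (\<phi>0 x)}"
    unfolding \<phi>0_dagger[OF xA, symmetric] using inj_on_image_set_diff[OF i2, of ?C "{dagger G x}"] x(1) by auto
  show e: "\<phi>0 ` ((B - {x}) \<union> (?C - {dagger G x})) =
      (\<phi>0 ` B - {\<phi>0 x}) \<union> (emb_bdry (\<phi>1 w) - {dagger G' (\<phi>0 x)})"
    unfolding image_Un e1 e2 \<phi>1_bdry[OF w(1)] ..
  have TS: "T (S \<union> {w}) = T S \<union> emb_verts (\<phi>1 w)" by auto
  have "\<phi>0 ` (B - {x}) \<inter> \<phi>0 ` (?C - {dagger G x}) = {}"
    unfolding e1 e2 by (rule glue_disjoint[OF gG' 1 2 dj a])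
  then have "inj_on \<phi>0 ((B - {x}) \<union> (?C - {dagger G x}))"
    using i1 i2 unfolding inj_on_Un by (blast intro: inj_on_subset)
  then show "good (S \<union> {w}) ((B - {x}) \<union> (?C - {dagger G x}))"
    unfolding good_def e TS using glue_admissible[OF gG' 1 2 dj a] \<phi>1_bdry[OF w(1)] by simp
  show "sub_le G' (T S) (\<phi>0 ` B) (T (S \<union> {w})) (\<phi>0 ` ((B - {x}) \<union> (?C - {dagger G x})))"
    unfolding e TS using glue_le[OF gG' 1 2 dj a] \<phi>1_bdry[OF w(1)] by simp
qed

text \<open>With nothing cut, no edge leaves \<open>S\<close>, so \<open>S\<close> is all of
  \<open>verts G\<close> and every arc is attached. Condition (c) then gives a vertex that is not
  sent to an edge.\<close>

lemma admissible_no_bdry: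
  assumes adm: "admissible G S {}" and ne: "S \<noteq> {}"
  shows "T S \<noteq> {}"
proof -
  note D = admissibleD[OF adm ne]
  have sub: "S \<subseteq> verts G" by (rule admissible_subset[OF adm])
  have "S = verts G"
  proof (rule ccontr)
    assume "S \<noteq> verts G"
    then obtain x where x: "x \<in> darts G S" "dagger G x \<in> darts G (verts G - S)"
      using connected_cross[OF G, of S] sub ne by auto
    then show False using D(2)[of x] by (auto simp: darts_def)
  qed
  moreover from this have "bdry G = {}"
    using connected_arc_attached[OF G] ne D(2) darts_verts[OF gG]
    by (auto simp: bdry_def) (metis dagger_dagger empty_iff gG)
  ultimately show ?thesis using \<phi>1_nonedge by auto
qed

text \<open>The danger is that all of \<open>S\<close> has collapsed to one edge. Then
  \<open>\<phi>0\<close> maps \<open>B\<close> onto its two arcs, injectivity makes \<open>B\<close>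
  the edge of \<open>x\<close>, and closing it leaves an empty boundary, which
  \<open>admissible_no_bdry\<close> excludes.\<close>

lemma image_close:
  assumes adm: "admissible G S B" and ne: "S \<noteq> {}" and good: "good S B"
    and x: "x \<in> B" "dagger G x \<in> B"
  shows "good S (B - {x, dagger G x})"
    and "\<phi>0 ` (B - {x, dagger G x}) = \<phi>0 ` B - {\<phi>0 x, dagger G' (\<phi>0 x)}"
    and "T S \<noteq> {}"
proof -
  have xA: "x \<in> arcs G" using x admissible_arcs[OF gG adm] by auto
  have 1: "admissible G' (T S) (\<phi>0 ` B)" and i1: "inj_on \<phi>0 B" using good by (auto simp: good_def)
  have "\<phi>0 ` {x, dagger G x} = {\<phi>0 x, dagger G' (\<phi>0 x)}" using \<phi>0_dagger[OF xA] by simp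
  then show e: "\<phi>0 ` (B - {x, dagger G x}) = \<phi>0 ` B - {\<phi>0 x, dagger G' (\<phi>0 x)}"
    using inj_on_image_set_diff[OF i1, of B "{x, dagger G x}"] x by auto
  show T: "T S \<noteq> {}"
  proof
    assume T0: "T S = {}"
    then have "\<phi>0 ` B = {\<phi>0 x, dagger G' (\<phi>0 x)}"
      using admissible_edge_eq[OF gG', of "\<phi>0 ` B" "\<phi>0 x"] 1 x(1) by simp
    then have "B - {x, dagger G x} = {}" using e by auto
    then have "admissible G S {}" using close_admissible[OF gG adm ne x] by (simp only:)
    then show False using admissible_no_bdry[of S] ne T0 by simp
  qed
  have "dagger G' (\<phi>0 x) \<in> \<phi>0 ` B" using x xA by (auto simp: \<phi>0_dagger[symmetric])
  then show "good S (B - {x, dagger G x})"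
    unfolding good_def e using close_admissible[OF gG' 1 T, of "\<phi>0 x"] x i1
    by (auto intro: inj_on_subset)
qed

lemma admissible_good:
  assumes "admissible G S B" shows "good S B"
proof (cases "S = {}")
  case True
  then obtain a where a: "a \<in> arcs G" "B = {a, dagger G a}" using assms by (auto simp: admissible_empty)
  have "\<phi>0 a \<noteq> \<phi>0 (dagger G a)"
    using dagger_neq[OF gG' \<phi>0_arcs[OF a(1)]] \<phi>0_dagger[OF a(1)] by metis
  then show ?thesis using True a \<phi>0_arcs[OF a(1)] \<phi>0_dagger[OF a(1)]
    by (auto simp: good_def admissible_empty)
next
  case False
  show ?thesis
    using gG assms False
  proof (induction rule: grow_induct)
    case (star v)
    then show ?case using good_star admissible_subset[OF assms] by auto
  next
    case (glue S B w x)
    then show ?case using image_glue(1) by blast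
  next
    case (close S B x)
    then show ?case using image_close(1) by blast
  qed
qed

lemma image_admissible: "admissible G S B \<Longrightarrow> admissible G' (T S) (\<phi>0 ` B)"
  and image_inj: "admissible G S B \<Longrightarrow> inj_on \<phi>0 B"
  using admissible_good by (auto simp: good_def)

text \<open>\<open>grow_reaches\<close> says that the order is generated by growth moves, so it is
  enough to compare the images before and after a single move.\<close>

lemma image_le_nonempty:
  assumes "admissible G S B" "S \<noteq> {}" "admissible G S' B'" "sub_le G S B S' B'"
  shows "sub_le G' (T S) (\<phi>0 ` B) (T S') (\<phi>0 ` B')"
proof -
  have "admissible G (fst q) (snd q) \<and> fst q \<noteq> {} \<and>
      sub_le G' (T S) (\<phi>0 ` B) (T (fst q)) (\<phi>0 ` snd q)"
    if "(grow G)\<^sup>*\<^sup>* (S, B) q" for q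
    using that
  proof (induction rule: rtranclp_induct)
    case base
    then show ?case using assms by simp
  next
    case (step q r)
    have adm: "admissible G (fst q) (snd q)" and ne: "fst q \<noteq> {}" using step by auto
    note adm' = grow_admissible[OF step(2) gG adm ne]
    have "sub_le G' (T (fst q)) (\<phi>0 ` snd q) (T (fst r)) (\<phi>0 ` snd r)"
      using step(2)
    proof cases
      case (glue w S x B)
      then show ?thesis using image_glue(3)[of S B w x] adm admissible_good[OF adm] by simp
    next
      case (close x B S)
      then show ?thesis
        using image_close(2,3)[of S B x] adm ne admissible_good[OF adm]
          close_le[of "T S" G' "\<phi>0 ` B" "{\<phi>0 x, dagger G' (\<phi>0 x)}"] by simp
    qed
    then show ?case
      using step sub_le_trans[OF gG' image_admissible[OF assms(1)] image_admissible[OF adm] image_admissible[OF adm'(1)]] adm'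
      by blast
  qed
  from this[OF grow_reaches[OF gG assms(3,1,2,4)]] show ?thesis by simp
qed

text \<open>An edge is not the start of growth moves. If the larger pair has vertices, the edge has
  an end at one of them, and the comparison goes through the star at that vertex.\<close>

lemma image_le:
  assumes adm: "admissible G S B" "admissible G S' B'" and le: "sub_le G S B S' B'"
  shows "sub_le G' (T S) (\<phi>0 ` B) (T S') (\<phi>0 ` B')"
proof (cases "S = {}")
  case False
  then show ?thesis using image_le_nonempty assms by blast
next
  case True
  show ?thesis
  proof (cases "S' = {}")
    case True
    then show ?thesis using \<open>S = {}\<close> le by (auto simp: sub_le_def)
  next
    case False
    obtain a where a: "a \<in> B" "a \<in> arcs G" "B = {a, dagger G a}"
      using adm(1) True by (auto simp: admissible_empty)
    have "a \<in> darts G S' \<union> B'" using le True a by (auto simp: sub_le_def)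
    then obtain d where d: "d \<in> darts G S'" "B = {d, dagger G d}"
      using admissibleD(1)[OF adm(2) False, of a] a
      by (cases "a \<in> B'") (force simp: insert_commute)+
    let ?v = "tgt G d"
    have v: "?v \<in> S'" "d \<in> nb G ?v" "d \<in> arcs G" using d by (auto simp: darts_def nb_def attached_arcs)
    have st: "admissible G {?v} (dagger G ` nb G ?v)"
      using star_admissible[of G ?v] v admissible_subset[OF adm(2)] by auto
    have "sub_le G {?v} (dagger G ` nb G ?v) S' B'" using v by (auto simp: sub_le_def darts_singleton)
    note 2 = image_le_nonempty[OF st _ adm(2) this]
    have db: "\<phi>0 (dagger G d) \<in> \<phi>0 ` dagger G ` nb G ?v" using v by auto
    have "\<phi>0 ` B \<subseteq> darts G' (T {?v}) \<union> \<phi>0 ` dagger G ` nb G ?v"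
    \<comment> \<open>If the star collapses to an edge, that edge is the image of \<open>B\<close>;
      otherwise one arc of the image of \<open>B\<close> lies on the boundary and the other one is
      attached.\<close>
    proof (cases "T {?v} = {}")
      case True
      then have "\<phi>0 ` dagger G ` nb G ?v = {\<phi>0 (dagger G d), dagger G' (\<phi>0 (dagger G d))}"
        using admissible_edge_eq[OF gG' _ db] image_admissible[OF st] by simp
      then show ?thesis using d(2) v(3) \<phi>0_dagger[of "dagger G d"] by auto
    next
      case False
      have "dagger G' (\<phi>0 (dagger G d)) \<in> darts G' (T {?v})"
        using admissibleD(1)[OF image_admissible[OF st] False db] .
      then show ?thesis using d(2) v(3) \<phi>0_dagger[of "dagger G d"] db by auto
    qed
    then have 1: "sub_le G' (T S) (\<phi>0 ` B) (T {?v}) (\<phi>0 ` dagger G ` nb G ?v)"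
      using True by (simp add: sub_le_def)
    show ?thesis
      by (rule sub_le_trans[OF gG' image_admissible[OF adm(1)] image_admissible[OF st] image_admissible[OF adm(2)] 1 2]) simp
  qed
qed

end

section \<open>Vertices sent to edges, and liftings of darts\<close>

context graphical
begin

text \<open>The boundary of the edge \<open>\<phi>1 w\<close> consists of two opposite arcs, and by
  (b) the darts at \<open>w\<close> correspond to them bijectively. So \<open>w\<close> has exactly
  two darts, and the graphical map treats \<open>w\<close> as a point inside an edge.\<close>

lemma edge_nb:
  assumes w: "w \<in> verts G" and e: "emb_verts (\<phi>1 w) = {}" and p: "p \<in> nb G w"
  obtains q where "nb G w = {p, q}" "p \<noteq> q" "\<phi>0 q = dagger G' (\<phi>0 p)"
proof -
  have pA: "p \<in> arcs G" using p by (simp add: nb_arcs)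
  have adm: "admissible G' {} (\<phi>0 ` dagger G ` nb G w)"
    using Emb_admissible[OF \<phi>1_Emb[OF w]] e \<phi>1_bdry[OF w] by simp
  have eq: "\<phi>0 ` dagger G ` nb G w = {\<phi>0 (dagger G p), \<phi>0 p}"
    using admissible_edge_eq[OF gG' adm, of "\<phi>0 (dagger G p)"] p pA \<phi>0_dagger[of "dagger G p"] by auto
  have "\<phi>0 p \<in> \<phi>0 ` dagger G ` nb G w" unfolding eq by simp
  then obtain q where q: "q \<in> nb G w" "\<phi>0 (dagger G q) = \<phi>0 p" by (elim imageE) simp
  have qA: "q \<in> arcs G" using q by (simp add: nb_arcs)
  have inj: "r = s" if "r \<in> nb G w" "s \<in> nb G w" "\<phi>0 (dagger G r) = \<phi>0 (dagger G s)" for r s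
  proof -
    have "dagger G r = dagger G s" using inj_onD[OF \<phi>0_inj_star[OF w] that(3)] that by auto
    then show ?thesis using that by (metis dagger_dagger gG nb_arcs)
  qed
  have "r = p \<or> r = q" if "r \<in> nb G w" for r
  proof -
    have "\<phi>0 (dagger G r) \<in> \<phi>0 ` dagger G ` nb G w" using that by simp
    then have "\<phi>0 (dagger G r) = \<phi>0 (dagger G p) \<or> \<phi>0 (dagger G r) = \<phi>0 (dagger G q)"
      unfolding eq q(2) by simp
    then show ?thesis using inj[OF that p] inj[OF that q(1)] by blast
  qed
  then have 1: "nb G w = {p, q}" using p q by auto
  have 2: "p \<noteq> q" using q(2) \<phi>0_dagger[OF pA] dagger_neq[OF gG' \<phi>0_arcs[OF pA]] by metis
  have "\<phi>0 q = dagger G' (\<phi>0 p)"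
    using q(2) \<phi>0_dagger[OF qA] \<phi>0_arcs[OF qA] by (metis dagger_dagger gG')
  then show thesis using that 1 2 by blast
qed

lemma nonedge_nb:
  assumes w: "w \<in> verts G" and e: "emb_verts (\<phi>1 w) \<noteq> {}" and p: "p \<in> nb G w"
  shows "\<phi>0 p \<in> darts G' (emb_verts (\<phi>1 w))"
proof -
  have pA: "p \<in> arcs G" using p by (simp add: nb_arcs)
  have "\<phi>0 (dagger G p) \<in> emb_bdry (\<phi>1 w)" using p \<phi>1_bdry[OF w] by simp
  then have "dagger G' (\<phi>0 (dagger G p)) \<in> darts G' (emb_verts (\<phi>1 w))"
    by (rule admissibleD(1)[OF Emb_admissible[OF \<phi>1_Emb[OF w]] e])
  then show ?thesis using pA \<phi>0_dagger[of "dagger G p"] by simp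
qed

text \<open>The pairs of darts whose lifts have to be opposite: the two ends of an internal edge, as
  the lift is involutive, and the two darts at a vertex sent to an edge, as the boundary of an edge
  consists of opposite arcs.\<close>

definition opposite :: "'v set \<Rightarrow> 'a set \<Rightarrow> 'a \<Rightarrow> 'a \<Rightarrow> bool" where
  "opposite S B p q \<longleftrightarrow>
     p \<in> darts G S \<and> q \<in> darts G S \<and> q = dagger G p \<and> q \<notin> B \<or>
     (\<exists>w\<in>S. emb_verts (\<phi>1 w) = {} \<and> nb G w = {p, q} \<and> p \<noteq> q)"

text \<open>Let \<open>K\<close> represent the image of \<open>(S, B)\<close>. An arc of \<open>G'\<close> may have two preimages in \<open>K\<close>,
  an attached and a boundary one, so the active map onto \<open>K\<close> is not determined by \<open>\<phi>0\<close>;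
  \<open>D\<close> is the set of darts whose image in \<open>K\<close> is attached. Opposite darts must go to
  opposite arcs of \<open>K\<close>.\<close>

definition lifting :: "'v set \<Rightarrow> 'a set \<Rightarrow> 'a set \<Rightarrow> bool" where
  "lifting S B D \<longleftrightarrow>
     D \<subseteq> darts G S \<and> (\<forall>p\<in>D. \<phi>0 p \<in> darts G' (T S)) \<and> (\<forall>p\<in>darts G S - D. \<phi>0 p \<in> \<phi>0 ` B) \<and>
     (\<forall>w\<in>S. emb_verts (\<phi>1 w) \<noteq> {} \<longrightarrow> nb G w \<subseteq> D) \<and>
     (T S \<noteq> {} \<longrightarrow> (\<forall>p\<in>darts G S. dagger G p \<in> B \<longrightarrow> p \<in> D) \<and>
       (\<forall>p q. opposite S B p q \<longrightarrow>
          (p \<in> D \<or> q \<in> D) \<and> (p \<in> D \<longrightarrow> q \<in> D \<longrightarrow> \<phi>0 p \<notin> \<phi>0 ` B \<and> \<phi>0 q \<notin> \<phi>0 ` B)))"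

lemma opposite_darts: "opposite S B p q \<Longrightarrow> p \<in> darts G S \<and> q \<in> darts G S"
  unfolding opposite_def
proof (elim disjE bexE conjE, goal_cases)
  case (2 w)
  then have "p \<in> nb G w" "q \<in> nb G w" by simp_all
  then show ?case using 2(1) by (simp add: nb_def darts_def)
qed simp

lemma opposite_arcs: "opposite S B p q \<Longrightarrow> p \<in> arcs G \<and> q \<in> arcs G"
  using opposite_darts darts_arcs[OF gG] by blast

lemma opposite_\<phi>0:
  assumes "S \<subseteq> verts G" "opposite S B p q" shows "\<phi>0 q = dagger G' (\<phi>0 p)"
  using assms(2) unfolding opposite_def
proof
  assume "p \<in> darts G S \<and> q \<in> darts G S \<and> q = dagger G p \<and> q \<notin> B"
  then show ?thesis using \<phi>0_dagger darts_arcs[OF gG] by blast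
next
  assume "\<exists>w\<in>S. emb_verts (\<phi>1 w) = {} \<and> nb G w = {p, q} \<and> p \<noteq> q"
  then obtain w where w: "w \<in> verts G" "emb_verts (\<phi>1 w) = {}" "nb G w = {p, q}" "p \<noteq> q"
    using assms(1) by auto
  then show ?thesis using edge_nb[of w p] by (metis doubleton_eq_iff insertI1)
qed

text \<open>When \<open>v\<close> goes to an edge, the image has no vertices and nothing can be
  attached; otherwise every dart at \<open>v\<close> is lifted to an attached arc.\<close>

lemma lifting_star:
  assumes v: "v \<in> verts G"
  shows "\<exists>D. lifting {v} (dagger G ` nb G v) D"
proof (cases "emb_verts (\<phi>1 v) = {}")
  case True
  have "\<phi>0 p \<in> \<phi>0 ` dagger G ` nb G v" if p: "p \<in> nb G v" for p
  proof -
    obtain q where q: "nb G v = {p, q}" "\<phi>0 q = dagger G' (\<phi>0 p)" using edge_nb[OF v True p] by metis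
    then have "\<phi>0 p = \<phi>0 (dagger G q)"
      using p \<phi>0_dagger[of q] \<phi>0_arcs[of p] by (simp add: nb_arcs[of G _ v])
    then show ?thesis using q by auto
  qed
  then have "lifting {v} (dagger G ` nb G v) {}" using True by (auto simp: lifting_def darts_singleton)
  then show ?thesis ..
next
  case False
  have "\<not> opposite {v} (dagger G ` nb G v) p q" for p q
    using False by (auto simp: opposite_def darts_singleton)
  then have "lifting {v} (dagger G ` nb G v) (nb G v)"
    using nonedge_nb[OF v False] by (auto simp: lifting_def darts_singleton)
  then show ?thesis ..
qed

text \<open>Closing \<open>x\<close> makes the edge of \<open>\<phi>0 x\<close> internal in the
  image, so its arcs lose their boundary preimages. Every dart over this edge must now count as
  attached.\<close>

lemma lifting_close:
  assumes adm: "admissible G S B" and ne: "S \<noteq> {}" and x: "x \<in> B" "dagger G x \<in> B"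
    and D: "lifting S B D"
  shows "\<exists>D. lifting S (B - {x, dagger G x}) D"
proof -
  have xA: "x \<in> arcs G" using x admissible_arcs[OF gG adm] by auto
  note im = image_close(2,3)[OF adm ne admissible_good[OF adm] x]
  let ?a = "\<phi>0 x" and ?B = "B - {x, dagger G x}"
  let ?D = "D \<union> {p \<in> darts G S. \<phi>0 p = ?a \<or> \<phi>0 p = dagger G' ?a}"
  have aA: "?a \<in> arcs G'" by (rule \<phi>0_arcs[OF xA])
  have xS: "x \<in> darts G S" "dagger G x \<in> darts G S"
    using admissible_darts_bdry[OF gG adm x ne] admissibleD(1)[OF adm ne x(1)] by auto
  have aB: "?a \<in> \<phi>0 ` B" "dagger G' ?a \<in> \<phi>0 ` B" using x \<phi>0_dagger[OF xA] by (auto simp: image_iff) metis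
  have aT: "?a \<in> darts G' (T S)" "dagger G' ?a \<in> darts G' (T S)"
    using admissibleD(1)[OF image_admissible[OF adm] im(2) aB(1)]
      admissibleD(1)[OF image_admissible[OF adm] im(2) aB(2)] aA by simp_all
  \<comment> \<open>The edge of \<open>x\<close> is the only new source of opposite darts.\<close>
  have opp: "opposite S B p q \<or> p = x \<and> q = dagger G x \<or> p = dagger G x \<and> q = x"
    if "opposite S ?B p q" for p q
  proof (cases "opposite S B p q")
    case False
    then have "q = dagger G p" "q = x \<or> q = dagger G x" using that unfolding opposite_def by blast+
    moreover from this have "p = dagger G q"
      using opposite_darts[OF that] darts_arcs[OF gG] by (metis dagger_dagger gG)
    ultimately show ?thesis using xA by auto
  qed simp
  have D1: "D \<subseteq> darts G S" "\<forall>p\<in>D. \<phi>0 p \<in> darts G' (T S)" "\<forall>p\<in>darts G S - D. \<phi>0 p \<in> \<phi>0 ` B"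
    "\<forall>w\<in>S. emb_verts (\<phi>1 w) \<noteq> {} \<longrightarrow> nb G w \<subseteq> D" "\<forall>p\<in>darts G S. dagger G p \<in> B \<longrightarrow> p \<in> D"
    using D im(2) unfolding lifting_def by simp_all
  have D2: "p \<in> D \<or> q \<in> D" "p \<in> D \<Longrightarrow> q \<in> D \<Longrightarrow> \<phi>0 p \<notin> \<phi>0 ` B \<and> \<phi>0 q \<notin> \<phi>0 ` B"
    if "opposite S B p q" for p q
    using D im(2) that unfolding lifting_def by blast+
  have "lifting S ?B ?D"
    unfolding lifting_def
  proof (intro conjI impI allI)
    show "?D \<subseteq> darts G S" "\<forall>p\<in>?D. \<phi>0 p \<in> darts G' (T S)" using D1 aT by auto
    show "\<forall>p\<in>darts G S - ?D. \<phi>0 p \<in> \<phi>0 ` ?B" unfolding im(1) using D1(3) by blast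
    show "\<forall>w\<in>S. emb_verts (\<phi>1 w) \<noteq> {} \<longrightarrow> nb G w \<subseteq> ?D" using D1(4) by blast
    show "\<forall>p\<in>darts G S. dagger G p \<in> ?B \<longrightarrow> p \<in> ?D" using D1(5) by blast
    fix p q assume pq: "opposite S ?B p q"
    show "p \<in> ?D \<or> q \<in> ?D" using opp[OF pq] D2(1)[of p q] xS by auto
    have "\<phi>0 q = dagger G' (\<phi>0 p)" by (rule opposite_\<phi>0[OF admissible_subset[OF adm] pq])
    moreover have "p \<in> arcs G" using opposite_arcs[OF pq] by simp
    ultimately have eq: "\<phi>0 p = ?a \<or> \<phi>0 p = dagger G' ?a \<longleftrightarrow> \<phi>0 q = ?a \<or> \<phi>0 q = dagger G' ?a"
      using aA \<phi>0_arcs[of p] by (metis dagger_dagger gG')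
    assume "p \<in> ?D" "q \<in> ?D"
    then have "\<phi>0 p = ?a \<or> \<phi>0 p = dagger G' ?a \<or> p \<in> D \<and> q \<in> D" using eq by blast
    moreover have "\<phi>0 p = ?a \<or> \<phi>0 p = dagger G' ?a" if "p = x \<or> p = dagger G x"
      using that \<phi>0_dagger[OF xA] by auto
    ultimately have "(\<phi>0 p = ?a \<or> \<phi>0 p = dagger G' ?a) \<or> \<phi>0 p \<notin> \<phi>0 ` B \<and> \<phi>0 q \<notin> \<phi>0 ` B"
      using opp[OF pq] D2(2)[of p q] by blast
    then show "\<phi>0 p \<notin> \<phi>0 ` ?B" "\<phi>0 q \<notin> \<phi>0 ` ?B" unfolding im(1) using eq by auto
  qed
  then show ?thesis ..
qed

text \<open>The answer depends on whether \<open>\<phi>1 w\<close> is an edge and on whether the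
  image of \<open>(S, B)\<close> is one, because only an image with vertices has attached arcs. In
  each case \<open>D\<close> is chosen according to which arcs of the glued image are attached and
  which belong to its boundary.\<close>

lemma lifting_glue:
  assumes adm: "admissible G S B" and ne: "S \<noteq> {}" and w: "w \<in> verts G" "w \<notin> S"
    and x: "x \<in> nb G w" "x \<in> B" and D: "lifting S B D"
  shows "\<exists>D. lifting (S \<union> {w}) ((B - {x}) \<union> (dagger G ` nb G w - {dagger G x})) D"
proof -
  let ?B = "(B - {x}) \<union> (dagger G ` nb G w - {dagger G x})" and ?a = "\<phi>0 x"
  have xA: "x \<in> arcs G" using x by (simp add: nb_arcs)
  have S: "S \<subseteq> verts G" by (rule admissible_subset[OF adm])
  have aA: "?a \<in> arcs G'" "dagger G' (dagger G' ?a) = ?a" "dagger G' ?a \<noteq> ?a" "?a \<noteq> dagger G' ?a"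
    using \<phi>0_arcs[OF xA] dagger_neq[OF gG' \<phi>0_arcs[OF xA]] by (simp_all add: eq_commute[of "\<phi>0 x"])
  note im = image_glue(2)[OF adm admissible_good[OF adm] w x]
  have dS: "darts G (S \<union> {w}) = darts G S \<union> nb G w" "darts G S \<inter> nb G w = {}"
    using w(2) by (auto simp: darts_Un darts_singleton darts_def nb_def)
  have TS: "T (S \<union> {w}) = T S \<union> emb_verts (\<phi>1 w)" by auto
  have dT: "darts G' (T S \<union> emb_verts (\<phi>1 w)) = darts G' (T S) \<union> darts G' (emb_verts (\<phi>1 w))"
    "darts G' (T S) \<inter> darts G' (emb_verts (\<phi>1 w)) = {}"
    using darts_disjoint[OF T_disjoint[OF S w], of G'] by (simp_all add: darts_Un)
  have dx: "dagger G x \<in> darts G S" "x \<notin> darts G S" "dagger G x \<notin> nb G w"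
    using admissibleD(1)[OF adm ne x(2)] x(1) dS(2) by auto
  have dd: "dagger G (dagger G p) = p" if "p \<in> darts G S \<or> p \<in> nb G w" for p
    using that by (auto simp: darts_arcs[OF gG] nb_arcs[OF gG])
  have opp: "opposite S B p q \<or> p = x \<and> q = dagger G x \<or> p = dagger G x \<and> q = x \<or>
      emb_verts (\<phi>1 w) = {} \<and> nb G w = {p, q} \<and> p \<noteq> q"
    if pq: "opposite (S \<union> {w}) ?B p q" for p q
  proof -
    consider "\<exists>u\<in>S \<union> {w}. emb_verts (\<phi>1 u) = {} \<and> nb G u = {p, q} \<and> p \<noteq> q"
      | "p \<in> darts G S \<union> nb G w" "q \<in> darts G S \<union> nb G w" "q = dagger G p" "q \<notin> ?B"
      using pq unfolding opposite_def dS(1) by blast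
    then show ?thesis
    proof cases
      case 1
      then show ?thesis unfolding opposite_def by blast
    next
      case 2
      have pq: "p = dagger G q" using 2 dd[of p] by auto
      show ?thesis
      proof (cases "p \<in> nb G w")
        case True
        then have "q = dagger G x" using 2 by blast
        then show ?thesis using pq xA by simp
      next
        case False
        then have p: "p \<in> darts G S" using 2 by blast
        show ?thesis
        proof (cases "q \<in> darts G S")
          case True
          then have "q \<notin> B" using 2(4) dx(2) by blast
          then show ?thesis using p True 2(3) unfolding opposite_def by blast
        next
          case False
          then have "q \<in> B" using admissibleD(2)[OF adm ne p] 2(3) by simp
          then have "q = x" using 2(4) by blast
          then show ?thesis using pq by blast
        qed
      qed
    qed
  qed
  have bd: "p \<in> darts G S \<and> dagger G p \<in> B \<and> dagger G p \<noteq> x \<or> p \<in> nb G w \<and> p \<noteq> x"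
    if "p \<in> darts G S \<union> nb G w" "dagger G p \<in> ?B" for p
  proof (cases "p \<in> nb G w")
    case True
    have "dagger G x \<notin> B" using admissibleD(1)[OF adm ne, of "dagger G x"] dx(2) xA by auto
    then show ?thesis using True that(2) by auto
  next
    case False
    then have p: "p \<in> darts G S" using that by blast
    have "dagger G p \<notin> dagger G ` nb G w"
    proof
      assume "dagger G p \<in> dagger G ` nb G w"
      then obtain d where "d \<in> nb G w" "dagger G p = dagger G d" by auto
      then show False using dd[of p] dd[of d] p False by metis
    qed
    then show ?thesis using that(2) p by auto
  qed
  have D1: "D \<subseteq> darts G S" "\<forall>p\<in>D. \<phi>0 p \<in> darts G' (T S)" "\<forall>p\<in>darts G S - D. \<phi>0 p \<in> \<phi>0 ` B"
    "\<forall>w\<in>S. emb_verts (\<phi>1 w) \<noteq> {} \<longrightarrow> nb G w \<subseteq> D"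
    using D unfolding lifting_def by simp_all
  have D3: "p \<in> D" if "T S \<noteq> {}" "p \<in> darts G S" "dagger G p \<in> B" for p
    using D that unfolding lifting_def by blast
  have D2: "p \<in> D \<or> q \<in> D" "p \<in> D \<Longrightarrow> q \<in> D \<Longrightarrow> \<phi>0 p \<notin> \<phi>0 ` B \<and> \<phi>0 q \<notin> \<phi>0 ` B"
    if "opposite S B p q" "T S \<noteq> {}" for p q
    using D that unfolding lifting_def by blast+
  have aB: "?a \<in> \<phi>0 ` B" "dagger G' ?a \<in> emb_bdry (\<phi>1 w)"
    using x \<phi>0_dagger[OF xA] \<phi>1_bdry[OF w(1)] by (auto simp: image_iff) metis
  have bT: "dagger G' b \<in> darts G' (T S)" if "T S \<noteq> {}" "b \<in> \<phi>0 ` B" for b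
    using admissibleD(1)[OF image_admissible[OF adm]] that by blast
  have bw: "dagger G' b \<in> darts G' (emb_verts (\<phi>1 w))"
    if "emb_verts (\<phi>1 w) \<noteq> {}" "b \<in> emb_bdry (\<phi>1 w)" for b
    using admissibleD(1)[OF Emb_admissible[OF \<phi>1_Emb[OF w(1)]]] that by blast
  have \<phi>0_opp: "\<phi>0 q = dagger G' (\<phi>0 p)" "\<phi>0 p = dagger G' (\<phi>0 q)" if "opposite S B p q" for p q
    using opposite_\<phi>0[OF S that] opposite_arcs[OF that] by (simp_all add: \<phi>0_arcs)
  show ?thesis
  proof (cases "emb_verts (\<phi>1 w) = {}")
    case False
    \<comment> \<open>Gluing identifies the boundary arc \<open>?a\<close> of the old image with a
      dart at \<open>\<phi>1 w\<close>. So the darts at \<open>S\<close> over \<open>?a\<close>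
      become attached, together with all darts at \<open>w\<close>.\<close>
    let ?D = "D \<union> {p \<in> darts G S. \<phi>0 p = ?a} \<union> nb G w"
    have aw: "?a \<in> darts G' (emb_verts (\<phi>1 w))" by (rule nonedge_nb[OF w(1) False x(1)])
    have "lifting (S \<union> {w}) ?B ?D"
    proof (cases "T S = {}")
      case True
      \<comment> \<open>All of \<open>S\<close> had collapsed to the edge of \<open>?a\<close>, so
        the new image is \<open>\<phi>1 w\<close> alone: the darts at \<open>S\<close> over
        \<open>?a\<close> are attached there, and those over \<open>dagger G' ?a\<close> lie on its
        boundary.\<close>
      have D0: "D = {}" using D1(2) True by auto
      have "\<phi>0 ` B = {?a, dagger G' ?a}"
        using admissible_edge_eq[OF gG', of "\<phi>0 ` B" ?a] image_admissible[OF adm] True aB(1) by simp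
      then have im': "\<phi>0 ` ?B = emb_bdry (\<phi>1 w)" unfolding im using aB(2) aA by auto
      have aS: "\<phi>0 p = ?a \<or> \<phi>0 p = dagger G' ?a" if "p \<in> darts G S" for p
        using D1(3) D0 that \<open>\<phi>0 ` B = _\<close> by auto
      show ?thesis
        unfolding lifting_def dS(1) TS im'
      proof (intro conjI impI allI)
        show "?D \<subseteq> darts G S \<union> nb G w" using D1(1) by blast
        show "\<forall>p\<in>?D. \<phi>0 p \<in> darts G' (T S \<union> emb_verts (\<phi>1 w))"
          using D0 aw nonedge_nb[OF w(1) False] unfolding dT(1) by auto
        show "\<forall>p\<in>darts G S \<union> nb G w - ?D. \<phi>0 p \<in> emb_bdry (\<phi>1 w)"
        proof
          fix p assume "p \<in> darts G S \<union> nb G w - ?D"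
          then have "\<phi>0 p = dagger G' ?a" using aS[of p] by blast
          then show "\<phi>0 p \<in> emb_bdry (\<phi>1 w)" using aB(2) by simp
        qed
        show "\<forall>u\<in>S \<union> {w}. emb_verts (\<phi>1 u) \<noteq> {} \<longrightarrow> nb G u \<subseteq> ?D" using True by auto
        show "\<forall>p\<in>darts G S \<union> nb G w. dagger G p \<in> ?B \<longrightarrow> p \<in> ?D"
        proof (intro ballI impI)
          fix p assume p: "p \<in> darts G S \<union> nb G w" "dagger G p \<in> ?B"
          show "p \<in> ?D"
          proof (rule ccontr)
            assume n: "p \<notin> ?D"
            then have p': "p \<in> darts G S" "dagger G p \<in> B" "dagger G p \<noteq> x" "\<phi>0 p = dagger G' ?a"
              using bd[OF p] aS by auto
            then have "\<phi>0 (dagger G p) = ?a"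
              using \<phi>0_dagger[of p] aA by (simp add: darts_arcs[OF gG])
            then show False using inj_onD[OF image_inj[OF adm]] p' x(2) by blast
          qed
        qed
        fix p q assume "opposite (S \<union> {w}) ?B p q"
        then consider "opposite S B p q" | "p = x" "q = dagger G x" | "p = dagger G x" "q = x"
          using opp False by blast
        note pq = this
        show "p \<in> ?D \<or> q \<in> ?D"
          using pq
        proof cases
          case 1
          then show ?thesis using aS[of p] \<phi>0_opp(1)[OF 1] aA(2) opposite_darts[OF 1] by auto
        qed (use x in auto)
        have "\<not> (p \<in> ?D \<and> q \<in> ?D)"
          using pq
        proof cases
          case 1
          then show ?thesis using \<phi>0_opp(1)[OF 1] D0 dS(2) opposite_darts[OF 1] aA by auto
        qed (use dx D0 \<phi>0_dagger[OF xA] aA in auto)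
        moreover assume "p \<in> ?D" "q \<in> ?D"
        ultimately show "\<phi>0 p \<notin> emb_bdry (\<phi>1 w)" "\<phi>0 q \<notin> emb_bdry (\<phi>1 w)" by auto
      qed
    next
      case T0: False
      have aT: "dagger G' ?a \<in> darts G' (T S)" by (rule bT[OF T0 aB(1)])
      \<comment> \<open>The glued edge joins vertices of both pieces and is internal, so neither of
        its arcs is on the new boundary.\<close>
      have F: "?a \<notin> \<phi>0 ` ?B" "dagger G' ?a \<notin> \<phi>0 ` ?B"
        unfolding im using bT[OF T0] bw[OF False] aT aw dT(2) aA(2) by fastforce+
      have F2: "y \<notin> \<phi>0 ` ?B" if "dagger G' y \<in> darts G' (T S)" "y \<notin> \<phi>0 ` B" for y
        unfolding im using bw[OF False] that dT(2) by blast
      show ?thesis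
        unfolding lifting_def dS(1) TS
      proof (intro conjI impI allI)
        show "?D \<subseteq> darts G S \<union> nb G w" using D1(1) by blast
        show "\<forall>p\<in>?D. \<phi>0 p \<in> darts G' (T S \<union> emb_verts (\<phi>1 w))"
          using D1(2) aw nonedge_nb[OF w(1) False] unfolding dT(1) by auto
        show "\<forall>p\<in>darts G S \<union> nb G w - ?D. \<phi>0 p \<in> \<phi>0 ` ?B" unfolding im using D1(3) by blast
        show "\<forall>u\<in>S \<union> {w}. emb_verts (\<phi>1 u) \<noteq> {} \<longrightarrow> nb G u \<subseteq> ?D" using D1(4) by auto
        show "\<forall>p\<in>darts G S \<union> nb G w. dagger G p \<in> ?B \<longrightarrow> p \<in> ?D" using bd D3[OF T0] by blast
        fix p q assume "opposite (S \<union> {w}) ?B p q"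
        then consider "opposite S B p q" | "p = x" "q = dagger G x" | "p = dagger G x" "q = x"
          using opp False by blast
        note pq = this
        show "p \<in> ?D \<or> q \<in> ?D"
          using pq D2(1)[OF _ T0] x(1) by cases auto
        assume in_D: "p \<in> ?D" "q \<in> ?D"
        have "\<phi>0 p \<notin> \<phi>0 ` ?B \<and> \<phi>0 q \<notin> \<phi>0 ` ?B"
          using pq
        proof cases
          case 1
          consider "p \<in> D" "q \<in> D" | "\<phi>0 p = ?a" | "\<phi>0 q = ?a"
            using in_D dS(2) opposite_darts[OF 1] by blast
          then show ?thesis
          proof cases
            case i: 1
            then show ?thesis using D2(2)[OF 1 T0 i] F2 D1(2) \<phi>0_opp[OF 1] by metis
          next
            case 2
            then show ?thesis using F \<phi>0_opp(1)[OF 1] by simp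
          next
            case 3
            then show ?thesis using F \<phi>0_opp(2)[OF 1] by simp
          qed
        qed (use F \<phi>0_dagger[OF xA] in auto)
        then show "\<phi>0 p \<notin> \<phi>0 ` ?B" "\<phi>0 q \<notin> \<phi>0 ` ?B" by auto
      qed
    qed
    then show ?thesis ..
  next
    case Tw: True
    obtain y where y: "nb G w = {x, y}" "x \<noteq> y" "\<phi>0 y = dagger G' ?a"
      using edge_nb[OF w(1) Tw x(1)] by metis
    have "emb_bdry (\<phi>1 w) = {?a, dagger G' ?a}"
      using admissible_edge_eq[OF gG', of "emb_bdry (\<phi>1 w)" "dagger G' ?a"]
        Emb_admissible[OF \<phi>1_Emb[OF w(1)]] Tw aB(2) aA by auto
    then have im': "\<phi>0 ` ?B = \<phi>0 ` B" unfolding im using aB(1) aA by auto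
    show ?thesis
    proof (cases "T S = {}")
      case True
      have D0: "D = {}" using D1(2) True by auto
      have "\<phi>0 ` B = {?a, dagger G' ?a}"
        using admissible_edge_eq[OF gG', of "\<phi>0 ` B" ?a] image_admissible[OF adm] True aB(1) by simp
      then have "lifting (S \<union> {w}) ?B {}"
        unfolding lifting_def dS(1) TS im' using D1(3) D0 y True Tw by auto
      then show ?thesis ..
    next
      case T0: False
      have yD: "y \<notin> darts G S" using y(1) dS(2) by auto
      have xD: "dagger G x \<in> D" "x \<notin> D" "x \<notin> insert y D" using D3[OF T0 dx(1)] x(2) xA D1(1) dx(2) y(2) by auto
      \<comment> \<open>The image is unchanged and \<open>?a\<close> is still on its boundary; the
        arc opposite to \<open>y\<close> takes over the role of \<open>x\<close> as the boundary arc
        over \<open>?a\<close>. Hence \<open>y\<close> is attached like \<open>dagger G x\<close>,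
        and \<open>x\<close> is lifted to the boundary.\<close>
      have "lifting (S \<union> {w}) ?B (insert y D)"
        unfolding lifting_def dS(1) TS im'
      proof (intro conjI impI allI)
        show "insert y D \<subseteq> darts G S \<union> nb G w" using D1(1) y(1) by blast
        show "\<forall>p\<in>insert y D. \<phi>0 p \<in> darts G' (T S \<union> emb_verts (\<phi>1 w))"
          using D1(2) y(3) bT[OF T0 aB(1)] Tw by simp
        show "\<forall>p\<in>darts G S \<union> nb G w - insert y D. \<phi>0 p \<in> \<phi>0 ` B"
          using D1(3) y(1) x(2) by auto
        show "\<forall>u\<in>S \<union> {w}. emb_verts (\<phi>1 u) \<noteq> {} \<longrightarrow> nb G u \<subseteq> insert y D" using D1(4) Tw by blast
        show "\<forall>p\<in>darts G S \<union> nb G w. dagger G p \<in> ?B \<longrightarrow> p \<in> insert y D"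
          using bd D3[OF T0] y(1) by blast
        fix p q assume "opposite (S \<union> {w}) ?B p q"
        then consider "opposite S B p q" | "p = x" "q = dagger G x" | "p = dagger G x" "q = x"
          | "nb G w = {p, q}" "p \<noteq> q"
          using opp by blast
        note pq = this
        show "p \<in> insert y D \<or> q \<in> insert y D"
          using pq D2(1)[OF _ T0] xD(1) y by cases (auto simp: doubleton_eq_iff)
        assume in_D: "p \<in> insert y D" "q \<in> insert y D"
        then have "opposite S B p q"
          using pq xD(2,3) y by cases (auto simp: doubleton_eq_iff)
        moreover from this have "p \<in> D" "q \<in> D" using in_D yD opposite_darts by blast+
        ultimately show "\<phi>0 p \<notin> \<phi>0 ` B" "\<phi>0 q \<notin> \<phi>0 ` B" using D2(2)[OF _ T0] by blast+
      qed
      then show ?thesis ..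
    qed
  qed
qed

lemma lifting_exists:
  assumes "admissible G S B" shows "\<exists>D. lifting S B D"
proof (cases "S = {}")
  case True
  then have "lifting S B {}" by (simp add: lifting_def)
  then show ?thesis ..
next
  case False
  show ?thesis
    using gG assms False
  proof (induction rule: grow_induct)
    case (star v)
    then show ?case using lifting_star admissible_subset[OF assms] by blast
  next
    case (glue S B w x)
    then show ?case using lifting_glue by blast
  next
    case (close S B x)
    then show ?case using lifting_close by blast
  qed
qed

end

section \<open>The active--inert factorization\<close>

text \<open>Opposite images do not imply opposite arcs, since an arc of \<open>G\<close> can have an
  attached and a boundary preimage. The listed cases leave out two boundary arcs in a graph with
  vertices, and two attached arcs on a cut edge; otherwise injectivity on attached arcs or, without
  vertices, on boundary arcs pins down the opposite arc.\<close>

lemma embedding_dagger_eqI: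
  assumes g: "embedding K G g" and st: "s \<in> arcs K" "t \<in> arcs K" and eq: "on_arcs g t = dagger G (on_arcs g s)"
    and cases: "verts K = {} \<or> s \<in> attached K \<and> t \<notin> attached K \<or> s \<notin> attached K \<and> t \<in> attached K \<or>
      s \<in> attached K \<and> t \<in> attached K \<and> on_arcs g t \<notin> on_arcs g ` bdry K"
  shows "t = dagger K s"
proof -
  have K: "is_graph K" and G: "is_graph G" and con: "connected_graph K" and et: "etale K G g"
    using g by (auto simp: embedding_def)
  have inj: "y = dagger K x"
    if "x \<in> arcs K" "y \<in> attached K" "dagger K x \<in> attached K" "on_arcs g y = dagger G (on_arcs g x)" for x y
    using that inj_onD[OF embedding_inj_attached[OF g], of y "dagger K x"] etale_dagger[OF et] by simp
  have half: "y = dagger K x"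
    if "verts K \<noteq> {}" "x \<in> arcs K" "x \<notin> attached K" "y \<in> attached K" "on_arcs g y = dagger G (on_arcs g x)" for x y
    using inj[OF that(2,4) _ that(5)] connected_arc_attached[OF con that(1,2)] that(3) by blast
  have eq': "on_arcs g s = dagger G (on_arcs g t)" using eq etale_arcs[OF et st(1)] G by simp
  show ?thesis
  proof (cases "verts K = {}")
    case True
    then have "arcs K = bdry K" using tgt_verts[OF K] by (auto simp: bdry_def)
    then have "inj_on (on_arcs g) (arcs K)" using embedding_inj_bdry[OF g] by simp
    then show ?thesis using inj_onD[of "on_arcs g" "arcs K" t "dagger K s"] st eq etale_dagger[OF et] K by simp
  next
    case False
    consider "s \<in> attached K" "t \<notin> attached K" | "s \<notin> attached K" "t \<in> attached K"
      | "s \<in> attached K" "t \<in> attached K" "on_arcs g t \<notin> on_arcs g ` bdry K"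
      using cases False by blast
    then show ?thesis
    proof cases
      case 1
      then have "s = dagger K t" using half[OF False st(2) _ _ eq'] by blast
      then show ?thesis using st K by simp
    next
      case 2
      then show ?thesis using half[OF False st(1) _ _ eq] by blast
    next
      case 3
      have "dagger K s \<notin> bdry K" using embedding_bdry_dagger[OF g False 3(1)] 3(3) eq by simp
      then have "dagger K s \<in> attached K" using st K by (simp add: bdry_def)
      then show ?thesis using inj[OF st(1) 3(2) _ eq] by blast
    qed
  qed
qed

text \<open>Composites are definite descriptions; by \<open>Emb_eqI\<close> any class with the
  prescribed boundary and vertices is the described one.\<close>

lemma gmap_comp_eq:
  assumes "v \<in> verts G" "c \<in> Emb G''" "emb_bdry c = fst \<psi> ` emb_bdry (snd \<phi> v)"
    "emb_verts c = (\<Union>w\<in>emb_verts (snd \<phi> v). emb_verts (snd \<psi> w))"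
  shows "snd (gmap_comp G G'' \<psi> \<phi>) v = c"
  unfolding gmap_comp_def snd_conv restrict_apply'[OF assms(1)]
proof (rule the_equality)
  fix d assume d: "d \<in> Emb G'' \<and> emb_bdry d = fst \<psi> ` emb_bdry (snd \<phi> v) \<and>
    emb_verts d = (\<Union>w\<in>emb_verts (snd \<phi> v). emb_verts (snd \<psi> w))"
  show "d = c" by (rule Emb_eqI[of _ G'']) (use d assms in simp_all)
qed (use assms in simp)

lemma emb_class_comp:
  assumes c: "c \<in> Emb K" and g: "embedding K G g"
  shows "\<exists>d\<in>Emb G. emb_bdry d = on_arcs g ` emb_bdry c \<and> emb_verts d = on_verts g ` emb_verts c"
proof -
  obtain J h where h: "embedding J K h" "emb_verts c = on_verts h ` verts J" "emb_bdry c = on_arcs h ` bdry J"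
    using Emb_cases[OF c] by metis
  note gh = embedding_comp[OF h(1) g]
  have "on_verts (comp_fun J g h) ` verts J = on_verts g ` on_verts h ` verts J"
    "on_arcs (comp_fun J g h) ` bdry J = on_arcs g ` on_arcs h ` bdry J"
    by (auto simp: image_image bdry_def)
  then show ?thesis using h emb_verts_class[OF gh] emb_bdry_class[OF gh] emb_class_Emb[OF gh] by metis
qed

section \<open>Construction of the active part over a given image\<close>

context graphical
begin

lemma liftingD:
  assumes "lifting S B D"
  shows "D \<subseteq> darts G S" "p \<in> D \<Longrightarrow> \<phi>0 p \<in> darts G' (T S)"
    "p \<in> darts G S \<Longrightarrow> p \<notin> D \<Longrightarrow> \<phi>0 p \<in> \<phi>0 ` B"
    "w \<in> S \<Longrightarrow> emb_verts (\<phi>1 w) \<noteq> {} \<Longrightarrow> nb G w \<subseteq> D"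
    "T S \<noteq> {} \<Longrightarrow> p \<in> darts G S \<Longrightarrow> dagger G p \<in> B \<Longrightarrow> p \<in> D"
    "T S \<noteq> {} \<Longrightarrow> opposite S B p q \<Longrightarrow> (p \<in> D \<or> q \<in> D) \<and>
      (p \<in> D \<longrightarrow> q \<in> D \<longrightarrow> \<phi>0 p \<notin> \<phi>0 ` B \<and> \<phi>0 q \<notin> \<phi>0 ` B)"
  using assms unfolding lifting_def by blast+

lemma comp_emb:
  assumes f: "embedding H G f" and v: "v \<in> verts H"
  shows "snd (gmap_comp H G' (\<phi>0, \<phi>1) (gmap_of_emb H G f)) v = \<phi>1 (on_verts f v)"
proof -
  have w: "on_verts f v \<in> verts G" by (rule etale_verts[OF embedding_etale[OF f] v])
  show ?thesis
    by (rule gmap_comp_eq[OF v])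
      (use v w star_class_Emb[OF G w] \<phi>1_Emb[OF w] \<phi>1_bdry[OF w] in \<open>simp_all add: gmap_of_emb_def\<close>)
qed

text \<open>The image pair prescribes the inert part, and a \<open>lifting\<close> prescribes the
  active part on arcs. Its value at \<open>v\<close> has to be a subgraph of \<open>K\<close> that
  \<open>g\<close> carries to \<open>\<phi>1 (on_verts f v)\<close>; monotonicity of the image
  provides it.\<close>

lemma factorization_exists:
  assumes f: "embedding H G f" and g: "embedding K G' g"
    and gv: "on_verts g ` verts K = T (on_verts f ` verts H)"
    and gb: "on_arcs g ` bdry K = \<phi>0 ` on_arcs f ` bdry H"
  shows "\<exists>\<alpha>\<in>active_maps H K.
    gmap_comp H G' (\<phi>0, \<phi>1) (gmap_of_emb H G f) = gmap_comp H G' (gmap_of_emb K G' g) \<alpha>"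
proof -
  let ?S = "on_verts f ` verts H" and ?B = "on_arcs f ` bdry H"
  have H: "connected_graph H" "is_graph H" and K: "connected_graph K" "is_graph K"
    and ef: "etale H G f" and eg: "etale K G' g"
    using f g by (auto simp: embedding_def)
  have adm: "admissible G ?S ?B" by (rule embedding_admissible[OF f])
  have S: "?S \<subseteq> verts G" by (rule admissible_subset[OF adm])
  obtain D where "lifting ?S ?B D" using lifting_exists[OF adm] by blast
  note D = liftingD[OF this]
  have fD: "on_arcs f p \<in> darts G ?S" if "p \<in> attached H" for p
    using that embedding_image_attached[OF f] by blast
  have fA: "on_arcs f p \<in> arcs G" if "p \<in> arcs H" for p by (rule etale_arcs[OF ef that])
  have bA: "p \<in> arcs H" if "p \<in> bdry H" for p using that by (rule bdry_arcs)
  have aA: "p \<in> arcs H" if "p \<in> attached H" for p using attached_arcs[OF H(2) that] .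
  \<comment> \<open>An arc goes to the attached preimage under \<open>g\<close> when
    \<open>D\<close> says so, and to the boundary preimage otherwise; boundary arcs of
    \<open>H\<close> always go to the boundary, as an active map must do.\<close>
  define lift where "lift p = (p \<in> attached H \<and> on_arcs f p \<in> D)" for p
  define \<alpha>0 where "\<alpha>0 = (\<lambda>p\<in>arcs H.
    if lift p then inv_into (attached K) (on_arcs g) (\<phi>0 (on_arcs f p))
    else inv_into (bdry K) (on_arcs g) (\<phi>0 (on_arcs f p)))"
  have \<alpha>1: "\<alpha>0 p \<in> attached K \<and> on_arcs g (\<alpha>0 p) = \<phi>0 (on_arcs f p)" if "p \<in> arcs H" "lift p" for p
  proof -
    have "\<phi>0 (on_arcs f p) \<in> on_arcs g ` attached K"
      unfolding embedding_image_attached[OF g] gv using that D(2) by (auto simp: lift_def)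
    then show ?thesis using that by (simp add: \<alpha>0_def inv_into_into f_inv_into_f)
  qed
  have \<alpha>2: "\<alpha>0 p \<in> bdry K \<and> on_arcs g (\<alpha>0 p) = \<phi>0 (on_arcs f p)" if "p \<in> arcs H" "\<not> lift p" for p
  proof -
    have "\<phi>0 (on_arcs f p) \<in> on_arcs g ` bdry K"
      unfolding gb using that D(3) fD[of p] by (auto simp: lift_def bdry_def)
    then show ?thesis using that by (simp add: \<alpha>0_def inv_into_into f_inv_into_f)
  qed
  have \<alpha>A: "\<alpha>0 p \<in> arcs K" and g\<alpha>: "on_arcs g (\<alpha>0 p) = \<phi>0 (on_arcs f p)" if "p \<in> arcs H" for p
    using \<alpha>1[OF that] \<alpha>2[OF that] attached_arcs[OF K(2)] bdry_arcs[of _ K] by blast+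
  have \<alpha>att: "\<alpha>0 p \<in> attached K \<longleftrightarrow> lift p" if "p \<in> arcs H" for p
    using \<alpha>1[OF that] \<alpha>2[OF that] by (auto simp: bdry_def)
  have pair: "\<alpha>0 q = dagger K (\<alpha>0 p)"
    if pq: "p \<in> arcs H" "q \<in> arcs H" "\<phi>0 (on_arcs f q) = dagger G' (\<phi>0 (on_arcs f p))"
      and c: "verts K = {} \<or> lift p \<and> \<not> lift q \<or> \<not> lift p \<and> lift q \<or>
        lift p \<and> lift q \<and> \<phi>0 (on_arcs f q) \<notin> \<phi>0 ` ?B" for p q
    by (rule embedding_dagger_eqI[OF g \<alpha>A[OF pq(1)] \<alpha>A[OF pq(2)]])
      (use pq(3) c in \<open>simp_all only: g\<alpha>[OF pq(1)] g\<alpha>[OF pq(2)] \<alpha>att[OF pq(1)] \<alpha>att[OF pq(2)] gb\<close>)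
  have opp: "\<alpha>0 q = dagger K (\<alpha>0 p)"
    if "p \<in> attached H" "q \<in> attached H" "opposite ?S ?B (on_arcs f p) (on_arcs f q)" for p q
  proof (rule pair)
    show "\<phi>0 (on_arcs f q) = dagger G' (\<phi>0 (on_arcs f p))" by (rule opposite_\<phi>0[OF S that(3)])
    show "verts K = {} \<or> lift p \<and> \<not> lift q \<or> \<not> lift p \<and> lift q \<or>
        lift p \<and> lift q \<and> \<phi>0 (on_arcs f q) \<notin> \<phi>0 ` ?B"
    proof (cases "verts K = {}")
      case False
      then have "T ?S \<noteq> {}" using gv by blast
      then show ?thesis using D(6)[OF _ that(3)] that(1,2) unfolding lift_def by blast
    qed simp
  qed (use that aA in auto)
  have \<alpha>dag: "\<alpha>0 (dagger H p) = dagger K (\<alpha>0 p)" if p: "p \<in> arcs H" for p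
  proof -
    have dp: "dagger H p \<in> arcs H" "on_arcs f (dagger H p) = dagger G (on_arcs f p)"
      using p H etale_dagger[OF ef p] by auto
    have eq: "\<phi>0 (on_arcs f (dagger H p)) = dagger G' (\<phi>0 (on_arcs f p))"
      unfolding dp(2) by (rule \<phi>0_dagger[OF fA[OF p]])
    show ?thesis
    proof (cases "verts K = {}")
      case True
      then show ?thesis using pair[OF p dp(1) eq] by blast
    next
      case False
      then have T: "T ?S \<noteq> {}" using gv by blast
      then have vH: "verts H \<noteq> {}" by auto
      \<comment> \<open>The opposite of a boundary arc is lifted to an attached arc by the clause of
        \<open>lifting\<close> on cut edges, so exactly one arc of such an edge becomes attached in
        \<open>K\<close>.\<close>
      have lift_bdry: "lift (dagger H q) \<and> \<not> lift q" if q: "q \<in> arcs H" "q \<notin> attached H" for q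
      proof -
        have a: "dagger H q \<in> attached H" using connected_arc_attached[OF H(1) vH q(1)] q(2) by blast
        have "dagger G (on_arcs f (dagger H q)) = on_arcs f q"
          using etale_dagger[OF ef q(1)] fA[OF q(1)] by simp
        moreover have "q \<in> bdry H" using q by (simp add: bdry_def)
        ultimately have "dagger G (on_arcs f (dagger H q)) \<in> ?B" by simp
        then have "on_arcs f (dagger H q) \<in> D" using D(5)[OF T fD[OF a]] by blast
        then show ?thesis using a q(2) by (simp add: lift_def)
      qed
      show ?thesis
      proof (cases "p \<in> attached H \<and> dagger H p \<in> attached H")
        case True
        have "dagger G (on_arcs f p) \<notin> ?B"
          using embedding_bdry_dagger[OF f vH, of p] True by (simp add: bdry_def)
        then have "opposite ?S ?B (on_arcs f p) (on_arcs f (dagger H p))"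
          unfolding opposite_def using True fD dp(2) by metis
        then show ?thesis using opp True by blast
      next
        case False
        then have "lift p \<and> \<not> lift (dagger H p) \<or> \<not> lift p \<and> lift (dagger H p)"
          using lift_bdry[OF p] lift_bdry[OF dp(1)] p H by auto
        then show ?thesis using pair[OF p dp(1) eq] by blast
      qed
    qed
  qed
  have inv: "involutive_fun H K \<alpha>0"
    unfolding involutive_fun_def using \<alpha>A \<alpha>dag by (auto simp: \<alpha>0_def)
  have bij: "bij_betw \<alpha>0 (bdry H) (bdry K)"
  proof -
    have nl: "\<not> lift p" if "p \<in> bdry H" for p using that by (simp add: lift_def bdry_def)
    have sub: "\<alpha>0 p \<in> bdry K" "on_arcs g (\<alpha>0 p) = \<phi>0 (on_arcs f p)" if "p \<in> bdry H" for p
      using \<alpha>2[OF bA[OF that] nl[OF that]] by auto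
    have "inj_on \<alpha>0 (bdry H)"
    proof (rule inj_onI)
      fix p q assume pq: "p \<in> bdry H" "q \<in> bdry H" "\<alpha>0 p = \<alpha>0 q"
      then have "\<phi>0 (on_arcs f p) = \<phi>0 (on_arcs f q)" using sub(2) by metis
      then have "on_arcs f p = on_arcs f q" using inj_onD[OF image_inj[OF adm]] pq by blast
      then show "p = q" using inj_onD[OF embedding_inj_bdry[OF f]] pq by blast
    qed
    moreover have "b \<in> \<alpha>0 ` bdry H" if b: "b \<in> bdry K" for b
    proof -
      obtain p where p: "p \<in> bdry H" "on_arcs g b = \<phi>0 (on_arcs f p)" using gb b by blast
      then have "b = \<alpha>0 p" using inj_onD[OF embedding_inj_bdry[OF g], of b "\<alpha>0 p"] b sub by simp
      then show ?thesis using p by blast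
    qed
    ultimately show ?thesis using sub(1) by (auto simp: bij_betw_def)
  qed
  \<comment> \<open>The value at \<open>v\<close> is the part of \<open>K\<close> over
    \<open>\<phi>1 (on_verts f v)\<close>. If this class is an edge, the two darts at
    \<open>v\<close> are opposite and their lifts form an edge of \<open>K\<close>; otherwise
    \<open>image_le\<close> and \<open>embedding_factor\<close> place the class inside
    \<open>K\<close>.\<close>
  have ex: "\<exists>c\<in>Emb K. emb_verts c = {u \<in> verts K. on_verts g u \<in> emb_verts (\<phi>1 (on_verts f v))} \<and>
      emb_bdry c = \<alpha>0 ` dagger H ` nb H v" if v: "v \<in> verts H" for v
  proof -
    let ?w = "on_verts f v"
    have w: "?w \<in> ?S" "?w \<in> verts G" using v S by auto
    have nbf: "on_arcs f ` nb H v = nb G ?w" using etale_nb[OF ef v] by (simp add: bij_betw_def)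
    have nbA: "p \<in> attached H" "p \<in> arcs H" if "p \<in> nb H v" for p
      using that aA by (auto simp: nb_def)
    show ?thesis
    proof (cases "emb_verts (\<phi>1 ?w) = {}")
      case True
      show ?thesis
      \<comment> \<open>A vertex sent to an edge has darts, since the boundary of an edge is
        nonempty.\<close>
      proof (cases "nb H v = {}")
        case True
        then have "emb_bdry (\<phi>1 ?w) = {}" using nbf \<phi>1_bdry[OF w(2)] by simp
        then show ?thesis
          using Emb_admissible[OF \<phi>1_Emb[OF w(2)]] \<open>emb_verts _ = {}\<close> by (auto simp: admissible_empty)
      next
        case False
        then obtain p where p: "p \<in> nb H v" by blast
        then obtain d where d: "nb G ?w = {on_arcs f p, d}" "on_arcs f p \<noteq> d"
          using edge_nb[OF w(2) True, of "on_arcs f p"] nbf by blast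
        then obtain q where q: "q \<in> nb H v" "d = on_arcs f q" using nbf by blast
        have "r = p \<or> r = q" if "r \<in> nb H v" for r
        proof -
          have "on_arcs f r = on_arcs f p \<or> on_arcs f r = on_arcs f q" using that nbf d q by blast
          then show ?thesis using inj_onD[OF embedding_inj_attached[OF f]] nbA that p q by blast
        qed
        then have pq: "nb H v = {p, q}" using p q by blast
        have "opposite ?S ?B (on_arcs f p) (on_arcs f q)"
          unfolding opposite_def using w(1) True d q by blast
        then have "\<alpha>0 q = dagger K (\<alpha>0 p)" using opp nbA p q by blast
        then have e: "\<alpha>0 ` dagger H ` nb H v = {\<alpha>0 p, dagger K (\<alpha>0 p)}"
          unfolding pq using \<alpha>dag nbA p q \<alpha>A K(2) by auto
        have "admissible K {} (\<alpha>0 ` dagger H ` nb H v)"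
          unfolding e admissible_empty using \<alpha>A nbA p by blast
        then show ?thesis using admissible_class[OF K(1)] True by simp
      qed
    next
      case False
      obtain J h where h: "embedding J G' h" "emb_verts (\<phi>1 ?w) = on_verts h ` verts J"
        "emb_bdry (\<phi>1 ?w) = on_arcs h ` bdry J"
        using Emb_cases[OF \<phi>1_Emb[OF w(2)]] by metis
      have "sub_le G {?w} (dagger G ` nb G ?w) ?S ?B"
        using w(1) by (auto simp: sub_le_def darts_singleton)
      then have "sub_le G' (T {?w}) (\<phi>0 ` dagger G ` nb G ?w) (T ?S) (\<phi>0 ` ?B)"
        using image_le[OF star_admissible[OF gG w(2)] adm] by blast
      then have "sub_le G' (on_verts h ` verts J) (on_arcs h ` bdry J) (on_verts g ` verts K) (on_arcs g ` bdry K)"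
        using \<phi>1_bdry[OF w(2)] by (simp add: gv gb h(2,3)[symmetric])
      then obtain j where j: "embedding J K j" "h = comp_fun J g j"
        using embedding_factor[OF h(1) g] by metis
      have J: "connected_graph J" "is_graph J" and ej: "etale J K j" and eh: "etale J G' h"
        using j h by (auto simp: embedding_def)
      have vJ: "verts J \<noteq> {}" using False h by auto
      have hj: "on_arcs h b = on_arcs g (on_arcs j b)" if "b \<in> arcs J" for b
        using that j(2) comp_fun_apply(1) by metis
      have hjv: "on_verts h u = on_verts g (on_verts j u)" if "u \<in> verts J" for u
        using that j(2) comp_fun_apply(2) by metis
      \<comment> \<open>The two arcs are compared through their opposites, which are attached in
        \<open>K\<close>, where \<open>g\<close> is injective. The dart \<open>p\<close> is lifted
        to an attached arc because its vertex is not sent to an edge.\<close>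
      have match: "on_arcs j b = \<alpha>0 (dagger H p)"
        if b: "b \<in> bdry J" and p: "p \<in> nb H v" and eq: "on_arcs h b = \<phi>0 (dagger G (on_arcs f p))" for b p
      proof -
        have bJ: "b \<in> arcs J" "dagger J b \<in> attached J" "dagger J b \<in> arcs J"
          using b connected_arc_attached[OF J(1) vJ, of b] J by (auto simp: bdry_def)
        have "on_arcs g (on_arcs j (dagger J b)) = dagger G' (on_arcs h b)"
          using hj[OF bJ(3)] etale_dagger[OF eh bJ(1)] by simp
        also have "\<dots> = \<phi>0 (on_arcs f p)"
          unfolding eq using \<phi>0_dagger[OF fA] \<phi>0_arcs[OF fA] nbA(2)[OF p] by simp
        also have "\<dots> = on_arcs g (\<alpha>0 p)" using g\<alpha>[OF nbA(2)[OF p]] by simp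
        finally have e: "on_arcs g (on_arcs j (dagger J b)) = on_arcs g (\<alpha>0 p)" .
        have "on_arcs f p \<in> D" using D(4)[OF w(1) False] nbf p by blast
        then have "\<alpha>0 p \<in> attached K" using \<alpha>1[OF nbA(2)[OF p]] nbA(1)[OF p] by (simp add: lift_def)
        then have "on_arcs j (dagger J b) = \<alpha>0 p"
          using inj_onD[OF embedding_inj_attached[OF g] e] etale_attached[OF ej bJ(2)] by blast
        then have "dagger K (on_arcs j b) = \<alpha>0 p" using etale_dagger[OF ej bJ(1)] by simp
        then show ?thesis
          using \<alpha>dag[OF nbA(2)[OF p]] etale_arcs[OF ej bJ(1)] K(2) by (metis dagger_dagger)
      qed
      have hb: "on_arcs h ` bdry J = (\<lambda>p. \<phi>0 (dagger G (on_arcs f p))) ` nb H v"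
        using h(3) \<phi>1_bdry[OF w(2)] nbf[symmetric] by (simp add: image_image)
      have "on_arcs j ` bdry J = \<alpha>0 ` dagger H ` nb H v"
      proof (intro equalityI subsetI)
        fix y assume "y \<in> on_arcs j ` bdry J"
        then obtain b where b: "b \<in> bdry J" "y = on_arcs j b" by blast
        then obtain p where "p \<in> nb H v" "on_arcs h b = \<phi>0 (dagger G (on_arcs f p))" using hb by blast
        then show "y \<in> \<alpha>0 ` dagger H ` nb H v" using match[OF b(1)] b(2) by blast
      next
        fix y assume "y \<in> \<alpha>0 ` dagger H ` nb H v"
        then obtain p where p: "p \<in> nb H v" "y = \<alpha>0 (dagger H p)" by blast
        then have "\<phi>0 (dagger G (on_arcs f p)) \<in> on_arcs h ` bdry J" using hb by blast
        then obtain b where b: "b \<in> bdry J" "on_arcs h b = \<phi>0 (dagger G (on_arcs f p))" by (metis imageE)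
        have "y = on_arcs j b" using match[OF b(1) p(1) b(2)] p(2) by simp
        then show "y \<in> on_arcs j ` bdry J" using b(1) by (rule image_eqI)
      qed
      moreover have "on_verts j ` verts J = {u \<in> verts K. on_verts g u \<in> emb_verts (\<phi>1 ?w)}"
      proof (intro equalityI subsetI)
        fix u assume "u \<in> on_verts j ` verts J"
        then show "u \<in> {u \<in> verts K. on_verts g u \<in> emb_verts (\<phi>1 ?w)}"
          using h(2) hjv etale_verts[OF ej] by auto
      next
        fix u assume "u \<in> {u \<in> verts K. on_verts g u \<in> emb_verts (\<phi>1 ?w)}"
        then obtain x where x: "u \<in> verts K" "x \<in> verts J" "on_verts g u = on_verts g (on_verts j x)"
          using h(2) hjv by auto
        then have "u = on_verts j x" using g etale_verts[OF ej x(2)] by (auto simp: embedding_def dest: inj_onD)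
        then show "u \<in> on_verts j ` verts J" using x(2) by blast
      qed
      ultimately show ?thesis
        using emb_class_Emb[OF j(1)] emb_verts_class[OF j(1)] emb_bdry_class[OF j(1)] by metis
    qed
  qed
  have "\<exists>c. \<forall>v\<in>verts H. c v \<in> Emb K \<and>
      emb_verts (c v) = {u \<in> verts K. on_verts g u \<in> emb_verts (\<phi>1 (on_verts f v))} \<and>
      emb_bdry (c v) = \<alpha>0 ` dagger H ` nb H v"
    by (rule bchoice) (intro ballI ex[unfolded Bex_def])
  then obtain c where "\<forall>v\<in>verts H. c v \<in> Emb K \<and>
      emb_verts (c v) = {u \<in> verts K. on_verts g u \<in> emb_verts (\<phi>1 (on_verts f v))} \<and>
      emb_bdry (c v) = \<alpha>0 ` dagger H ` nb H v" ..
  then have c: "v \<in> verts H \<Longrightarrow> c v \<in> Emb K"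
    "v \<in> verts H \<Longrightarrow> emb_verts (c v) = {u \<in> verts K. on_verts g u \<in> emb_verts (\<phi>1 (on_verts f v))}"
    "v \<in> verts H \<Longrightarrow> emb_bdry (c v) = \<alpha>0 ` dagger H ` nb H v" for v
    by simp_all
  let ?\<alpha> = "(\<alpha>0, restrict c (verts H))"
  have "?\<alpha> \<in> graphical_maps H K"
    unfolding graphical_maps_iff[OF H(1) K(1)]
  proof (intro conjI ballI impI inv)
    show "restrict c (verts H) \<in> verts H \<rightarrow>\<^sub>E Emb K" using c(1) by auto
  next
    fix u v assume uv: "u \<in> verts H" "v \<in> verts H" "u \<noteq> v"
    then have "on_verts f u \<noteq> on_verts f v" using f by (auto simp: embedding_def dest: inj_onD)
    then have "emb_verts (\<phi>1 (on_verts f u)) \<inter> emb_verts (\<phi>1 (on_verts f v)) = {}"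
      using \<phi>1_disjoint etale_verts[OF ef] uv by blast
    then show "emb_verts (restrict c (verts H) u) \<inter> emb_verts (restrict c (verts H) v) = {}"
      using uv c(2) by auto
  next
    fix v assume v: "v \<in> verts H"
    show "\<alpha>0 ` dagger H ` nb H v = emb_bdry (restrict c (verts H) v)" using v c(3) by simp
    show "inj_on \<alpha>0 (dagger H ` nb H v)"
    proof (intro inj_onI, elim imageE)
      fix r s p q assume e: "\<alpha>0 r = \<alpha>0 s" and rs: "r = dagger H p" "s = dagger H q"
        and pq: "p \<in> nb H v" "q \<in> nb H v"
      have A: "p \<in> arcs H" "q \<in> arcs H" using pq nb_arcs[OF H(2)] by auto
      have fnb: "on_arcs f p \<in> nb G (on_verts f v)" "on_arcs f q \<in> nb G (on_verts f v)"
        using etale_nb[OF ef v] pq by (auto simp: bij_betw_def)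
      have "\<phi>0 (on_arcs f r) = \<phi>0 (on_arcs f s)" using e g\<alpha>[of r] g\<alpha>[of s] rs A H by simp
      then have "\<phi>0 (dagger G (on_arcs f p)) = \<phi>0 (dagger G (on_arcs f q))"
        using rs A etale_dagger[OF ef] by simp
      then have "dagger G (on_arcs f p) = dagger G (on_arcs f q)"
        using inj_onD[OF \<phi>0_inj_star[OF etale_verts[OF ef v]]] fnb by blast
      then have "on_arcs f p = on_arcs f q" using fA A by (metis dagger_dagger gG)
      then have "p = q" using inj_onD[OF embedding_inj_attached[OF f]] pq by (auto simp: nb_def)
      then show "r = s" using rs by simp
    qed
  next
    \<comment> \<open>Condition (c) for the active map: with empty boundary the image has vertices,
      and these are distributed among the values at the vertices of \<open>H\<close>.\<close>
    assume b: "bdry H = {}"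
    have "verts H \<noteq> {}"
    proof
      assume "verts H = {}"
      from connected_no_verts[OF H(1) this] obtain a where "bdry H = {a, dagger H a}" .
      then show False using b by simp
    qed
    then have "T ?S \<noteq> {}" using admissible_no_bdry[of ?S] adm b by simp
    then obtain v y where vy: "v \<in> verts H" "y \<in> emb_verts (\<phi>1 (on_verts f v))" by auto
    then have "y \<in> on_verts g ` verts K" unfolding gv by blast
    then have "emb_verts (restrict c (verts H) v) \<noteq> {}" using vy c(2) by auto
    then show "\<exists>v\<in>verts H. emb_verts (restrict c (verts H) v) \<noteq> {}" using vy by blast
  qed
  then have act: "?\<alpha> \<in> active_maps H K" using bij by (simp add: active_maps_def)
  have "gmap_comp H G' (\<phi>0, \<phi>1) (gmap_of_emb H G f) = gmap_comp H G' (gmap_of_emb K G' g) ?\<alpha>"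
  proof (rule prod_eqI)
    show "fst (gmap_comp H G' (\<phi>0, \<phi>1) (gmap_of_emb H G f)) =
        fst (gmap_comp H G' (gmap_of_emb K G' g) ?\<alpha>)"
      using g\<alpha> by (auto simp: gmap_comp_def gmap_of_emb_def compose_def restrict_def)
    show "snd (gmap_comp H G' (\<phi>0, \<phi>1) (gmap_of_emb H G f)) =
        snd (gmap_comp H G' (gmap_of_emb K G' g) ?\<alpha>)"
    proof (rule extensionalityI[of _ "verts H"])
      fix v assume v: "v \<in> verts H"
      have w: "on_verts f v \<in> verts G" by (rule etale_verts[OF ef v])
      have "snd (gmap_comp H G' (gmap_of_emb K G' g) ?\<alpha>) v = \<phi>1 (on_verts f v)"
      proof (rule gmap_comp_eq[OF v \<phi>1_Emb[OF w]])
        have "on_arcs g ` \<alpha>0 ` dagger H ` nb H v = \<phi>0 ` dagger G ` on_arcs f ` nb H v"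
          unfolding image_image
          by (rule image_cong) (use g\<alpha> nb_arcs[OF H(2)] H etale_dagger[OF ef] in auto)
        also have "on_arcs f ` nb H v = nb G (on_verts f v)" using etale_nb[OF ef v] by (simp add: bij_betw_def)
        finally show "emb_bdry (\<phi>1 (on_verts f v)) = fst (gmap_of_emb K G' g) ` emb_bdry (snd ?\<alpha> v)"
          using v c(3) \<phi>1_bdry[OF w] by (simp add: gmap_of_emb_def)
        have st: "emb_verts (snd (gmap_of_emb K G' g) u) = {on_verts g u}" if "u \<in> verts K" for u
          using that star_class_Emb(2)[OF G' etale_verts[OF eg that]] by (simp add: gmap_of_emb_def)
        have "emb_verts (\<phi>1 (on_verts f v)) \<subseteq> on_verts g ` verts K" unfolding gv using v by blast
        then have "emb_verts (\<phi>1 (on_verts f v)) =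
            (\<Union>u\<in>{u \<in> verts K. on_verts g u \<in> emb_verts (\<phi>1 (on_verts f v))}. {on_verts g u})"
          by auto
        also have "\<dots> = (\<Union>u\<in>emb_verts (snd ?\<alpha> v). emb_verts (snd (gmap_of_emb K G' g) u))"
          using v c(2) st by simp
        finally show "emb_verts (\<phi>1 (on_verts f v)) =
            (\<Union>u\<in>emb_verts (snd ?\<alpha> v). emb_verts (snd (gmap_of_emb K G' g) u))" .
      qed
      then show "snd (gmap_comp H G' (\<phi>0, \<phi>1) (gmap_of_emb H G f)) v =
          snd (gmap_comp H G' (gmap_of_emb K G' g) ?\<alpha>) v" using comp_emb[OF f v] by simp
    qed (simp_all add: gmap_comp_def)
  qed
  then show ?thesis using act by blast
qed

text \<open>Otherwise connectedness of \<open>G'\<close> gives an edge from the covered vertices to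
  the rest. It is cut in the image of \<open>(verts G, bdry G)\<close>, whose boundary is
  \<open>bdry G'\<close>, although its outer end is attached. If the image is an edge, both of its
  arcs are boundary arcs of \<open>G'\<close>, which then has no vertices.\<close>

lemma active_covers:
  assumes "(\<phi>0, \<phi>1) \<in> active_maps G G'"
  shows "T (verts G) = verts G'"
proof -
  have "\<phi>0 ` bdry G = bdry G'" using assms by (auto simp: active_maps_def bij_betw_def)
  moreover have "admissible G (verts G) (bdry G)"
    using embedding_admissible[OF embedding_id[OF G]] by (simp add: bdry_def cong: image_cong_simp)
  ultimately have adm: "admissible G' (T (verts G)) (bdry G')" using image_admissible by metis
  show ?thesis
  proof (cases "T (verts G) = {}")
    case True
    then obtain a where "a \<in> arcs G'" "bdry G' = {a, dagger G' a}" using adm by (auto simp: admissible_empty)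
    then have "verts G' = {}" using connected_arc_attached[OF G', of a] by (auto simp: bdry_def)
    then show ?thesis using True by simp
  next
    case False
    show ?thesis
    proof (rule ccontr)
      assume "T (verts G) \<noteq> verts G'"
      then obtain x where x: "x \<in> darts G' (T (verts G))" "dagger G' x \<in> darts G' (verts G' - T (verts G))"
        using connected_cross[OF G', of "T (verts G)"] admissible_subset[OF adm] False by blast
      then have "dagger G' x \<in> bdry G'" using admissibleD(2)[OF adm False x(1)] by (auto simp: darts_def)
      then show False using x(2) by (simp add: bdry_def darts_def)
    qed
  qed
qed

end

text \<open>The pair of the inert part can be read off: activity of \<open>\<alpha>\<close>
  identifies the boundaries, and \<open>active_covers\<close> writes the vertices of
  \<open>K\<close> as the union of the values of \<open>\<alpha>\<close>. Hence its class depends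
  only on the class of \<open>f\<close>.\<close>

lemma factorization_unique:
  assumes gr: "graphical G G' \<phi>0 \<phi>1" and f: "embedding H G f" and g: "embedding K G' g"
    and act: "\<alpha> \<in> active_maps H K"
    and eq: "gmap_comp H G' (\<phi>0, \<phi>1) (gmap_of_emb H G f) = gmap_comp H G' (gmap_of_emb K G' g) \<alpha>"
  shows "on_verts g ` verts K = (\<Union>v\<in>on_verts f ` verts H. emb_verts (\<phi>1 v))"
    and "on_arcs g ` bdry K = \<phi>0 ` on_arcs f ` bdry H"
proof -
  interpret graphical G G' \<phi>0 \<phi>1 by (rule gr)
  obtain \<alpha>0 \<alpha>1 where \<alpha>: "\<alpha> = (\<alpha>0, \<alpha>1)" by (cases \<alpha>)
  interpret A: graphical H K \<alpha>0 \<alpha>1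
    by unfold_locales (use f g act in \<open>auto simp: embedding_def active_maps_def \<alpha>\<close>)
  have ef: "etale H G f" and eg: "etale K G' g" using f g by (auto simp: embedding_def)
  have "on_arcs g (\<alpha>0 p) = \<phi>0 (on_arcs f p)" if "p \<in> arcs H" for p
    using fun_cong[OF arg_cong[OF eq, of fst], of p] that
    by (simp add: gmap_comp_def gmap_of_emb_def compose_eq \<alpha>)
  then have "on_arcs g ` \<alpha>0 ` bdry H = \<phi>0 ` on_arcs f ` bdry H"
    unfolding image_image by (intro image_cong) (auto simp: bdry_def)
  moreover have "\<alpha>0 ` bdry H = bdry K" using act by (simp add: active_maps_def \<alpha> bij_betw_def)
  ultimately show "on_arcs g ` bdry K = \<phi>0 ` on_arcs f ` bdry H" by simp
  have "on_verts g ` emb_verts (\<alpha>1 v) = emb_verts (\<phi>1 (on_verts f v))" if v: "v \<in> verts H" for v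
  proof -
    obtain d where d: "d \<in> Emb G'" "emb_bdry d = on_arcs g ` emb_bdry (\<alpha>1 v)"
      "emb_verts d = on_verts g ` emb_verts (\<alpha>1 v)"
      using emb_class_comp[OF A.\<phi>1_Emb[OF v] g] by blast
    have st: "emb_verts (snd (gmap_of_emb K G' g) u) = {on_verts g u}" if "u \<in> emb_verts (\<alpha>1 v)" for u
    proof -
      have u: "u \<in> verts K" using that admissible_subset[OF Emb_admissible[OF A.\<phi>1_Emb[OF v]]] by blast
      then show ?thesis using star_class_Emb(2)[OF G' etale_verts[OF eg u]] by (simp add: gmap_of_emb_def)
    qed
    have "snd (gmap_comp H G' (gmap_of_emb K G' g) \<alpha>) v = d"
      by (rule gmap_comp_eq[OF v d(1)]) (use d st in \<open>auto simp: \<alpha> gmap_of_emb_def\<close>)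
    then have "d = \<phi>1 (on_verts f v)" using comp_emb[OF f v] eq by simp
    then show ?thesis using d by simp
  qed
  then have "(\<Union>v\<in>verts H. on_verts g ` emb_verts (\<alpha>1 v)) = T (on_verts f ` verts H)" by simp
  moreover have "(\<Union>v\<in>verts H. emb_verts (\<alpha>1 v)) = verts K" using A.active_covers act \<alpha> by simp
  ultimately show "on_verts g ` verts K = T (on_verts f ` verts H)" by (metis image_UN)
qed

section \<open>The assignment N in terms of pairs\<close>

context graphical
begin

text \<open>The image pair is realized by some \<open>d\<close>; existence and uniqueness of the
  factorization identify the definite description with this \<open>d\<close>.\<close>

lemma frakN_spec:
  assumes c: "c \<in> Emb G"
  shows "snd (frakN G G' (\<phi>0, \<phi>1)) c \<in> Emb G'"
    and "emb_verts (snd (frakN G G' (\<phi>0, \<phi>1)) c) = T (emb_verts c)"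
    and "emb_bdry (snd (frakN G G' (\<phi>0, \<phi>1)) c) = \<phi>0 ` emb_bdry c"
proof -
  obtain d where d: "d \<in> Emb G'" "emb_verts d = T (emb_verts c)" "emb_bdry d = \<phi>0 ` emb_bdry c"
    using admissible_class[OF G' image_admissible[OF Emb_admissible[OF c]]] by blast
  obtain H f where f: "embedding H G f" "(H, f) \<in> c" "emb_verts c = on_verts f ` verts H"
    "emb_bdry c = on_arcs f ` bdry H" using Emb_cases[OF c] by metis
  obtain K g where g: "embedding K G' g" "d = emb_class G' K g" "emb_verts d = on_verts g ` verts K"
    "emb_bdry d = on_arcs g ` bdry K" using Emb_cases[OF d(1)] by metis
  obtain \<alpha> where \<alpha>: "\<alpha> \<in> active_maps H K"
    "gmap_comp H G' (\<phi>0, \<phi>1) (gmap_of_emb H G f) = gmap_comp H G' (gmap_of_emb K G' g) \<alpha>"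
    using factorization_exists[OF f(1) g(1)] d f g by metis
  have "snd (frakN G G' (\<phi>0, \<phi>1)) c = d"
    unfolding frakN_def snd_conv restrict_apply'[OF c]
  proof (rule the_equality)
    show "\<exists>H f K g \<alpha>. (H, f) \<in> c \<and> embedding K G' g \<and> d = emb_class G' K g \<and> \<alpha> \<in> active_maps H K \<and>
        gmap_comp H G' (\<phi>0, \<phi>1) (gmap_of_emb H G f) = gmap_comp H G' (gmap_of_emb K G' g) \<alpha>"
      using f(2) g(1,2) \<alpha> by blast
    fix e
    assume "\<exists>H f K g \<alpha>. (H, f) \<in> c \<and> embedding K G' g \<and> e = emb_class G' K g \<and> \<alpha> \<in> active_maps H K \<and>
        gmap_comp H G' (\<phi>0, \<phi>1) (gmap_of_emb H G f) = gmap_comp H G' (gmap_of_emb K G' g) \<alpha>"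
    then obtain H f K g \<alpha> where e: "(H, f) \<in> c" "embedding K G' g" "e = emb_class G' K g"
      "\<alpha> \<in> active_maps H K"
      "gmap_comp H G' (\<phi>0, \<phi>1) (gmap_of_emb H G f) = gmap_comp H G' (gmap_of_emb K G' g) \<alpha>" by blast
    note f = Emb_mem[OF c e(1)]
    note u = factorization_unique[OF graphical_axioms f(1) e(2,4,5)]
    show "e = d"
      by (rule Emb_eqI)
        (use e(2,3) d f u in \<open>simp_all add: emb_class_Emb emb_verts_class emb_bdry_class\<close>)
  qed
  then show "snd (frakN G G' (\<phi>0, \<phi>1)) c \<in> Emb G'"
    "emb_verts (snd (frakN G G' (\<phi>0, \<phi>1)) c) = T (emb_verts c)"
    "emb_bdry (snd (frakN G G' (\<phi>0, \<phi>1)) c) = \<phi>0 ` emb_bdry c" using d by simp_all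
qed

lemma frakN_star:
  assumes v: "v \<in> verts G" shows "snd (frakN G G' (\<phi>0, \<phi>1)) (star_class G v) = \<phi>1 v"
proof -
  note st = star_class_Emb[OF G v]
  show ?thesis
    by (rule Emb_eqI) (use st frakN_spec[OF st(1)] \<phi>1_Emb[OF v] \<phi>1_bdry[OF v] in simp_all)
qed

text \<open>Axiom (ii) is monotonicity of the image together with the formula for its vertices,
  (iii) comes from condition (a), and (iv) from injectivity on boundaries.\<close>

lemma frakN_new_graph_map: "frakN G G' (\<phi>0, \<phi>1) \<in> new_graph_maps G G'"
proof -
  let ?h = "snd (frakN G G' (\<phi>0, \<phi>1))"
  note N = frakN_spec
  have le: "emb_le (?h c) (?h d)" if "c \<in> Emb G" "d \<in> Emb G" "emb_le c d" for c d
    using image_le[OF Emb_admissible[OF that(1)] Emb_admissible[OF that(2)]] that(3)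
    unfolding emb_le_iff[OF that(1,2)] emb_le_iff[OF N(1)[OF that(1)] N(1)[OF that(2)]]
      N(2,3)[OF that(1)] N(2,3)[OF that(2)] .
  have "(\<phi>0, ?h) \<in> new_graph_maps G G'"
    unfolding new_graph_maps_def mem_Collect_eq case_prod_conv
  proof (intro conjI ballI impI)
    show "involutive_fun G G' \<phi>0" using graphical unfolding graphical_maps_def by blast
    show "?h \<in> Emb G \<rightarrow>\<^sub>E Emb G'" using N(1) by (auto simp: PiE_iff) (simp add: frakN_def)
    show "is_edge (?h c)" if "c \<in> Emb G" "is_edge c" for c
      using that N[OF that(1)] by (simp add: is_edge_iff)
    show "is_union (?h l) (?h h) (?h k)"
      if "l \<in> Emb G" "h \<in> Emb G" "k \<in> Emb G" "is_union l h k" for l h k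
      using that le N unfolding is_union_def by auto
    show "vertex_disjoint (?h h) (?h k)" if "h \<in> Emb G" "k \<in> Emb G" "vertex_disjoint h k" for h k
    proof -
      have sub: "emb_verts h \<subseteq> verts G" "emb_verts k \<subseteq> verts G"
        using admissible_subset[OF Emb_admissible] that by auto
      have "emb_verts (\<phi>1 v) \<inter> emb_verts (\<phi>1 w) = {}" if "v \<in> emb_verts h" "w \<in> emb_verts k" for v w
        using that sub \<phi>1_disjoint[of v w] \<open>vertex_disjoint h k\<close> unfolding vertex_disjoint_def by blast
      then show ?thesis using N that unfolding vertex_disjoint_def by auto
    qed
    show "mset_set (emb_bdry (?h h)) = image_mset \<phi>0 (mset_set (emb_bdry h))" if "h \<in> Emb G" for h
      using N(3)[OF that] image_mset_mset_set[OF image_inj[OF Emb_admissible[OF that]]] by simp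
  qed
  moreover have "frakN G G' (\<phi>0, \<phi>1) = (\<phi>0, ?h)" by (simp add: frakN_def)
  ultimately show ?thesis by simp
qed

lemma frakO_frakN: "frakO G G' (frakN G G' (\<phi>0, \<phi>1)) = (\<phi>0, \<phi>1)"
proof -
  have "(\<lambda>v\<in>verts G. snd (frakN G G' (\<phi>0, \<phi>1)) (star_class G v)) = \<phi>1"
    by (rule extensionalityI[of _ "verts G"])
      (use graphical frakN_star in \<open>auto simp: graphical_maps_def PiE_iff\<close>)
  moreover have "fst (frakN G G' (\<phi>0, \<phi>1)) = \<phi>0" by (simp add: frakN_def)
  ultimately show ?thesis by (simp only: frakO_def)
qed

end

section \<open>New graph maps\<close>

locale new_graph_map =
  fixes G G' :: "('a::infinite, 'v) graph" and \<phi>0 :: "'a \<Rightarrow> 'a" and h :: "('a, 'v) emb \<Rightarrow> ('a, 'v) emb"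
  assumes G: "connected_graph G" and G': "connected_graph G'"
    and new: "(\<phi>0, h) \<in> new_graph_maps G G'"
begin

lemma involutive: "involutive_fun G G' \<phi>0"
  and h_Emb: "c \<in> Emb G \<Longrightarrow> h c \<in> Emb G'"
  and h_ext: "h \<in> extensional (Emb G)"
  and h_edge: "c \<in> Emb G \<Longrightarrow> is_edge c \<Longrightarrow> is_edge (h c)"
  and h_union: "l \<in> Emb G \<Longrightarrow> c \<in> Emb G \<Longrightarrow> d \<in> Emb G \<Longrightarrow> is_union l c d \<Longrightarrow> is_union (h l) (h c) (h d)"
  and h_disjoint: "c \<in> Emb G \<Longrightarrow> d \<in> Emb G \<Longrightarrow> vertex_disjoint c d \<Longrightarrow> vertex_disjoint (h c) (h d)"
  and h_mset: "c \<in> Emb G \<Longrightarrow> mset_set (emb_bdry (h c)) = image_mset \<phi>0 (mset_set (emb_bdry c))"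
  using new unfolding new_graph_maps_def by (auto simp: PiE_iff)

text \<open>In axiom (iv) the left side has no repetitions and the sizes of the multisets agree,
  which is possible only if \<open>\<phi>0\<close> is injective on the boundary.\<close>

lemma h_bdry:
  assumes c: "c \<in> Emb G"
  shows "emb_bdry (h c) = \<phi>0 ` emb_bdry c" "inj_on \<phi>0 (emb_bdry c)"
proof -
  have fin: "finite (emb_bdry (h c))" "finite (emb_bdry c)"
    using emb_bdry_finite[OF c] emb_bdry_finite[OF h_Emb[OF c]] by auto
  show eq: "emb_bdry (h c) = \<phi>0 ` emb_bdry c"
    using arg_cong[OF h_mset[OF c], of set_mset] fin by simp
  have "card (emb_bdry (h c)) = card (emb_bdry c)"
    using arg_cong[OF h_mset[OF c], of size] by simp
  then show "inj_on \<phi>0 (emb_bdry c)" using eq_card_imp_inj_on[OF fin(2), of \<phi>0] eq by simp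
qed

text \<open>Axiom (ii) is applied along the growth of the pair: a gluing is a union of the smaller
  subgraph and a star. The claim quantifies over classes with a given pair since \<open>h\<close>
  acts on classes while the induction runs over pairs. Edges are settled by (i).\<close>

lemma h_verts:
  assumes c: "c \<in> Emb G"
  shows "emb_verts (h c) = (\<Union>v\<in>emb_verts c. emb_verts (h (star_class G v)))"
proof (cases "emb_verts c = {}")
  case True
  then show ?thesis using h_edge[OF c] c h_Emb[OF c] by (simp add: is_edge_iff)
next
  case False
  have gG: "is_graph G" using G by simp
  have "\<forall>c\<in>Emb G. emb_verts c = S \<longrightarrow> emb_bdry c = B \<longrightarrow>
      emb_verts (h c) = (\<Union>v\<in>emb_verts c. emb_verts (h (star_class G v)))"
    if "admissible G S B" "S \<noteq> {}" for S B
    using gG that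
  proof (induction rule: grow_induct)
    case (star v)
    then have v: "v \<in> verts G" using admissible_subset[OF that(1)] by blast
    show ?case
    proof (intro ballI impI)
      fix c assume "c \<in> Emb G" "emb_verts c = {v}" "emb_bdry c = dagger G ` nb G v"
      then have "c = star_class G v"
        by (intro Emb_eqI[OF _ star_class_Emb(1)[OF G v]]) (simp_all add: star_class_Emb[OF G v])
      then show "emb_verts (h c) = (\<Union>v\<in>emb_verts c. emb_verts (h (star_class G v)))"
        by (simp add: star_class_Emb(2)[OF G v])
    qed
  next
    case (glue S B w x)
    show ?case
    proof (intro ballI impI)
      fix c assume c: "c \<in> Emb G" and cS: "emb_verts c = S \<union> {w}"
        and cB: "emb_bdry c = B - {x} \<union> (dagger G ` nb G w - {dagger G x})"
      obtain d where d: "d \<in> Emb G" "emb_verts d = S" "emb_bdry d = B"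
        using admissible_class[OF G glue.hyps(1)] by blast
      note st = star_class_Emb[OF G glue.hyps(3)]
      have dd: "dagger G (dagger G x) = x" using nb_arcs[OF gG glue.hyps(5)] gG by simp
      have adm_w: "admissible G {w} (dagger G ` nb G w)" by (rule star_admissible[OF gG glue.hyps(3)])
      have dj: "S \<inter> {w} = {}" "{w} \<inter> S = {}" using glue.hyps(4) by auto
      have "emb_le d c"
        unfolding emb_le_iff[OF d(1) c] d cS cB
        by (rule glue_le[OF gG glue.hyps(1) adm_w dj(1) glue.hyps(6)]) (use glue.hyps(5) in simp)
      moreover have "emb_le (star_class G w) c"
        unfolding emb_le_iff[OF st(1) c] st cS cB
        using glue_le[OF gG adm_w glue.hyps(1) dj(2), of "dagger G x"] glue.hyps(5,6) dd by (simp add: Un_commute)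
      ultimately have "is_union c d (star_class G w)"
        unfolding is_union_def using cS d st by simp
      then have "emb_verts (h c) = emb_verts (h d) \<union> emb_verts (h (star_class G w))"
        using h_union[OF c d(1) st(1)] by (simp add: is_union_def)
      then show "emb_verts (h c) = (\<Union>v\<in>emb_verts c. emb_verts (h (star_class G v)))"
        using glue.IH d cS by auto
    qed
  next
    case (close S B x)
    show ?case
    proof (intro ballI impI)
      fix c assume c: "c \<in> Emb G" and cS: "emb_verts c = S" and cB: "emb_bdry c = B - {x, dagger G x}"
      obtain d where d: "d \<in> Emb G" "emb_verts d = S" "emb_bdry d = B"
        using admissible_class[OF G close.hyps(1)] by blast
      have "emb_le d c" unfolding emb_le_iff[OF d(1) c] d cS cB by (rule close_le[OF close.hyps(2)])
      \<comment> \<open>Closing joins the ends of an edge but adds no vertex, so the larger subgraph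
        is a union of the smaller one with itself.\<close>
      then have "is_union c d d" unfolding is_union_def using cS d by simp
      then have "emb_verts (h c) = emb_verts (h d)"
        using h_union[OF c d(1) d(1)] by (simp add: is_union_def)
      then show "emb_verts (h c) = (\<Union>v\<in>emb_verts c. emb_verts (h (star_class G v)))"
        using close.IH d cS by auto
    qed
  qed
  then show ?thesis using Emb_admissible[OF c] False c by blast
qed

lemma frakO_graphical_map: "frakO G G' (\<phi>0, h) \<in> graphical_maps G G'"
proof -
  have st: "star_class G v \<in> Emb G" "emb_verts (star_class G v) = {v}"
    "emb_bdry (star_class G v) = dagger G ` nb G v" if "v \<in> verts G" for v
    using star_class_Emb[OF G that] by auto
  have "(\<phi>0, \<lambda>v\<in>verts G. h (star_class G v)) \<in> graphical_maps G G'"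
    unfolding graphical_maps_iff[OF G G']
  proof (intro conjI ballI impI involutive)
    show "(\<lambda>v\<in>verts G. h (star_class G v)) \<in> verts G \<rightarrow>\<^sub>E Emb G'" using st h_Emb by auto
  next
    fix v w assume vw: "v \<in> verts G" "w \<in> verts G" "v \<noteq> w"
    then have "vertex_disjoint (star_class G v) (star_class G w)" using st by (simp add: vertex_disjoint_def)
    then show "emb_verts ((\<lambda>v\<in>verts G. h (star_class G v)) v) \<inter>
        emb_verts ((\<lambda>v\<in>verts G. h (star_class G v)) w) = {}"
      using h_disjoint st vw by (simp add: vertex_disjoint_def)
  next
    fix v assume v: "v \<in> verts G"
    show "inj_on \<phi>0 (dagger G ` nb G v)" using h_bdry(2)[OF st(1)[OF v]] st(3)[OF v] by simp
    show "\<phi>0 ` dagger G ` nb G v = emb_bdry ((\<lambda>v\<in>verts G. h (star_class G v)) v)"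
      using h_bdry(1)[OF st(1)[OF v]] st(3)[OF v] v by simp
  next
    assume b: "bdry G = {}"
    \<comment> \<open>Condition (c) comes from the whole graph: its image has empty boundary, hence
      is not an edge, and by \<open>h_verts\<close> its vertices come from the stars.\<close>
    let ?c = "emb_class G G (id_fun G)"
    note e = embedding_id[OF G]
    have c: "?c \<in> Emb G" "emb_bdry ?c = {}" "emb_verts ?c = verts G"
      using emb_class_Emb[OF e] emb_bdry_class[OF e] emb_verts_class[OF e] b by auto
    have "emb_verts (h ?c) \<noteq> {}"
      using Emb_admissible[OF h_Emb[OF c(1)]] h_bdry(1)[OF c(1)] c(2) by (auto simp: admissible_empty)
    then show "\<exists>v\<in>verts G. emb_verts ((\<lambda>v\<in>verts G. h (star_class G v)) v) \<noteq> {}"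
      using h_verts[OF c(1)] c(3) by auto
  qed
  then show ?thesis by (simp add: frakO_def)
qed

lemma frakN_frakO: "frakN G G' (frakO G G' (\<phi>0, h)) = (\<phi>0, h)"
proof -
  let ?\<phi>1 = "\<lambda>v\<in>verts G. h (star_class G v)"
  have O: "frakO G G' (\<phi>0, h) = (\<phi>0, ?\<phi>1)" by (simp add: frakO_def)
  interpret N: graphical G G' \<phi>0 ?\<phi>1
    using frakO_graphical_map G G' by unfold_locales (simp_all add: O)
  have "snd (frakN G G' (\<phi>0, ?\<phi>1)) = h"
  proof (rule extensionalityI[OF _ h_ext])
    show "snd (frakN G G' (\<phi>0, ?\<phi>1)) \<in> extensional (Emb G)" by (simp add: frakN_def)
    fix c assume c: "c \<in> Emb G"
    have "(\<Union>v\<in>emb_verts c. emb_verts (?\<phi>1 v)) = (\<Union>v\<in>emb_verts c. emb_verts (h (star_class G v)))"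
      using admissible_subset[OF Emb_admissible[OF c]] by (intro SUP_cong) auto
    then show "snd (frakN G G' (\<phi>0, ?\<phi>1)) c = h c"
      by (intro Emb_eqI[OF N.frakN_spec(1)[OF c] h_Emb[OF c]])
        (simp_all only: N.frakN_spec(2,3)[OF c] h_verts[OF c] h_bdry(1)[OF c])
  qed
  moreover have "fst (frakN G G' (\<phi>0, ?\<phi>1)) = \<phi>0" by (simp add: frakN_def)
  ultimately show ?thesis unfolding O by (metis prod.collapse)
qed

end

section \<open>The isomorphism of categories\<close>

lemma graphicalI:
  "connected_graph G \<Longrightarrow> connected_graph G' \<Longrightarrow> \<phi> \<in> graphical_maps G G' \<Longrightarrow> graphical G G' (fst \<phi>) (snd \<phi>)"
  by (simp add: graphical_def)

lemma new_graph_mapI: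
  "connected_graph G \<Longrightarrow> connected_graph G' \<Longrightarrow> \<phi> \<in> new_graph_maps G G' \<Longrightarrow> new_graph_map G G' (fst \<phi>) (snd \<phi>)"
  by (simp add: new_graph_map_def)

lemma involutive_comp:
  assumes "involutive_fun G G' \<phi>" "involutive_fun G' G'' \<psi>" "is_graph G"
  shows "involutive_fun G G'' (compose (arcs G) \<psi> \<phi>)"
  using assms unfolding involutive_fun_def by (auto simp: compose_eq PiE_iff)

lemma nmap_comp_new:
  fixes G G' G'' :: "('a::infinite, 'v) graph"
  assumes con: "connected_graph G" "connected_graph G'" "connected_graph G''"
    and \<phi>: "\<phi> \<in> new_graph_maps G G'" and \<psi>: "\<psi> \<in> new_graph_maps G' G''"
  shows "nmap_comp G \<psi> \<phi> \<in> new_graph_maps G G''"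
proof -
  interpret A: new_graph_map G G' "fst \<phi>" "snd \<phi>" by (rule new_graph_mapI[OF con(1,2) \<phi>])
  interpret B: new_graph_map G' G'' "fst \<psi>" "snd \<psi>" by (rule new_graph_mapI[OF con(2,3) \<psi>])
  have gG: "is_graph G" using con by simp
  have "image_mset (fst \<psi>) (image_mset (fst \<phi>) (mset_set (emb_bdry c))) =
      image_mset (compose (arcs G) (fst \<psi>) (fst \<phi>)) (mset_set (emb_bdry c))" if c: "c \<in> Emb G" for c
    unfolding multiset.map_comp
    by (rule image_mset_cong)
      (use admissible_arcs[OF gG Emb_admissible[OF c]] emb_bdry_finite[OF c] in \<open>auto simp: compose_eq\<close>)
  then have "mset_set (emb_bdry (snd \<psi> (snd \<phi> c))) =
      image_mset (compose (arcs G) (fst \<psi>) (fst \<phi>)) (mset_set (emb_bdry c))" if "c \<in> Emb G" for c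
    using that A.h_mset B.h_mset A.h_Emb by simp
  then show ?thesis
    unfolding new_graph_maps_def nmap_comp_def
    using involutive_comp[OF A.involutive B.involutive gG] A.h_Emb B.h_Emb
      A.h_edge B.h_edge A.h_union B.h_union A.h_disjoint B.h_disjoint
    by (simp add: compose_eq) (simp add: compose_def)
qed

lemma nmap_id_new:
  assumes "connected_graph G"
  shows "(\<lambda>a\<in>arcs G. a, \<lambda>c\<in>Emb G. c) \<in> new_graph_maps G G"
proof -
  have gG: "is_graph G" using assms by simp
  have "image_mset (\<lambda>a\<in>arcs G. a) (mset_set (emb_bdry c)) = image_mset id (mset_set (emb_bdry c))"
    if c: "c \<in> Emb G" for c
    by (rule image_mset_cong)
      (use admissible_arcs[OF gG Emb_admissible[OF c]] emb_bdry_finite[OF c] in auto)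
  then show ?thesis using gG unfolding new_graph_maps_def by (auto simp: involutive_fun_def)
qed

lemma cat_New_is_category: "is_category (cat_New :: (('a::infinite, 'v) graph, ('a, 'v) nmap) category)"
proof -
  have id_left: "compose A (\<lambda>x\<in>B. x) f = f" if "f \<in> A \<rightarrow>\<^sub>E B" for f :: "'x \<Rightarrow> 'x" and A B
    using that by (auto simp: compose_def fun_eq_iff PiE_iff extensional_def)
  have id_right: "compose A f (\<lambda>x\<in>A. x) = f" if "f \<in> A \<rightarrow>\<^sub>E B" for f :: "'x \<Rightarrow> 'x" and A B
    using that by (auto simp: compose_def fun_eq_iff PiE_iff extensional_def)
  have type: "fst f \<in> arcs G \<rightarrow>\<^sub>E arcs G'" "snd f \<in> Emb G \<rightarrow>\<^sub>E Emb G'" if "f \<in> new_graph_maps G G'"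
    for f and G G' :: "('a, 'v) graph"
    using that unfolding new_graph_maps_def involutive_fun_def by auto
  show ?thesis
    unfolding is_category_def cat_New_def category.simps mem_Collect_eq
  proof (intro conjI ballI)
    show "nmap_comp x g f \<in> new_graph_maps x z" if "x \<in> Collect connected_graph"
      "y \<in> Collect connected_graph" "z \<in> Collect connected_graph"
      "f \<in> new_graph_maps x y" "g \<in> new_graph_maps y z" for x y z :: "('a, 'v) graph" and f g
      using nmap_comp_new[OF _ _ _ that(4,5)] that(1-3) by simp
  next
    fix x y :: "('a, 'v) graph" and f assume f: "f \<in> new_graph_maps x y"
    note t = type[OF f]
    show "nmap_comp x f (\<lambda>a\<in>arcs x. a, \<lambda>c\<in>Emb x. c) = f"
      unfolding nmap_comp_def fst_conv snd_conv id_right[OF t(1)] id_right[OF t(2)] by simp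
    show "nmap_comp x (\<lambda>a\<in>arcs y. a, \<lambda>c\<in>Emb y. c) f = f"
      unfolding nmap_comp_def fst_conv snd_conv id_left[OF t(1)] id_left[OF t(2)] by simp
  next
    fix w x y z :: "('a, 'v) graph" and f g h
    assume "f \<in> new_graph_maps w x" "g \<in> new_graph_maps x y" "h \<in> new_graph_maps y z"
    then show "nmap_comp w (nmap_comp x h g) f = nmap_comp w h (nmap_comp w g f)"
      using type(1)[of f w x] type(2)[of f w x]
      by (auto simp: nmap_comp_def compose_def fun_eq_iff PiE_iff)
  qed (auto intro: nmap_id_new)
qed

text \<open>By \<open>frakN_spec\<close>, the class that \<open>frakN\<close> of
  \<open>\<psi>\<close> assigns to \<open>snd \<phi> v\<close> has exactly the boundary and the
  vertices that single out the composite at \<open>v\<close>. This also shows that the composite in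
  U exists.\<close>

lemma gmap_comp_frakO:
  fixes G G' G'' :: "('a::infinite, 'v) graph"
  assumes con: "connected_graph G" "connected_graph G'" "connected_graph G''"
    and \<phi>: "\<phi> \<in> graphical_maps G G'" and \<psi>: "\<psi> \<in> graphical_maps G' G''"
  shows "gmap_comp G G'' \<psi> \<phi> = frakO G G'' (nmap_comp G (frakN G' G'' \<psi>) (frakN G G' \<phi>))"
proof (rule prod_eqI)
  interpret A: graphical G G' "fst \<phi>" "snd \<phi>" by (rule graphicalI[OF con(1,2) \<phi>])
  interpret B: graphical G' G'' "fst \<psi>" "snd \<psi>" by (rule graphicalI[OF con(2,3) \<psi>])
  show "fst (gmap_comp G G'' \<psi> \<phi>) = fst (frakO G G'' (nmap_comp G (frakN G' G'' \<psi>) (frakN G G' \<phi>)))"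
    by (simp add: gmap_comp_def frakO_def nmap_comp_def frakN_def)
  show "snd (gmap_comp G G'' \<psi> \<phi>) = snd (frakO G G'' (nmap_comp G (frakN G' G'' \<psi>) (frakN G G' \<phi>)))"
  proof (rule extensionalityI[of _ "verts G"])
    fix v assume v: "v \<in> verts G"
    note st = star_class_Emb[OF con(1) v] and c = A.\<phi>1_Emb[OF v]
    have "snd (frakN G G' \<phi>) (star_class G v) = snd \<phi> v" using A.frakN_star[OF v] by simp
    then have "snd (frakO G G'' (nmap_comp G (frakN G' G'' \<psi>) (frakN G G' \<phi>))) v =
        snd (frakN G' G'' \<psi>) (snd \<phi> v)"
      using v st(1) by (simp add: frakO_def nmap_comp_def compose_eq)
    moreover have "snd (gmap_comp G G'' \<psi> \<phi>) v = snd (frakN G' G'' \<psi>) (snd \<phi> v)"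
      by (rule gmap_comp_eq[OF v]) (use B.frakN_spec[OF c] in simp_all)
    ultimately show "snd (gmap_comp G G'' \<psi> \<phi>) v =
        snd (frakO G G'' (nmap_comp G (frakN G' G'' \<psi>) (frakN G G' \<phi>))) v" by simp
  qed (simp_all add: gmap_comp_def frakO_def)
qed

lemma gmap_id_frakO:
  fixes G :: "('a::infinite, 'v) graph"
  assumes "connected_graph G"
  shows "gmap_of_emb G G (id_fun G) = frakO G G (\<lambda>a\<in>arcs G. a, \<lambda>c\<in>Emb G. c)"
  using star_class_Emb(1)[OF assms]
  by (auto simp: gmap_of_emb_def frakO_def id_fun_def fun_eq_iff restrict_def)

text \<open>The category laws of \<open>cat_U\<close> are not verified directly but carried over from
  \<open>cat_New\<close> along the bijection on morphisms.\<close>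

lemma transport_category:
  assumes D: "is_category D" and obj: "Obj C = Obj D"
    and N: "\<And>x y f. x \<in> Obj D \<Longrightarrow> y \<in> Obj D \<Longrightarrow> f \<in> Hom C x y \<Longrightarrow> N x y f \<in> Hom D x y \<and> M x y (N x y f) = f"
    and M: "\<And>x y f. x \<in> Obj D \<Longrightarrow> y \<in> Obj D \<Longrightarrow> f \<in> Hom D x y \<Longrightarrow> M x y f \<in> Hom C x y \<and> N x y (M x y f) = f"
    and id: "\<And>x. x \<in> Obj D \<Longrightarrow> Ident C x = M x x (Ident D x)"
    and cmp: "\<And>x y z f g. x \<in> Obj D \<Longrightarrow> y \<in> Obj D \<Longrightarrow> z \<in> Obj D \<Longrightarrow> f \<in> Hom C x y \<Longrightarrow> g \<in> Hom C y z \<Longrightarrow>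
      Comp C x y z g f = M x z (Comp D x y z (N y z g) (N x y f))"
  shows "is_functor C D (\<lambda>x. x) N" and "is_functor D C (\<lambda>x. x) M"
proof -
  have D1: "\<And>x. x \<in> Obj D \<Longrightarrow> Ident D x \<in> Hom D x x"
    and D2: "\<And>x y z f g. x \<in> Obj D \<Longrightarrow> y \<in> Obj D \<Longrightarrow> z \<in> Obj D \<Longrightarrow> f \<in> Hom D x y \<Longrightarrow> g \<in> Hom D y z \<Longrightarrow>
      Comp D x y z g f \<in> Hom D x z"
    and D3: "\<And>x y f. x \<in> Obj D \<Longrightarrow> y \<in> Obj D \<Longrightarrow> f \<in> Hom D x y \<Longrightarrow>
      Comp D x x y f (Ident D x) = f \<and> Comp D x y y (Ident D y) f = f"
    and D4: "\<And>w x y z f g h. w \<in> Obj D \<Longrightarrow> x \<in> Obj D \<Longrightarrow> y \<in> Obj D \<Longrightarrow> z \<in> Obj D \<Longrightarrow>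
      f \<in> Hom D w x \<Longrightarrow> g \<in> Hom D x y \<Longrightarrow> h \<in> Hom D y z \<Longrightarrow>
      Comp D w x z (Comp D x y z h g) f = Comp D w y z h (Comp D w x y g f)"
    using D unfolding is_category_def by blast+
  have C: "is_category C"
    unfolding is_category_def obj
  proof (intro conjI ballI)
    fix x assume "x \<in> Obj D"
    then show "Ident C x \<in> Hom C x x" using id M D1 by simp
  next
    fix x y z f g assume a: "x \<in> Obj D" "y \<in> Obj D" "z \<in> Obj D" "f \<in> Hom C x y" "g \<in> Hom C y z"
    show "Comp C x y z g f \<in> Hom C x z" using a cmp[OF a] M N D2 by simp
  next
    fix x y f assume a: "x \<in> Obj D" "y \<in> Obj D" "f \<in> Hom C x y"
    have I: "Ident C x \<in> Hom C x x" "Ident C y \<in> Hom C y y" using a id M D1 by simp_all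
    show "Comp C x x y f (Ident C x) = f" using a cmp[OF a(1,1,2) I(1) a(3)] id M N D1 D3 by simp
    show "Comp C x y y (Ident C y) f = f" using a cmp[OF a(1,2,2,3) I(2)] id M N D1 D3 by simp
  next
    fix w x y z f g h assume a: "w \<in> Obj D" "x \<in> Obj D" "y \<in> Obj D" "z \<in> Obj D"
      "f \<in> Hom C w x" "g \<in> Hom C x y" "h \<in> Hom C y z"
    have gf: "Comp C w x y g f \<in> Hom C w y" and hg: "Comp C x y z h g \<in> Hom C x z"
      using a cmp M N D2 by simp_all
    show "Comp C w x z (Comp C x y z h g) f = Comp C w y z h (Comp C w x y g f)"
      using a cmp[OF a(1,2,4,5) hg] cmp[OF a(1,3,4) gf a(7)] cmp[OF a(2-4,6,7)] cmp[OF a(1-3,5,6)] M N D2 D4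
      by simp
  qed
  show "is_functor C D (\<lambda>x. x) N" unfolding is_functor_def obj using C D N M id cmp D1 D2 by simp
  show "is_functor D C (\<lambda>x. x) M" unfolding is_functor_def obj using C D N M id cmp D1 D2 by simp
qed

theorem theorem4p15:
  shows "(\<forall>G G' :: ('a::infinite, 'v) graph. connected_graph G \<longrightarrow> connected_graph G' \<longrightarrow>
            bij_betw (frakN G G') (graphical_maps G G') (new_graph_maps G G') \<and>
            bij_betw (frakO G G') (new_graph_maps G G') (graphical_maps G G') \<and>
            (\<forall>\<phi>\<in>graphical_maps G G'. frakO G G' (frakN G G' \<phi>) = \<phi>) \<and>
            (\<forall>\<phi>\<in>new_graph_maps G G'. frakN G G' (frakO G G' \<phi>) = \<phi>)) \<and>
         is_functor (cat_U :: (('a, 'v) graph, ('a, 'v) gmap) category) cat_New (\<lambda>G. G) frakN \<and>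
         is_functor (cat_New :: (('a, 'v) graph, ('a, 'v) nmap) category) cat_U (\<lambda>G. G) frakO"
proof -
  have N: "frakN G G' \<phi> \<in> new_graph_maps G G'" "frakO G G' (frakN G G' \<phi>) = \<phi>"
    if "connected_graph G" "connected_graph G'" "\<phi> \<in> graphical_maps G G'"
    for G G' :: "('a, 'v) graph" and \<phi>
    using graphical.frakN_new_graph_map[OF graphicalI[OF that]] graphical.frakO_frakN[OF graphicalI[OF that]]
    by simp_all
  have O: "frakO G G' \<phi> \<in> graphical_maps G G'" "frakN G G' (frakO G G' \<phi>) = \<phi>"
    if "connected_graph G" "connected_graph G'" "\<phi> \<in> new_graph_maps G G'"
    for G G' :: "('a, 'v) graph" and \<phi>
    using new_graph_map.frakO_graphical_map[OF new_graph_mapI[OF that]]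
      new_graph_map.frakN_frakO[OF new_graph_mapI[OF that]]
    by simp_all
  have "bij_betw (frakN G G') (graphical_maps G G') (new_graph_maps G G')"
    "bij_betw (frakO G G') (new_graph_maps G G') (graphical_maps G G')"
    if "connected_graph G" "connected_graph G'" for G G' :: "('a, 'v) graph"
    using N[OF that] O[OF that]
    by (auto intro: bij_betw_byWitness[where f' = "frakO G G'"] bij_betw_byWitness[where f' = "frakN G G'"])
  moreover have "is_functor (cat_U :: (('a, 'v) graph, ('a, 'v) gmap) category) cat_New (\<lambda>G. G) frakN"
    "is_functor (cat_New :: (('a, 'v) graph, ('a, 'v) nmap) category) cat_U (\<lambda>G. G) frakO"
    by (rule transport_category[where C = cat_U and D = cat_New and N = frakN and M = frakO,
          OF cat_New_is_category];
        simp add: cat_U_def cat_New_def N O gmap_id_frakO gmap_comp_frakO)+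
  ultimately show ?thesis using N O by blast
qed

end
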